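(* Let $A_S$ be an Artin--Tits group of spherical type. If $\alpha$ belongs to a parabolic subgroup $P$ of $A_S$, and $\beta\in A_S$ is such that $\beta^m=\alpha$ for some nonzero integer $m$, then $\beta\in P$.
   Context: Artin--Tits group: let $S$ be a finite set and for all distinct $s,t\in S$ let $m(s,t)=m(t,s)\in\{2,3,\dots\}\cup\{\infty\}$. The Artin--Tits group $A_S$ is the group generated by $S$ with one relation $sts\cdots=tst\cdots$ (both sides of length $m(s,t)$) for each pair $s\ne t$ with $m(s,t)<\infty$. The Coxeter group $W_S$ is the quotient of $A_S$ by the relations $s^2=1$, $s\in S$. $A_S$ is of spherical type if $W_S$ is finite. For $X\subseteq S$, $A_X$ denotes the subgroup of $A_S$ generated by $X$ (a standard parabolic subgroup). A parabolic subgroup of $A_S$ is a subgroup of the form $\gamma A_X\gamma^{-1}$ with $X\subseteq S$ and $\gamma\in A_S$. *)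

theory Defs
  imports "HOL-Algebra.Generated_Groups" "HOL-Library.Extended_Nat"
begin

section \<open>Groups given by a presentation\<close>

text \<open>
  A word in the generators and their inverses: the letter \<open>(s, True)\<close> stands for \<open>s\<close>, the letter
  \<open>(s, False)\<close> for \<open>s\<close> inverse.
\<close>

type_synonym 'a gword = "('a \<times> bool) list"

definition gwords :: "'a set \<Rightarrow> 'a gword set" where
  "gwords S = lists (S \<times> UNIV)"

inductive pres_eq :: "'a set \<Rightarrow> ('a gword \<times> 'a gword) set \<Rightarrow> 'a gword \<Rightarrow> 'a gword \<Rightarrow> bool"
  for S R where
  refl: "u \<in> gwords S \<Longrightarrow> pres_eq S R u u"
| sym: "pres_eq S R u v \<Longrightarrow> pres_eq S R v u"
| trans: "pres_eq S R u v \<Longrightarrow> pres_eq S R v w \<Longrightarrow> pres_eq S R u w"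
| append: "pres_eq S R u u' \<Longrightarrow> pres_eq S R v v' \<Longrightarrow> pres_eq S R (u @ v) (u' @ v')"
| cancel: "s \<in> S \<Longrightarrow> pres_eq S R [(s, b), (s, \<not> b)] []"
| rel: "(u, v) \<in> R \<Longrightarrow> u \<in> gwords S \<Longrightarrow> v \<in> gwords S \<Longrightarrow> pres_eq S R u v"

definition pres_rel :: "'a set \<Rightarrow> ('a gword \<times> 'a gword) set \<Rightarrow> ('a gword \<times> 'a gword) set" where
  "pres_rel S R = {(u, v). pres_eq S R u v}"

text \<open>
  The group generated by \<open>S\<close> with one relation \<open>u = v\<close> for each pair \<open>(u, v) \<in> R\<close>. Its elements are
  equivalence classes of words.
\<close>

definition presented_group :: "'a set \<Rightarrow> ('a gword \<times> 'a gword) set \<Rightarrow> 'a gword set monoid" where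
  "presented_group S R =
    \<lparr>carrier = gwords S // pres_rel S R,
     monoid.mult = (\<lambda>A B. \<Union>a\<in>A. \<Union>b\<in>B. pres_rel S R `` {a @ b}),
     one = pres_rel S R `` {[]}\<rparr>"

definition pres_gen :: "'a set \<Rightarrow> ('a gword \<times> 'a gword) set \<Rightarrow> 'a \<Rightarrow> 'a gword set" where
  "pres_gen S R s = pres_rel S R `` {[(s, True)]}"

lemma pres_eq_gwords:
  "pres_eq S R u v \<Longrightarrow> u \<in> gwords S \<and> v \<in> gwords S"
  by (induction rule: pres_eq.induct) (auto simp: gwords_def)

lemma equiv_pres_rel: "equiv (gwords S) (pres_rel S R)"
proof (rule equivI)
  show "pres_rel S R \<subseteq> gwords S \<times> gwords S"
    using pres_eq_gwords by (auto simp: pres_rel_def)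
  show "refl_on (gwords S) (pres_rel S R)"
    by (auto simp: pres_rel_def refl_on_def intro: pres_eq.refl)
  show "Relation.sym (pres_rel S R)"
    by (auto simp: pres_rel_def sym_def intro: pres_eq.sym)
  show "Relation.trans (pres_rel S R)"
    unfolding pres_rel_def trans_def by (blast intro: pres_eq.trans)
qed

lemma congruent2_append:
  "congruent2 (pres_rel S R) (pres_rel S R) (\<lambda>a b. pres_rel S R `` {a @ b})"
proof (rule congruent2I')
  fix u u' v v'
  assume "(u, u') \<in> pres_rel S R" "(v, v') \<in> pres_rel S R"
  then have "(u @ v, u' @ v') \<in> pres_rel S R"
    by (auto simp: pres_rel_def intro: pres_eq.append)
  then show "pres_rel S R `` {u @ v} = pres_rel S R `` {u' @ v'}"
    by (rule equiv_class_eq[OF equiv_pres_rel])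
qed

lemma presented_group_mult:
  assumes "u \<in> gwords S" "v \<in> gwords S"
  shows "pres_rel S R `` {u} \<otimes>\<^bsub>presented_group S R\<^esub> pres_rel S R `` {v} = pres_rel S R `` {u @ v}"
  using UN_equiv_class2[OF equiv_pres_rel equiv_pres_rel congruent2_append assms]
  by (simp add: presented_group_def)

lemma carrier_presented_groupE:
  assumes "x \<in> carrier (presented_group S R)"
  obtains u where "u \<in> gwords S" "x = pres_rel S R `` {u}"
  using assms by (auto simp: presented_group_def elim: quotientE)

lemma class_in_presented_group:
  "u \<in> gwords S \<Longrightarrow> pres_rel S R `` {u} \<in> carrier (presented_group S R)"
  by (simp add: presented_group_def quotientI)

lemma append_in_gwords:
  "u \<in> gwords S \<Longrightarrow> v \<in> gwords S \<Longrightarrow> u @ v \<in> gwords S"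
  by (simp add: gwords_def)

lemma pres_left_inverse:
  "u \<in> gwords S \<Longrightarrow> \<exists>v \<in> gwords S. pres_eq S R (v @ u) []"
proof (induction u)
  case Nil
  then show ?case by (auto simp: gwords_def intro!: pres_eq.refl bexI[of _ "[]"])
next
  case (Cons a u)
  obtain s b where a: "a = (s, b)" by (cases a)
  have s: "s \<in> S" and u: "u \<in> gwords S" using Cons.prems a by (auto simp: gwords_def)
  obtain v where v: "v \<in> gwords S" "pres_eq S R (v @ u) []" using Cons.IH u by blast
  have "pres_eq S R ([(s, \<not> b), (s, b)] @ u) ([] @ u)"
    using pres_eq.cancel[OF s, of R "\<not> b"] pres_eq.refl[OF u] by (intro pres_eq.append) auto
  then have "pres_eq S R (v @ ([(s, \<not> b), (s, b)] @ u)) (v @ u)"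
    using pres_eq.append[OF pres_eq.refl[OF v(1)]] by fastforce
  then have "pres_eq S R ((v @ [(s, \<not> b)]) @ a # u) []"
    using v(2) a pres_eq.trans by fastforce
  moreover have "v @ [(s, \<not> b)] \<in> gwords S" using v(1) s by (simp add: gwords_def)
  ultimately show ?case by blast
qed

lemma group_presented_group: "group (presented_group S R)"
proof (rule groupI)
  let ?G = "presented_group S R"
  have Nil: "[] \<in> gwords S" by (simp add: gwords_def)
  have one: "\<one>\<^bsub>?G\<^esub> = pres_rel S R `` {[]}" by (simp add: presented_group_def)
  show "\<one>\<^bsub>?G\<^esub> \<in> carrier ?G" by (simp add: one class_in_presented_group Nil)
  show "x \<otimes>\<^bsub>?G\<^esub> y \<in> carrier ?G" if "x \<in> carrier ?G" "y \<in> carrier ?G" for x y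
    using that by (elim carrier_presented_groupE)
      (simp add: presented_group_mult append_in_gwords class_in_presented_group)
  show "x \<otimes>\<^bsub>?G\<^esub> y \<otimes>\<^bsub>?G\<^esub> z = x \<otimes>\<^bsub>?G\<^esub> (y \<otimes>\<^bsub>?G\<^esub> z)"
    if "x \<in> carrier ?G" "y \<in> carrier ?G" "z \<in> carrier ?G" for x y z
    using that by (elim carrier_presented_groupE)
      (simp add: presented_group_mult append_in_gwords)
  show "\<one>\<^bsub>?G\<^esub> \<otimes>\<^bsub>?G\<^esub> x = x" if "x \<in> carrier ?G" for x
    using that by (elim carrier_presented_groupE) (simp add: one presented_group_mult Nil)
  show "\<exists>y \<in> carrier ?G. y \<otimes>\<^bsub>?G\<^esub> x = \<one>\<^bsub>?G\<^esub>" if "x \<in> carrier ?G" for x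
  proof -
    obtain u where u: "u \<in> gwords S" "x = pres_rel S R `` {u}"
      using \<open>x \<in> carrier ?G\<close> by (rule carrier_presented_groupE)
    obtain v where v: "v \<in> gwords S" "pres_eq S R (v @ u) []"
      using pres_left_inverse[OF u(1)] by blast
    have "pres_rel S R `` {v} \<otimes>\<^bsub>?G\<^esub> x = \<one>\<^bsub>?G\<^esub>"
      unfolding u(2) one presented_group_mult[OF v(1) u(1)]
      using v(2) by (intro equiv_class_eq[OF equiv_pres_rel]) (simp add: pres_rel_def)
    then show ?thesis using class_in_presented_group[OF v(1)] by blast
  qed
qed


section \<open>Normal closure\<close>

definition normal_closure :: "('a, 'b) monoid_scheme \<Rightarrow> 'a set \<Rightarrow> 'a set" where
  "normal_closure G H = \<Inter>{N. N \<lhd> G \<and> H \<subseteq> N}"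

lemma (in group) normal_closure_normal:
  assumes "H \<subseteq> carrier G"
  shows "normal_closure G H \<lhd> G"
proof -
  let ?F = "{N. N \<lhd> G \<and> H \<subseteq> N}"
  have ne: "carrier G \<in> ?F"
    using assms subgroup_self by (auto simp: normal_inv_iff)
  have "subgroup (\<Inter>?F) G"
    using ne by (intro subgroups_Inter) (auto simp: normal_inv_iff)
  moreover have "\<forall>x\<in>carrier G. \<forall>h\<in>\<Inter>?F. x \<otimes> h \<otimes> inv x \<in> \<Inter>?F"
    by (auto simp: normal_inv_iff)
  ultimately show ?thesis
    unfolding normal_closure_def by (simp add: normal_inv_iff)
qed


section \<open>Artin--Tits groups and Coxeter groups\<close>

text \<open>The values of \<open>m\<close> on the diagonal are irrelevant.\<close>

definition artin_datum :: "'a set \<Rightarrow> ('a \<Rightarrow> 'a \<Rightarrow> enat) \<Rightarrow> bool" where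
  "artin_datum S m \<longleftrightarrow>
    finite S \<and> (\<forall>s\<in>S. \<forall>t\<in>S. s \<noteq> t \<longrightarrow> m s t = m t s \<and> 2 \<le> m s t)"

text \<open>The alternating word \<open>s t s \<dots>\<close> with \<open>n\<close> letters.\<close>

fun alt_word :: "nat \<Rightarrow> 'a \<Rightarrow> 'a \<Rightarrow> 'a gword" where
  "alt_word 0 s t = []"
| "alt_word (Suc n) s t = (s, True) # alt_word n t s"

definition artin_relations ::
    "'a set \<Rightarrow> ('a \<Rightarrow> 'a \<Rightarrow> enat) \<Rightarrow> ('a gword \<times> 'a gword) set" where
  "artin_relations S m =
    {(alt_word n s t, alt_word n t s) | n s t. s \<in> S \<and> t \<in> S \<and> s \<noteq> t \<and> m s t = enat n}"

definition artin_group :: "'a set \<Rightarrow> ('a \<Rightarrow> 'a \<Rightarrow> enat) \<Rightarrow> 'a gword set monoid" where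
  "artin_group S m = presented_group S (artin_relations S m)"

definition artin_gen :: "'a set \<Rightarrow> ('a \<Rightarrow> 'a \<Rightarrow> enat) \<Rightarrow> 'a \<Rightarrow> 'a gword set" where
  "artin_gen S m = pres_gen S (artin_relations S m)"

definition coxeter_group :: "'a set \<Rightarrow> ('a \<Rightarrow> 'a \<Rightarrow> enat) \<Rightarrow> 'a gword set set monoid" where
  "coxeter_group S m =
    artin_group S m Mod
      normal_closure (artin_group S m)
        ((\<lambda>s. artin_gen S m s [^]\<^bsub>artin_group S m\<^esub> (2::nat)) ` S)"

definition spherical_type :: "'a set \<Rightarrow> ('a \<Rightarrow> 'a \<Rightarrow> enat) \<Rightarrow> bool" where
  "spherical_type S m \<longleftrightarrow> finite (carrier (coxeter_group S m))"

definition standard_parabolic ::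
    "'a set \<Rightarrow> ('a \<Rightarrow> 'a \<Rightarrow> enat) \<Rightarrow> 'a set \<Rightarrow> 'a gword set set" where
  "standard_parabolic S m X = generate (artin_group S m) (artin_gen S m ` X)"

definition parabolic_subgroup ::
    "'a set \<Rightarrow> ('a \<Rightarrow> 'a \<Rightarrow> enat) \<Rightarrow> 'a gword set set \<Rightarrow> bool" where
  "parabolic_subgroup S m P \<longleftrightarrow>
    (\<exists>X\<subseteq>S. \<exists>\<gamma>\<in>carrier (artin_group S m).
      P = (\<lambda>x. \<gamma> \<otimes>\<^bsub>artin_group S m\<^esub> x \<otimes>\<^bsub>artin_group S m\<^esub> inv\<^bsub>artin_group S m\<^esub> \<gamma>)
            ` standard_parabolic S m X)"

lemma group_artin_group: "group (artin_group S m)"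
  by (simp add: artin_group_def group_presented_group)

lemma artin_gen_closed: "s \<in> S \<Longrightarrow> artin_gen S m s \<in> carrier (artin_group S m)"
  by (simp add: artin_gen_def pres_gen_def artin_group_def class_in_presented_group gwords_def)

lemma group_coxeter_group: "group (coxeter_group S m)"
proof -
  interpret group "artin_group S m" by (rule group_artin_group)
  show ?thesis
    unfolding coxeter_group_def
    by (intro normal.factorgroup_is_group normal_closure_normal)
      (auto simp: artin_gen_closed)
qed

end

theory Submission
  imports Defs Complex_Main
begin

text \<open>
  After a conjugation, a power of \<open>\<beta>\<close> lies in the standard parabolic subgroup \<open>A\<^sub>X\<close>. The group is a
  lattice for left divisibility. The lower bounds of elements of \<open>A\<^sub>X\<close> form an ideal, which
  determines \<open>A\<^sub>X\<close> as its stabiliser, and the translates of this ideal by the powers of \<open>\<beta>\<close> are finite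
  in number. Their intersection \<open>M\<close> is a \<open>\<beta>\<close>-invariant ideal. Above a given point of \<open>M\<close>, the position of
  a point relative to the translates takes only finitely many values, so that one value occurs
  cofinally. Two points of \<open>M\<close> with the same position differ by a positive element that a
  positive element conjugates into \<open>A\<^sub>X\<close>, and then all its letters are conjugated into \<open>A\<^sub>X\<close>. Hence \<open>M\<close> is
  the ideal of a coset of some \<open>A\<^sub>Y\<close>, its stabiliser is a conjugate of \<open>A\<^sub>Y\<close> contained in \<open>A\<^sub>X\<close>, and it
  contains \<open>\<beta>\<close>.

  The lattice property comes from the finite Coxeter group: the weak order is a lattice, and the
  positive monoid acts on the Coxeter group by taking greatest simple prefixes (Michel), which makes
  the monoid cancellative and embeds it in the group.

  Groups are written additively, as instances of the class of not necessarily commutative groups.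
\<close>

text \<open>The obstacle is that invariance under conjugation is too weak. \<open>\<beta>\<close>
  normalises the intersection of the conjugates of \<open>A_X\<close> by its powers, but an element
  normalising a parabolic subgroup need not belong to it, as central elements show. Ideals remember
  the order. If \<open>M\<close> consists of the elements below a coset \<open>q A_Y\<close> and is
  mapped onto itself by \<open>\<beta>\<close>, then \<open>q^-1 \<beta> q\<close> divides some
  positive \<open>y\<close> in \<open>A_Y\<close>, and the quotient is a factor of a positive
  element of \<open>A_Y\<close>. Such factors stay in \<open>A_Y\<close>, so stabilising
  \<open>M\<close> already means membership.

  Positions are finite in number because the bound at one point of \<open>M\<close> may be chosen
  quasi-central: it moves past positive elements, and so bounds the complements at every higher
  point.

  The geometric representation supplies what the presentation does not show directly: no power of
  \<open>s t\<close> below \<open>m(s,t)\<close> is trivial in the Coxeter group.\<close>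

section \<open>Joins from local joins\<close>

text \<open>The criterion of Bjorner, Edelman and Ziegler.\<close>

lemma local_join_imp_join:
  fixes le C :: "'b \<Rightarrow> 'b \<Rightarrow> bool" and rk :: "'b \<Rightarrow> 'b \<Rightarrow> nat"
  assumes refl: "\<And>a. le a a"
    and trans: "\<And>a b c. le a b \<Longrightarrow> le b c \<Longrightarrow> le a c"
    and step: "\<And>a b. C a b \<Longrightarrow> le a b"
    and cover: "\<And>a x. le a x \<Longrightarrow> a \<noteq> x \<Longrightarrow> \<exists>b. C a b \<and> le b x"
    and rank: "\<And>a b z. C a b \<Longrightarrow> le b z \<Longrightarrow> rk b z < rk a z"
    and local: "\<And>a x y z. C a x \<Longrightarrow> C a y \<Longrightarrow> le x z \<Longrightarrow> le y z \<Longrightarrow>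
      \<exists>j. le x j \<and> le y j \<and> (\<forall>u. le x u \<longrightarrow> le y u \<longrightarrow> le u z \<longrightarrow> le j u)"
    and "le a x" "le a y" "le x z" "le y z"
  shows "\<exists>j. le x j \<and> le y j \<and> (\<forall>u. le x u \<longrightarrow> le y u \<longrightarrow> le u z \<longrightarrow> le j u)"
  using assms(7-10)
proof (induction "rk a z" arbitrary: a x y rule: less_induct)
  case less
  note az = less.prems
  consider "x = a" | "y = a" | "x \<noteq> a" "y \<noteq> a" by blast
  then show ?case
  proof cases
    case 1 then show ?thesis using az refl by blast
  next
    case 2 then show ?thesis using az refl by blast
  next
    case 3
    obtain x1 where x1: "C a x1" "le x1 x" using cover az(1) 3(1) by metis
    obtain y1 where y1: "C a y1" "le y1 y" using cover az(2) 3(2) by metis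
    have x1z: "le x1 z" and y1z: "le y1 z" using x1 y1 az trans by blast+
    obtain j where j: "le x1 j" "le y1 j" "\<And>u. le x1 u \<Longrightarrow> le y1 u \<Longrightarrow> le u z \<Longrightarrow> le j u"
      using local[OF x1(1) y1(1) x1z y1z] by blast
    have jz: "le j z" using j(3) x1z y1z refl by blast
    \<comment> \<open>The join is assembled from three joins over base points of smaller rank:
      \<open>p\<close> of \<open>x\<close> and \<open>j\<close> over \<open>x1\<close>,
      \<open>q\<close> of \<open>y\<close> and \<open>j\<close> over \<open>y1\<close>, and
      \<open>r\<close> of \<open>p\<close> and \<open>q\<close> over \<open>x1\<close>.\<close>
    obtain p where p: "le x p" "le j p" "\<And>u. le x u \<Longrightarrow> le j u \<Longrightarrow> le u z \<Longrightarrow> le p u"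
      using less.hyps[OF rank[OF x1(1) x1z] x1(2) j(1) az(3) jz] by blast
    obtain q where q: "le y q" "le j q" "\<And>u. le y u \<Longrightarrow> le j u \<Longrightarrow> le u z \<Longrightarrow> le q u"
      using less.hyps[OF rank[OF y1(1) y1z] y1(2) j(2) az(4) jz] by blast
    have pz: "le p z" and qz: "le q z" using p(3) q(3) az jz refl by blast+
    obtain r where r: "le p r" "le q r" "\<And>u. le p u \<Longrightarrow> le q u \<Longrightarrow> le u z \<Longrightarrow> le r u"
      using less.hyps[OF rank[OF x1(1) x1z] trans[OF j(1) p(2)] trans[OF j(1) q(2)] pz qz] by blast
    have "le r u" if u: "le x u" "le y u" "le u z" for u
    proof -
      have "le j u" using j(3) x1(2) y1(2) u trans by blast
      then show ?thesis using p(3) q(3) r(3) u by blast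
    qed
    then show ?thesis using r p q trans by blast
  qed
qed

section \<open>Roots in groups with a Garside structure\<close>

primrec nmul :: "nat \<Rightarrow> 'g::monoid_add \<Rightarrow> 'g" where
  "nmul 0 a = 0"
| "nmul (Suc n) a = a + nmul n a"

lemma nmul_add: "nmul (i + j) a = nmul i a + nmul j a"
  by (induction i) (simp_all add: add.assoc)

lemma nmul_Suc_right: "nmul (Suc i) a = nmul i a + a"
  by (induction i) (simp_all add: add.assoc[symmetric])

inductive_set mspan :: "'g::group_add set \<Rightarrow> 'g set" for X where
  mon_zero: "0 \<in> mspan X"
| mon_add: "s \<in> X \<Longrightarrow> a \<in> mspan X \<Longrightarrow> s + a \<in> mspan X"

inductive_set gspan :: "'g::group_add set \<Rightarrow> 'g set" for X where
  grp_zero: "0 \<in> gspan X"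
| grp_add: "s \<in> X \<Longrightarrow> a \<in> gspan X \<Longrightarrow> s + a \<in> gspan X"
| grp_minus: "s \<in> X \<Longrightarrow> a \<in> gspan X \<Longrightarrow> - s + a \<in> gspan X"

lemmas group_simps = add.assoc minus_add diff_conv_add_uminus

lemma mon_gen: "s \<in> X \<Longrightarrow> s \<in> mspan X"
  using mon_add[OF _ mon_zero] by fastforce

lemma mon_plus: "a \<in> mspan X \<Longrightarrow> b \<in> mspan X \<Longrightarrow> a + b \<in> mspan X"
  by (induction rule: mspan.induct) (auto simp: add.assoc intro: mon_add)

lemma mon_mono: "a \<in> mspan X \<Longrightarrow> X \<subseteq> Y \<Longrightarrow> a \<in> mspan Y"
  by (induction rule: mspan.induct) (auto intro: mspan.intros)

lemma mon_snoc: "s \<in> X \<Longrightarrow> a \<in> mspan X \<Longrightarrow> a + s \<in> mspan X"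
  by (simp add: mon_plus mon_gen)

lemma mon_rev_induct [consumes 1, case_names zero snoc]:
  assumes "a \<in> mspan X" "Q 0" "\<And>a s. a \<in> mspan X \<Longrightarrow> s \<in> X \<Longrightarrow> Q a \<Longrightarrow> Q (a + s)"
  shows "Q a"
proof -
  have "\<forall>b \<in> mspan X. Q b \<longrightarrow> Q (b + a)"
    using assms(1)
  proof (induction rule: mspan.induct)
    case mon_zero
    then show ?case by simp
  next
    case (mon_add s a)
    then show ?case using assms(3) mon_snoc by (metis add.assoc)
  qed
  then show ?thesis using assms(2) mon_zero by fastforce
qed

lemma mon_last:
  assumes "a \<in> mspan X" "a \<noteq> 0"
  obtains s b where "s \<in> X" "b \<in> mspan X" "a = b + s"
  using assms by (induction rule: mon_rev_induct) auto

lemma mon_first: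
  assumes "a \<in> mspan X" "a \<noteq> 0"
  obtains s b where "s \<in> X" "b \<in> mspan X" "a = s + b"
  using assms by (cases rule: mspan.cases) auto

lemma grp_plus: "a \<in> gspan X \<Longrightarrow> b \<in> gspan X \<Longrightarrow> a + b \<in> gspan X"
  by (induction rule: gspan.induct) (auto simp: add.assoc intro: gspan.intros)

lemma mon_grp: "a \<in> mspan X \<Longrightarrow> a \<in> gspan X"
  by (induction rule: mspan.induct) (auto intro: gspan.intros)

lemma grp_gen: "s \<in> X \<Longrightarrow> s \<in> gspan X"
  by (simp add: mon_grp mon_gen)

lemma grp_neg: "a \<in> gspan X \<Longrightarrow> - a \<in> gspan X"
proof (induction rule: gspan.induct)
  case grp_zero then show ?case by (simp add: gspan.grp_zero)
next
  case (grp_add s a)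
  have "- s \<in> gspan X" using grp_minus[OF grp_add(1) gspan.grp_zero] by simp
  then show ?case using grp_add grp_plus by (simp add: minus_add del: add_uminus_conv_diff)
next
  case (grp_minus s a)
  then show ?case by (metis minus_add minus_minus grp_plus grp_gen)
qed

lemma grp_diff: "a \<in> gspan X \<Longrightarrow> b \<in> gspan X \<Longrightarrow> a - b \<in> gspan X"
  using grp_plus[OF _ grp_neg] by fastforce

lemma grp_mono: "a \<in> gspan X \<Longrightarrow> X \<subseteq> Y \<Longrightarrow> a \<in> gspan Y"
  by (induction rule: gspan.induct) (auto intro: gspan.intros)

lemma grp_conj:
  assumes "a \<in> gspan X" "\<And>s. s \<in> X \<Longrightarrow> - b + s + b \<in> gspan Y"
  shows "- b + a + b \<in> gspan Y"
  using assms(1)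
proof (induction rule: gspan.induct)
  case grp_zero then show ?case by (simp add: gspan.grp_zero)
next
  case (grp_add s a)
  have "- b + (s + a) + b = (- b + s + b) + (- b + a + b)" by (simp add: group_simps)
  then show ?case using grp_plus assms(2) grp_add by metis
next
  case (grp_minus s a)
  have "- b + (- s + a) + b = - (- b + s + b) + (- b + a + b)"
    by (simp add: group_simps del: add_uminus_conv_diff)
  then show ?case using grp_plus grp_neg assms(2) grp_minus by metis
qed

lemma mon_conj:
  assumes "a \<in> mspan X" "\<And>s. s \<in> X \<Longrightarrow> - b + s + b \<in> Y"
  shows "- b + a + b \<in> mspan Y"
  using assms(1)
proof (induction rule: mspan.induct)
  case mon_zero then show ?case by (simp add: mspan.mon_zero)
next
  case (mon_add s a)
  have "- b + (s + a) + b = (- b + s + b) + (- b + a + b)" by (simp add: group_simps)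
  then show ?case using mspan.mon_add assms(2) mon_add by metis
qed

text \<open>\<open>D X\<close> is the Garside element of the submonoid generated by \<open>X\<close>. The assumption \<open>D_fold\<close> is the
  folding condition of the Coxeter group, lifted to divisors of the ribbon \<open>D (insert t X) - D X\<close>.\<close>

locale garside_group =
  fixes S :: "'g::group_add set" and D :: "'g set \<Rightarrow> 'g" and len :: "'g \<Rightarrow> nat"
  assumes fin: "finite S"
    and len_gen: "s \<in> S \<Longrightarrow> len s = 1"
    and len_add: "a \<in> mspan S \<Longrightarrow> b \<in> mspan S \<Longrightarrow> len (a + b) = len a + len b"
    and gen_lcm: "s \<in> S \<Longrightarrow> t \<in> S \<Longrightarrow> s \<noteq> t \<Longrightarrow>
      \<exists>j. - s + j \<in> mspan S \<and> - t + j \<in> mspan S \<and>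
        (\<forall>d. - s + d \<in> mspan S \<longrightarrow> - t + d \<in> mspan S \<longrightarrow> - j + d \<in> mspan S)"
    and factors: "X \<subseteq> S \<Longrightarrow> a \<in> mspan S \<Longrightarrow> b \<in> mspan S \<Longrightarrow> a + b \<in> mspan X \<Longrightarrow> a \<in> mspan X \<and> b \<in> mspan X"
    and D_mon: "X \<subseteq> S \<Longrightarrow> D X \<in> mspan X"
    and D_conj: "X \<subseteq> S \<Longrightarrow> s \<in> X \<Longrightarrow> - D X + s + D X \<in> X"
    and D_left: "X \<subseteq> S \<Longrightarrow> s \<in> X \<Longrightarrow> - s + D X \<in> mspan S"
    and D_unique: "X \<subseteq> S \<Longrightarrow> d \<in> mspan S \<Longrightarrow> D X - d \<in> mspan S \<Longrightarrow> (\<And>s. s \<in> X \<Longrightarrow> d - s \<in> mspan S) \<Longrightarrow> d = D X"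
    and D_squarefree: "X \<subseteq> S \<Longrightarrow> a \<in> mspan S \<Longrightarrow> b \<in> mspan S \<Longrightarrow> s \<in> S \<Longrightarrow> a + s + s + b \<noteq> D X"
    and D_fold: "X \<subseteq> S \<Longrightarrow> t \<in> S \<Longrightarrow> p \<in> mspan S \<Longrightarrow> p' \<in> mspan S \<Longrightarrow>
      D (insert t X) - D X - p \<in> mspan S \<Longrightarrow> D (insert t X) - D X - p' \<in> mspan S \<Longrightarrow>
      x \<in> X \<Longrightarrow> q \<in> S \<Longrightarrow> q + p = p' + x \<Longrightarrow> p = p'"
begin

section \<open>Length, left and right divisibility\<close>

abbreviation le (infix \<open>\<preceq>\<close> 50) where "a \<preceq> b \<equiv> - a + b \<in> mspan S"
abbreviation ler (infix \<open>\<preceq>\<^sub>r\<close> 50) where "a \<preceq>\<^sub>r b \<equiv> b - a \<in> mspan S"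

lemma len_zero: "len 0 = 0"
  using len_add[OF mon_zero mon_zero] by simp

lemma len_eq_0: "a \<in> mspan S \<Longrightarrow> len a = 0 \<Longrightarrow> a = 0"
  by (erule mspan.cases) (auto simp: len_add len_gen mon_gen)

lemma len_eq_1: "a \<in> mspan S \<Longrightarrow> len a = 1 \<Longrightarrow> a \<in> S"
  by (erule mspan.cases) (auto simp: len_add len_gen mon_gen len_zero dest!: len_eq_0)

lemma gen_in_mon:
  assumes "X \<subseteq> S" "t \<in> S" "t \<in> mspan X" shows "t \<in> X"
  using assms(3)
proof (cases rule: mspan.cases)
  case mon_zero
  then show ?thesis using len_gen[OF assms(2)] len_zero by simp
next
  case (mon_add s a)
  have a: "a \<in> mspan S" and s: "s \<in> S" using mon_mono[OF mon_add(3) assms(1)] mon_add(2) assms(1) by auto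
  have "len a = 0" using len_add[OF mon_gen[OF s] a] len_gen[OF s] len_gen[OF assms(2)] mon_add by simp
  then show ?thesis using len_eq_0[OF a] mon_add by simp
qed

lemma le_trans: "a \<preceq> b \<Longrightarrow> b \<preceq> c \<Longrightarrow> a \<preceq> c"
  using mon_plus[of "- a + b" S "- b + c"] by (simp add: add.assoc)

lemma ler_trans: "a \<preceq>\<^sub>r b \<Longrightarrow> b \<preceq>\<^sub>r c \<Longrightarrow> a \<preceq>\<^sub>r c"
  using mon_plus[of "c - b" S "b - a"] by (simp add: add_diff_eq)

lemma mon_le_pos: "X \<subseteq> S \<Longrightarrow> a \<in> mspan X \<Longrightarrow> a \<in> mspan S"
  using mon_mono .

lemma D_left_mon: "X \<subseteq> S \<Longrightarrow> s \<in> X \<Longrightarrow> - s + D X \<in> mspan X"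
  using factors[of X s "- s + D X"] D_left[of X s] D_mon[of X] mon_gen[of s S] by auto

section \<open>Garside elements and quasi-central bounds\<close>

lemma D_conj':
  assumes "X \<subseteq> S" "s \<in> X" shows "D X + s - D X \<in> X"
proof -
  let ?f = "\<lambda>s. - D X + s + D X"
  have "inj_on ?f X" by (auto simp: inj_on_def)
  then have "?f ` X = X"
    using D_conj[OF assms(1)] finite_subset[OF assms(1) fin] by (intro endo_inj_surj) auto
  then obtain s' where s': "s' \<in> X" "s = - D X + s' + D X" using assms(2) by blast
  then have "D X + s - D X = s'" by (simp add: group_simps del: add_uminus_conv_diff)
  then show ?thesis using s' by simp
qed

lemma D_right:
  assumes "X \<subseteq> S" "s \<in> X" shows "s \<preceq>\<^sub>r D X"
proof -
  have "- (D X + s - D X) + D X = D X - s" by (simp add: group_simps del: add_uminus_conv_diff)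
  then show ?thesis using D_left[OF assms(1) D_conj'[OF assms]] by simp
qed

text \<open>Positive elements whose conjugation permutes \<open>X\<close>, such as multiples of
  \<open>D X\<close>. Elements of \<open>mspan X\<close> can be moved past them in both directions,
  so they serve as common bounds.\<close>

definition quasi :: "'g set \<Rightarrow> 'g set" where
  "quasi X = {u \<in> mspan X. \<forall>s\<in>X. - u + s + u \<in> X \<and> u + s - u \<in> X}"

lemma quasi_mon: "u \<in> quasi X \<Longrightarrow> u \<in> mspan X"
  by (simp add: quasi_def)

lemma quasi_conj1: "u \<in> quasi X \<Longrightarrow> a \<in> mspan X \<Longrightarrow> - u + a + u \<in> mspan X"
  by (rule mon_conj) (auto simp: quasi_def)

lemma quasi_conj2: "u \<in> quasi X \<Longrightarrow> a \<in> mspan X \<Longrightarrow> u + a - u \<in> mspan X"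
  using mon_conj[of a X "- u" X] by (auto simp: quasi_def)

lemma quasi_D: "X \<subseteq> S \<Longrightarrow> D X \<in> quasi X"
  by (auto simp: quasi_def D_mon D_conj D_conj')

lemma quasi_zero: "0 \<in> quasi X"
  by (auto simp: quasi_def mon_zero)

lemma quasi_add:
  assumes "u \<in> quasi X" "v \<in> quasi X" shows "u + v \<in> quasi X"
proof -
  have "- (u + v) + s + (u + v) = - v + (- u + s + u) + v"
    "(u + v) + s - (u + v) = u + (v + s - v) - u" for s
    by (simp_all add: group_simps del: add_uminus_conv_diff)
  then show ?thesis using assms by (auto simp: quasi_def mon_plus)
qed

text \<open>In the left divisibility order of \<open>mspan X\<close>: \<open>- w\<close> is below
  \<open>g\<close> and \<open>g\<close> is below \<open>w\<close>.\<close>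

definition bounds :: "'g set \<Rightarrow> 'g \<Rightarrow> 'g \<Rightarrow> bool" where
  "bounds X w g \<longleftrightarrow> w + g \<in> mspan X \<and> - g + w \<in> mspan X"

lemma bounds_add:
  assumes "bounds X w g" "w \<in> quasi X" "v \<in> quasi X"
  shows "bounds X (w + v) g" "bounds X (v + w) g"
proof -
  have e: "w + v + g = (w + v - w) + (w + g)" "- g + (v + w) = (- g + w) + (- w + v + w)"
    by (simp_all add: group_simps del: add_uminus_conv_diff)
  have b: "w + g \<in> mspan X" "- g + w \<in> mspan X" using assms(1) by (auto simp: bounds_def)
  have v: "v \<in> mspan X" using assms(3) by (rule quasi_mon)
  have "- g + (w + v) = (- g + w) + v" "v + w + g = v + (w + g)" by (simp_all only: add.assoc)
  then show "bounds X (w + v) g" "bounds X (v + w) g"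
    unfolding bounds_def e
    using mon_plus[OF quasi_conj2[OF assms(2) v] b(1)] mon_plus[OF b(2) v] mon_plus[OF v b(1)]
      mon_plus[OF b(2) quasi_conj1[OF assms(2) v]] by auto
qed

text \<open>When \<open>s\<close> is put in front of \<open>b\<close>, the bound \<open>u\<close>
  becomes \<open>D X + u\<close>: the complement of \<open>s\<close> in \<open>D X\<close> is
  conjugated by \<open>u\<close> to the right-hand end.\<close>

lemma mon_le_quasi:
  assumes X: "X \<subseteq> S" and "b \<in> mspan X"
  shows "\<exists>u \<in> quasi X. - b + u \<in> mspan X \<and> u - b \<in> mspan X"
  using assms(2)
proof (induction rule: mspan.induct)
  case mon_zero
  then show ?case using quasi_zero mspan.mon_zero by fastforce
next
  case (mon_add s b)
  then obtain u where u: "u \<in> quasi X" "- b + u \<in> mspan X" by blast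
  let ?v = "u + D X"
  have v: "?v \<in> quasi X" using quasi_add quasi_D X u by simp
  have c: "- s + D X \<in> mspan X" using D_left_mon X mon_add by simp
  have "- (s + b) + (D X + u) = - b + u + (- u + (- s + D X) + u)" by (simp add: group_simps del: add_uminus_conv_diff)
  then have 1: "- (s + b) + (D X + u) \<in> mspan X" using mon_plus[OF u(2) quasi_conj1[OF u(1) c]] by simp
  have w: "D X + u \<in> quasi X" using quasi_add quasi_D X u by simp
  have "D X + u - (s + b) = (D X + u) + (- (s + b) + (D X + u)) - (D X + u)"
    by (simp add: group_simps del: add_uminus_conv_diff)
  then have "D X + u - (s + b) \<in> mspan X" using quasi_conj2[OF w 1] by simp
  then show ?case using 1 w by blast
qed

text \<open>A negative letter is \<open>- s = (- s + D X) - D X\<close>; conjugating the numerator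
  moves the last \<open>D X\<close> into the denominator.\<close>

lemma grp_fraction:
  assumes X: "X \<subseteq> S" and "g \<in> gspan X"
  shows "\<exists>a \<in> mspan X. \<exists>b \<in> mspan X. g = a - b"
  using assms(2)
proof (induction rule: gspan.induct)
  case grp_zero
  then show ?case using mon_zero by fastforce
next
  case (grp_add s g)
  then obtain a b where "a \<in> mspan X" "b \<in> mspan X" "g = a - b" by blast
  then show ?case using mon_add[OF grp_add(1)] by (metis add_diff_eq)
next
  case (grp_minus s g)
  then obtain a b where ab: "a \<in> mspan X" "b \<in> mspan X" "g = a - b" by blast
  have "- s + g = ((- s + D X) + (- D X + a + D X)) - (b + D X)"
    unfolding ab by (simp add: group_simps del: add_uminus_conv_diff)
  moreover have "(- s + D X) + (- D X + a + D X) \<in> mspan X"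
    using mon_plus[OF D_left_mon[OF X grp_minus(1)] quasi_conj1[OF quasi_D[OF X] ab(1)]] .
  ultimately show ?case using mon_plus[OF ab(2) D_mon[OF X]] by (intro bexI)
qed

lemma ex_bounds:
  assumes X: "X \<subseteq> S" and g: "g \<in> gspan X"
  shows "\<exists>w \<in> quasi X. bounds X w g"
proof -
  obtain a b where ab: "a \<in> mspan X" "b \<in> mspan X" "g = a - b" using grp_fraction[OF assms] by blast
  obtain u where u: "u \<in> quasi X" "- a + u \<in> mspan X" "u - a \<in> mspan X" using mon_le_quasi[OF X ab(1)] by blast
  obtain v where v: "v \<in> quasi X" "- b + v \<in> mspan X" "v - b \<in> mspan X" using mon_le_quasi[OF X ab(2)] by blast
  have "u + v + g = (u + (v + a - v) - u) + (u + (v - b) - u) + u"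
    unfolding ab by (simp add: group_simps del: add_uminus_conv_diff)
  moreover have "(u + (v + a - v) - u) + (u + (v - b) - u) + u \<in> mspan X"
    by (intro mon_plus quasi_conj2 u v ab quasi_mon)
  ultimately have "u + v + g \<in> mspan X" by simp
  moreover have "- g + (u + v) = b + (- a + u) + v"
    unfolding ab by (simp add: group_simps del: add_uminus_conv_diff)
  then have "- g + (u + v) \<in> mspan X" using mon_plus[OF mon_plus[OF ab(2) u(2)] quasi_mon[OF v(1)]] by simp
  ultimately show ?thesis using quasi_add[OF u(1) v(1)] unfolding bounds_def by blast
qed

lemma ex_bounds_finite:
  assumes X: "X \<subseteq> S" and "finite F" "F \<subseteq> gspan X"
  shows "\<exists>w \<in> quasi X. \<forall>g\<in>F. bounds X w g"
  using assms(2,3)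
proof (induction rule: finite_induct)
  case empty
  then show ?case using quasi_zero by blast
next
  case (insert g F)
  then obtain w where w: "w \<in> quasi X" "\<forall>g\<in>F. bounds X w g" by auto
  obtain v where v: "v \<in> quasi X" "bounds X v g" using ex_bounds[OF X] insert by blast
  have "bounds X (w + v) x" if "x \<in> insert g F" for x
    using that w v bounds_add(1)[OF _ w(1) v(1)] bounds_add(2)[OF v(2) v(1) w(1)] by blast
  then show ?case using quasi_add[OF w(1) v(1)] by blast
qed

text \<open>If \<open>g = a - b\<close>, then \<open>g + b = a\<close> lies in
  \<open>mspan X\<close>, which contains the positive factors of its elements.\<close>

lemma grp_pos: "X \<subseteq> S \<Longrightarrow> g \<in> gspan X \<Longrightarrow> g \<in> mspan S \<Longrightarrow> g \<in> mspan X"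
proof -
  assume X: "X \<subseteq> S" and g: "g \<in> gspan X" "g \<in> mspan S"
  obtain a b where "a \<in> mspan X" "b \<in> mspan X" "g = a - b" using grp_fraction[OF X g(1)] by blast
  then show "g \<in> mspan X" using factors[OF X g(2), of b] mon_le_pos[OF X] by simp
qed

section \<open>Joins and meets for divisibility\<close>

lemma upper_in_grp: "g \<in> gspan S \<Longrightarrow> g \<preceq> u \<Longrightarrow> u \<in> gspan S"
  using grp_plus[OF _ mon_grp, of g S "- g + u"] by simp

lemma lower_in_grp: "g \<in> gspan S \<Longrightarrow> u \<preceq> g \<Longrightarrow> u \<in> gspan S"
proof -
  assume g: "g \<in> gspan S" and u: "u \<preceq> g"
  have "g - (- u + g) \<in> gspan S" using grp_diff[OF g mon_grp[OF u]] .
  then show "u \<in> gspan S" by (simp add: group_simps del: add_uminus_conv_diff)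
qed

lemma bounded_join:
  assumes "a \<preceq> x" "a \<preceq> y" "x \<preceq> z" "y \<preceq> z"
  shows "\<exists>j. x \<preceq> j \<and> y \<preceq> j \<and> (\<forall>u. x \<preceq> u \<longrightarrow> y \<preceq> u \<longrightarrow> u \<preceq> z \<longrightarrow> j \<preceq> u)"
proof (rule local_join_imp_join[where le = "(\<preceq>)" and C = "\<lambda>a b. \<exists>s\<in>S. b = a + s"
      and rk = "\<lambda>a z. len (- a + z)"])
  show "a \<preceq> a" for a by (simp add: mon_zero)
  show "a \<preceq> b \<Longrightarrow> b \<preceq> c \<Longrightarrow> a \<preceq> c" for a b c by (rule le_trans)
  show "\<exists>s\<in>S. b = a + s \<Longrightarrow> a \<preceq> b" for a b by (auto simp: mon_gen)
  show "\<exists>b. (\<exists>s\<in>S. b = a + s) \<and> b \<preceq> x" if ax: "a \<preceq> x" "a \<noteq> x" for a x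
  proof -
    have "- a + x \<noteq> 0" using ax(2) by (metis add.right_neutral add_minus_cancel)
    then obtain s b where s: "s \<in> S" "b \<in> mspan S" "- a + x = s + b" using mon_first ax(1) by metis
    then have "- (a + s) + x = b" by (simp add: group_simps del: add_uminus_conv_diff)
    then show ?thesis using s by blast
  qed
  show "len (- b + z) < len (- a + z)" if ab: "\<exists>s\<in>S. b = a + s" "b \<preceq> z" for a b z
  proof -
    obtain s where s: "s \<in> S" "b = a + s" using ab by blast
    then have "- a + z = s + (- b + z)" by (simp add: group_simps del: add_uminus_conv_diff)
    then show ?thesis using len_add[OF mon_gen[OF s(1)] ab(2)] len_gen s by simp
  qed
  show "\<exists>j. x \<preceq> j \<and> y \<preceq> j \<and> (\<forall>u. x \<preceq> u \<longrightarrow> y \<preceq> u \<longrightarrow> u \<preceq> z \<longrightarrow> j \<preceq> u)"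
    if xy: "\<exists>s\<in>S. x = a + s" "\<exists>s\<in>S. y = a + s" for a x y z
  proof -
    obtain s t where st: "s \<in> S" "t \<in> S" "x = a + s" "y = a + t" using xy by blast
    show ?thesis
    proof (cases "s = t")
      case True
      then show ?thesis using st by (auto intro!: exI[of _ x] simp: mon_zero)
    next
      case False
      obtain j where j: "s \<preceq> j" "t \<preceq> j" "\<And>d. s \<preceq> d \<Longrightarrow> t \<preceq> d \<Longrightarrow> j \<preceq> d"
        using gen_lcm[OF st(1,2) False] by blast
      have sh: "- (a + v) + w = - v + (- a + w)" for v w by (simp add: group_simps del: add_uminus_conv_diff)
      show ?thesis unfolding st
        using j by (intro exI[of _ "a + j"]) (auto simp: sh)
    qed
  qed
qed (fact assms)+

text \<open>\<open>bounded_join\<close> only compares with upper bounds below a fixed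
  \<open>w\<close>. An arbitrary upper bound \<open>u\<close> is reached through the join
  \<open>k\<close> relative to a common bound \<open>z\<close> of \<open>u\<close> and
  \<open>w\<close>: it lies below both, so \<open>j\<close> precedes \<open>k\<close> and hence
  \<open>u\<close>.\<close>

lemma ex_join:
  assumes "x \<in> gspan S" "y \<in> gspan S"
  shows "\<exists>j. x \<preceq> j \<and> y \<preceq> j \<and> (\<forall>u. x \<preceq> u \<longrightarrow> y \<preceq> u \<longrightarrow> j \<preceq> u)"
proof -
  obtain w where w: "w \<in> quasi S" "bounds S w x" "bounds S w y"
    using ex_bounds_finite[of S "{x, y}"] assms by auto
  have lo: "- w \<preceq> x" "- w \<preceq> y" and up: "x \<preceq> w" "y \<preceq> w" using w by (auto simp: bounds_def)
  obtain j where j: "x \<preceq> j" "y \<preceq> j" "\<And>u. x \<preceq> u \<Longrightarrow> y \<preceq> u \<Longrightarrow> u \<preceq> w \<Longrightarrow> j \<preceq> u"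
    using bounded_join[OF lo up] by blast
  have "j \<preceq> u" if u: "x \<preceq> u" "y \<preceq> u" for u
  proof -
    have ug: "u \<in> gspan S" "w \<in> gspan S" using upper_in_grp[OF assms(1)] u(1) up(1) by blast+
    obtain z where z: "u \<preceq> z" "w \<preceq> z"
      using ex_bounds_finite[of S "{u, w}"] ug by (auto simp: bounds_def)
    obtain k where k: "x \<preceq> k" "y \<preceq> k" "\<And>u. x \<preceq> u \<Longrightarrow> y \<preceq> u \<Longrightarrow> u \<preceq> z \<Longrightarrow> k \<preceq> u"
      using bounded_join[OF lo le_trans[OF up(1) z(2)] le_trans[OF up(2) z(2)]] by blast
    have "k \<preceq> u" "k \<preceq> w" using k(3) u up z by blast+
    then show ?thesis using j(3)[OF k(1,2)] le_trans by blast
  qed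
  then show ?thesis using j by blast
qed

text \<open>Among the common lower bounds above \<open>- w\<close>, one of greatest length measured
  from \<open>- w\<close> is the meet: its join with another lower bound is again a lower bound and
  cannot be longer.\<close>

lemma ex_meet:
  assumes "x \<in> gspan S" "y \<in> gspan S"
  shows "\<exists>j. j \<preceq> x \<and> j \<preceq> y \<and> (\<forall>u. u \<preceq> x \<longrightarrow> u \<preceq> y \<longrightarrow> u \<preceq> j)"
proof -
  obtain w where w: "bounds S w x" "bounds S w y"
    using ex_bounds_finite[of S "{x, y}"] assms by auto
  define Q where "Q l \<longleftrightarrow> - w \<preceq> l \<and> l \<preceq> x \<and> l \<preceq> y" for l
  have Qw: "Q (- w)" using w by (auto simp: bounds_def Q_def mon_zero)
  have len_split: "len (w + b) = len (w + a) + len (- a + b)" if "- w \<preceq> a" "a \<preceq> b" for a b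
    using len_add[of "w + a" "- a + b"] that by (simp add: add.assoc)
  have bd: "len (w + l) < Suc (len (w + x))" if "Q l" for l
    using len_split[of l x] that by (simp add: Q_def)
  obtain l where l: "Q l" "\<And>l'. Q l' \<Longrightarrow> len (w + l') \<le> len (w + l)"
    using ex_has_greatest_nat[of Q "- w" "\<lambda>l. len (w + l)", OF Qw] bd by blast
  have "u \<preceq> l" if u: "u \<preceq> x" "u \<preceq> y" for u
  proof -
    have ul: "u \<in> gspan S" "l \<in> gspan S" using lower_in_grp[OF assms(1)] u l(1) by (auto simp only: Q_def)
    obtain j where j: "u \<preceq> j" "l \<preceq> j" "\<And>v. u \<preceq> v \<Longrightarrow> l \<preceq> v \<Longrightarrow> j \<preceq> v"
      using ex_join[OF ul] by blast
    have "- w \<preceq> j" "j \<preceq> x" "j \<preceq> y" using le_trans[of "- w" l j] l(1) j u by (auto simp only: Q_def)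
    then have Qj: "Q j" by (simp only: Q_def)
    have "len (- l + j) = 0" using l(2)[OF Qj] len_split[of l j] l(1) j(2) by (simp add: Q_def)
    then have "- l + j = 0" using len_eq_0 j by blast
    then have "j = l" by (metis add.right_neutral add_minus_cancel)
    then show ?thesis using j by simp
  qed
  then show ?thesis using l(1) Q_def by blast
qed

text \<open>Negation turns right divisibility into reversed left divisibility, so right lcms come
  from meets.\<close>

lemma ex_right_lcm:
  assumes "x \<in> gspan S" "y \<in> gspan S"
  shows "\<exists>j. x \<preceq>\<^sub>r j \<and> y \<preceq>\<^sub>r j \<and> (\<forall>u. x \<preceq>\<^sub>r u \<longrightarrow> y \<preceq>\<^sub>r u \<longrightarrow> j \<preceq>\<^sub>r u)"
proof -
  obtain j where j: "j \<preceq> - x" "j \<preceq> - y" "\<And>u. u \<preceq> - x \<Longrightarrow> u \<preceq> - y \<Longrightarrow> u \<preceq> j"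
    using ex_meet[OF grp_neg grp_neg, OF assms] by blast
  show ?thesis
  proof (intro exI[of _ "- j"] conjI allI impI)
    show "x \<preceq>\<^sub>r - j" "y \<preceq>\<^sub>r - j" using j(1,2) by simp_all
    show "- j \<preceq>\<^sub>r u" if "x \<preceq>\<^sub>r u" "y \<preceq>\<^sub>r u" for u using j(3)[of "- u"] that by simp
  qed
qed

lemma ex_right_gcd:
  assumes "x \<in> gspan S" "y \<in> gspan S"
  shows "\<exists>j. j \<preceq>\<^sub>r x \<and> j \<preceq>\<^sub>r y \<and> (\<forall>u. u \<preceq>\<^sub>r x \<longrightarrow> u \<preceq>\<^sub>r y \<longrightarrow> u \<preceq>\<^sub>r j)"
proof -
  obtain j where j: "- x \<preceq> j" "- y \<preceq> j" "\<And>u. - x \<preceq> u \<Longrightarrow> - y \<preceq> u \<Longrightarrow> j \<preceq> u"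
    using ex_join[OF grp_neg grp_neg, OF assms] by blast
  show ?thesis
  proof (intro exI[of _ "- j"] conjI allI impI)
    show "- j \<preceq>\<^sub>r x" "- j \<preceq>\<^sub>r y" using j(1,2) by simp_all
    show "u \<preceq>\<^sub>r - j" if "u \<preceq>\<^sub>r x" "u \<preceq>\<^sub>r y" for u using j(3)[of "- u"] that by simp
  qed
qed

section \<open>Ribbons\<close>

lemma D_lcm:
  assumes X: "X \<subseteq> S" and y: "y \<in> mspan S" and "\<And>s. s \<in> X \<Longrightarrow> s \<preceq>\<^sub>r y"
  shows "D X \<preceq>\<^sub>r y"
proof -
  have D: "D X \<in> mspan S" using mon_le_pos[OF X D_mon[OF X]] .
  obtain j where j: "j \<preceq>\<^sub>r D X" "j \<preceq>\<^sub>r y" "\<And>u. u \<preceq>\<^sub>r D X \<Longrightarrow> u \<preceq>\<^sub>r y \<Longrightarrow> u \<preceq>\<^sub>r j"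
    using ex_right_gcd[OF mon_grp mon_grp, OF D y] by blast
  have "j \<in> mspan S" using j(3)[of 0] D y by simp
  \<comment> \<open>The right gcd of \<open>D X\<close> and \<open>y\<close> keeps every generator
    in \<open>X\<close> as a right divisor, so by \<open>D_unique\<close> it is all of
    \<open>D X\<close>.\<close>
  moreover have "s \<preceq>\<^sub>r j" if "s \<in> X" for s using j(3)[OF D_right[OF X that] assms(3)[OF that]] .
  ultimately have "j = D X" using D_unique[OF X _ j(1)] by blast
  then show ?thesis using j by simp
qed

lemma D_ratio_pos: "X \<subseteq> Z \<Longrightarrow> Z \<subseteq> S \<Longrightarrow> D Z - D X \<in> mspan S"
  by (rule D_lcm) (auto intro: D_right mon_le_pos[OF _ D_mon])

lemma D_ratio_conj:
  assumes XZ: "X \<subseteq> Z" "Z \<subseteq> S" and s: "s \<in> X"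
  shows "(D Z - D X) + s - (D Z - D X) \<in> S"
proof -
  have "(D Z - D X) + s - (D Z - D X) = D Z + (- D X + s + D X) - D Z"
    by (simp add: group_simps del: add_uminus_conv_diff)
  moreover have "- D X + s + D X \<in> Z" using D_conj[OF subset_trans[OF XZ] s] XZ(1) by (rule subsetD[rotated])
  ultimately show ?thesis using D_conj'[OF XZ(2)] XZ(2) by auto
qed

text \<open>A letter \<open>x\<close> ending the ribbon would meet the same \<open>x\<close> at the
  start of \<open>D X\<close>, a square inside the squarefree \<open>D Z\<close>.\<close>

lemma D_ratio_not_right:
  assumes XZ: "X \<subseteq> Z" "Z \<subseteq> S" and x: "x \<in> X"
  shows "\<not> x \<preceq>\<^sub>r D Z - D X"
proof
  assume "x \<preceq>\<^sub>r D Z - D X"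
  moreover have "(D Z - D X - x) + x + x + (- x + D X) = D Z"
    by (simp add: group_simps del: add_uminus_conv_diff)
  moreover have "X \<subseteq> S" "x \<in> S" using XZ x by auto
  ultimately show False using D_squarefree[OF XZ(2)] D_left[of X x] x by blast
qed

section \<open>Conjugating positive elements into a standard parabolic subgroup\<close>

lemma right_lcm_mon:
  assumes X: "X \<subseteq> S" and xy: "x \<in> mspan X" "y \<in> mspan X"
  obtains j where "j \<in> mspan X" "x \<preceq>\<^sub>r j" "y \<preceq>\<^sub>r j" "\<And>u. x \<preceq>\<^sub>r u \<Longrightarrow> y \<preceq>\<^sub>r u \<Longrightarrow> j \<preceq>\<^sub>r u"
proof -
  have xyg: "x \<in> gspan S" "y \<in> gspan S" using mon_grp[OF mon_le_pos[OF X xy(1)]] mon_grp[OF mon_le_pos[OF X xy(2)]] .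
  obtain j where j: "x \<preceq>\<^sub>r j" "y \<preceq>\<^sub>r j" "\<And>u. x \<preceq>\<^sub>r u \<Longrightarrow> y \<preceq>\<^sub>r u \<Longrightarrow> j \<preceq>\<^sub>r u"
    using ex_right_lcm[OF xyg] by blast
  have "- x \<in> gspan X" "- y \<in> gspan X" using grp_neg[OF mon_grp[OF xy(1)]] grp_neg[OF mon_grp[OF xy(2)]] .
  then obtain w where w: "w \<in> quasi X" "bounds X w (- x)" "bounds X w (- y)"
    using ex_bounds_finite[OF X, of "{- x, - y}"] by auto
  then have "x \<preceq>\<^sub>r w" "y \<preceq>\<^sub>r w" using mon_le_pos[OF X] by (auto simp: bounds_def)
  then have "j \<preceq>\<^sub>r w" using j by blast
  moreover have "j \<in> mspan S" using mon_plus[OF j(1) mon_le_pos[OF X xy(1)]] by simp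
  moreover have "w \<in> mspan X" using quasi_mon[OF w(1)] .
  ultimately have "j \<in> mspan X" using factors[OF X, of "w - j" j] by simp
  then show ?thesis using that j by blast
qed

text \<open>Letters of the denominator cancel one at a time. The last letter \<open>x\<close> of
  \<open>v\<close> right-divides \<open>b + u\<close>, and the right lcm of \<open>x\<close> and
  \<open>u\<close> exceeds \<open>u\<close> by a right divisor of \<open>b\<close> with letters in
  \<open>X\<close>. As no generator in \<open>X\<close> right-divides \<open>b\<close>, the excess
  is trivial and \<open>x\<close> right-divides \<open>u\<close>.\<close>

lemma reduced_conj_pos:
  assumes X: "X \<subseteq> S" and b: "b \<in> mspan S" and red: "\<And>x. x \<in> X \<Longrightarrow> \<not> x \<preceq>\<^sub>r b"
    and e: "e \<in> mspan S" and c: "- b + e + b \<in> gspan X"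
  shows "- b + e + b \<in> mspan X"
proof -
  obtain u v where uv: "u \<in> mspan X" "v \<in> mspan X" "- b + e + b = u - v"
    using grp_fraction[OF X c] by blast
  have "- b + e + b + v = u" using uv(3) by simp
  then have "e + b + v = b + u" by (metis add.assoc add_minus_cancel)
  with uv(2,1) show ?thesis
  proof (induction arbitrary: u rule: mon_rev_induct)
    case zero
    then show ?case by (simp add: add.assoc)
  next
    case (snoc v x)
    have xb: "x \<preceq>\<^sub>r b + u"
    proof -
      have "b + u - x = e + b + v" unfolding snoc(5)[symmetric] by (simp add: group_simps del: add_uminus_conv_diff)
      then show ?thesis using mon_plus[OF mon_plus[OF e b] mon_le_pos[OF X snoc(1)]] by simp
    qed
    obtain j where j: "j \<in> mspan X" "x \<preceq>\<^sub>r j" "u \<preceq>\<^sub>r j" "\<And>w. x \<preceq>\<^sub>r w \<Longrightarrow> u \<preceq>\<^sub>r w \<Longrightarrow> j \<preceq>\<^sub>r w"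
      using right_lcm_mon[OF X mon_gen[OF snoc(2)] snoc(4)] by blast
    have "j \<preceq>\<^sub>r b + u" using j(4) xb b by simp
    then have yb: "j - u \<preceq>\<^sub>r b" by (simp add: group_simps del: add_uminus_conv_diff)
    have "j - u \<in> mspan X" using factors[OF X j(3), of u] mon_le_pos[OF X snoc(4)] j(1) by simp
    have "j - u = 0"
    proof (rule ccontr)
      assume "j - u \<noteq> 0"
      then obtain z y where z: "z \<in> X" "y \<in> mspan X" "j - u = y + z"
        using mon_last[OF \<open>j - u \<in> mspan X\<close>] by metis
      have "b - z = b - (j - u) + y" unfolding z(3) by (simp add: group_simps del: add_uminus_conv_diff)
      then have "z \<preceq>\<^sub>r b" using mon_plus[OF yb mon_le_pos[OF X z(2)]] by simp
      then show False using red z by blast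
    qed
    then have "x \<preceq>\<^sub>r u" using j(2) by simp
    then have "u - x \<in> mspan X"
      using factors[OF X \<open>x \<preceq>\<^sub>r u\<close> mon_gen[of x]] snoc(4) X snoc(2) by auto
    moreover have "e + b + v = b + (u - x)"
    proof -
      have "e + b + v = e + b + (v + x) - x" by (simp add: group_simps del: add_uminus_conv_diff)
      then show ?thesis unfolding snoc(5) by (simp add: add_diff_eq)
    qed
    ultimately show ?case using snoc(3) by blast
  qed
qed

text \<open>Here \<open>r\<close> is a ribbon. Peeling the letters of \<open>c\<close> off the right lcm of \<open>k\<close> and \<open>c\<close> one at a time, the
  length of the residue of \<open>k\<close> never decreases, so it has to be constant.\<close>

lemma fold_chain:
  assumes X: "X \<subseteq> S" and t: "t \<in> S" and r: "r = D (insert t X) - D X"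
    and "c \<in> mspan X" and "k \<in> mspan S" "k \<preceq>\<^sub>r r" "h \<in> mspan S" "k \<preceq>\<^sub>r h + c" "len h \<le> len k"
  shows "h = k \<and> c \<in> mspan {x \<in> X. \<exists>q\<in>S. k + x = q + k}"
  using assms(4-)
proof (induction arbitrary: k rule: mon_rev_induct)
  case zero
  then have "len (h - k) = 0" using len_add[of "h - k" k] by simp
  moreover have "h - k \<in> mspan S" using zero by simp
  ultimately have "h - k = 0" by (rule len_eq_0[rotated])
  then show ?case by (simp add: mon_zero)
next
  case (snoc c x)
  let ?Z = "insert t X"
  have Z: "?Z \<subseteq> S" using X t by blast
  have DX: "D X \<in> mspan S" using D_mon[OF X] mon_le_pos[OF X] by blast
  have XZ: "X \<subseteq> ?Z" by blast
  have rP: "r \<in> mspan S" and nx: "\<not> x \<preceq>\<^sub>r r" and cj: "r + x - r \<in> S"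
    unfolding r using D_ratio_pos[OF XZ Z] D_ratio_not_right[OF XZ Z] D_ratio_conj[OF XZ Z] snoc(2) by auto
  have xS: "x \<in> S" using X snoc by blast
  obtain j where j: "k \<preceq>\<^sub>r j" "x \<preceq>\<^sub>r j" "\<And>u. k \<preceq>\<^sub>r u \<Longrightarrow> x \<preceq>\<^sub>r u \<Longrightarrow> j \<preceq>\<^sub>r u"
    using ex_right_lcm[OF mon_grp[OF snoc(4)] grp_gen[OF xS]] by blast
  define k1 q where "k1 = j - x" and "q = j - k"
  have k1: "k1 \<in> mspan S" and q: "q \<in> mspan S" and eq: "q + k = k1 + x"
    using j by (simp_all add: k1_def q_def)
  \<comment> \<open>The ribbon carries \<open>x\<close> to a generator, so \<open>k\<close>
    right-divides \<open>r + x\<close>; the new residue \<open>k1\<close> therefore remains a right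
    divisor of the ribbon.\<close>
  have "r + x - k = (r + x - r) + (r - k)" by (simp add: group_simps del: add_uminus_conv_diff)
  then have "k \<preceq>\<^sub>r r + x" using mon_add[OF cj snoc(5)] by simp
  then have "j \<preceq>\<^sub>r r + x" using j(3) rP by simp
  then have k1r: "k1 \<preceq>\<^sub>r r" by (simp add: k1_def group_simps del: add_uminus_conv_diff)
  have hc: "h + c \<in> mspan S" using mon_plus[OF snoc(6) mon_le_pos[OF X snoc(1)]] .
  have "j \<preceq>\<^sub>r h + (c + x)" using j(3)[OF snoc(7)] hc by (simp add: group_simps del: add_uminus_conv_diff)
  then have k1h: "k1 \<preceq>\<^sub>r h + c" by (simp add: k1_def group_simps del: add_uminus_conv_diff)
  \<comment> \<open>A trivial \<open>q\<close> would let \<open>x\<close> end the ribbon. So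
    \<open>q\<close> has length at least one and \<open>k1\<close> is at least as long as
    \<open>k\<close>, as the induction hypothesis needs.\<close>
  have "q \<noteq> 0"
  proof
    assume "q = 0"
    then have "x \<preceq>\<^sub>r k" using j(2) by (simp add: q_def)
    then show False using nx ler_trans[OF _ snoc(5)] by blast
  qed
  then have "len q \<ge> 1" using len_eq_0[OF q] by (cases "len q") auto
  moreover have ll: "len q + len k = len k1 + 1"
    using len_add[OF q snoc(4)] len_add[OF k1 mon_gen[OF xS]] eq len_gen[OF xS] by simp
  ultimately have IH: "h = k1 \<and> c \<in> mspan {x \<in> X. \<exists>q\<in>S. k1 + x = q + k1}"
    using snoc(3)[OF k1 k1r snoc(6) k1h] snoc(8) by simp
  \<comment> \<open>From \<open>h = k1\<close> and \<open>len h \<le> len k\<close> the residue has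
    kept its length, so \<open>q\<close> is a generator and \<open>D_fold\<close> identifies
    \<open>k\<close> with \<open>k1\<close>.\<close>
  then have "len q = 1" using ll snoc(8) \<open>len q \<ge> 1\<close> by simp
  then have qS: "q \<in> S" using len_eq_1 q by blast
  then have "k = k1" using D_fold[OF X t snoc(4) k1 _ _ snoc(2) qS eq] snoc(5) k1r r by simp
  then have "k + x = q + k" using eq by simp
  then have "x \<in> {x \<in> X. \<exists>q\<in>S. k + x = q + k}" using snoc(2) qS by blast
  moreover have "h = k" "c \<in> mspan {x \<in> X. \<exists>q\<in>S. k + x = q + k}" using IH \<open>k = k1\<close> by simp_all
  ultimately show ?case by (blast intro: mon_snoc)
qed

text \<open>Letters of \<open>X\<close> at the right end of \<open>b\<close> are stripped off. If there are none, \<open>b\<close> ends in some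
  \<open>t \<notin> X\<close>, the conjugate of \<open>e\<close> is positive with set of letters \<open>Y \<subseteq> X\<close>, and the right gcd of \<open>b\<close>
  and the ribbon \<open>D (insert t Y) - D Y\<close> is the whole ribbon, which can be stripped off. Conjugation by a ribbon turns
  the letters of \<open>Y\<close> into generators again.\<close>

lemma letters_conj:
  assumes "X \<subseteq> S" "e \<in> mspan S" "b \<in> mspan S" "- b + e + b \<in> gspan X"
  shows "e \<in> mspan {s \<in> S. - b + s + b \<in> gspan X}"
  using assms
proof (induction "len b" arbitrary: b X rule: less_induct)
  case less
  note X = less.prems(1) and e = less.prems(2) and b = less.prems(3) and c = less.prems(4)
  consider (divides) x where "x \<in> X" "x \<preceq>\<^sub>r b" | (zero) "b = 0"
    | (red) "\<And>x. x \<in> X \<Longrightarrow> \<not> x \<preceq>\<^sub>r b" "b \<noteq> 0" by blast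
  then show ?case
  proof cases
    case divides
    obtain b' where b': "b' \<in> mspan S" "b = b' + x" using divides(2) diff_add_cancel by metis
    have xS: "x \<in> S" using X divides by blast
    have xg: "x \<in> gspan X" using grp_gen divides(1) by blast
    have "len b = len b' + 1" using len_add[OF b'(1) mon_gen[OF xS]] len_gen[OF xS] b'(2) by simp
    moreover have "- b' + e + b' = x + (- b + e + b) - x" unfolding b'(2) by (simp add: group_simps del: add_uminus_conv_diff)
    then have "- b' + e + b' \<in> gspan X" using grp_diff[OF grp_plus[OF xg c] xg] by simp
    ultimately have "e \<in> mspan {s \<in> S. - b' + s + b' \<in> gspan X}" using less.hyps[OF _ X e b'(1)] by linarith
    moreover have "- b + s + b \<in> gspan X" if "- b' + s + b' \<in> gspan X" for s
    proof -
      have "- b + s + b = - x + (- b' + s + b') + x" unfolding b'(2) by (simp add: group_simps del: add_uminus_conv_diff)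
      then show ?thesis using grp_plus[OF grp_plus[OF grp_neg[OF xg] that] xg] by simp
    qed
    ultimately show ?thesis by - (erule mon_mono, blast)
  next
    case zero
    then have "e \<in> mspan X" using grp_pos[OF X] c e by simp
    then show ?thesis by (rule mon_mono) (use X zero grp_gen in auto)
  next
    case red
    define d where "d = - b + e + b"
    have "d \<in> mspan X" unfolding d_def using reduced_conj_pos[OF X b red(1) e c] .
    \<comment> \<open>A smallest set of letters for \<open>d\<close>: a subset of \<open>Y\<close>
      that still generates \<open>d\<close> has to be \<open>Y\<close>.\<close>
    obtain Y where Y: "Y \<subseteq> X" "d \<in> mspan Y" "\<And>Y'. Y' \<subseteq> X \<Longrightarrow> d \<in> mspan Y' \<Longrightarrow> card Y \<le> card Y'"
      using ex_has_least_nat[of "\<lambda>Y. Y \<subseteq> X \<and> d \<in> mspan Y" X card] \<open>d \<in> mspan X\<close> by auto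
    have YS: "Y \<subseteq> S" and finY: "finite Y" using Y(1) X finite_subset[OF _ fin, of Y] by auto
    obtain t b' where t: "t \<in> S" "b' \<in> mspan S" "b = b' + t" using mon_last[OF b red(2)] by metis
    let ?Z = "insert t Y"
    have Z: "?Z \<subseteq> S" using YS t by blast
    define r where "r = D ?Z - D Y"
    have DZ: "D ?Z \<in> mspan S" and DY: "D Y \<in> mspan S" using mon_le_pos[OF Z D_mon[OF Z]] mon_le_pos[OF YS D_mon[OF YS]] .
    have YZ: "Y \<subseteq> ?Z" by blast
    have rP: "r \<in> mspan S" and rconj: "\<And>s. s \<in> Y \<Longrightarrow> r + s - r \<in> S"
      and nr: "\<And>s. s \<in> Y \<Longrightarrow> \<not> s \<preceq>\<^sub>r r"
      unfolding r_def using D_ratio_pos[OF YZ Z] D_ratio_not_right[OF YZ Z] D_ratio_conj[OF YZ Z] by auto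
    \<comment> \<open>The ribbon is nontrivial, and its last letter lies in
      \<open>insert t Y\<close> but not in \<open>Y\<close>.\<close>
    have tr: "t \<preceq>\<^sub>r r"
    proof -
      have tY: "t \<notin> Y" using red(1)[of t] t Y(1) by (auto simp: t(3))
      have "r \<noteq> 0"
      proof
        assume "r = 0"
        then have "t + (- t + D ?Z) \<in> mspan Y" using D_mon[OF YS] by (simp add: r_def)
        then have "t \<in> mspan Y" using factors[OF YS mon_gen[OF t(1)]] D_left[OF Z] by blast
        then show False using tY gen_in_mon[OF YS t(1)] by blast
      qed
      have "r \<in> mspan ?Z" using factors[OF Z rP DY] D_mon[OF Z] by (simp add: r_def)
      then obtain z r' where z: "z \<in> ?Z" "r' \<in> mspan ?Z" "r = r' + z"
        by (rule mon_last[OF _ \<open>r \<noteq> 0\<close>])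
      have "z \<preceq>\<^sub>r r" using z(3) mon_le_pos[OF Z z(2)] by simp
      then show ?thesis using z(1) nr by blast
    qed
    have bg: "b \<in> gspan S" and rg: "r \<in> gspan S" using mon_grp[OF b] mon_grp[OF rP] .
    obtain k where k: "k \<preceq>\<^sub>r r" "k \<preceq>\<^sub>r b" "\<And>u. u \<preceq>\<^sub>r r \<Longrightarrow> u \<preceq>\<^sub>r b \<Longrightarrow> u \<preceq>\<^sub>r k"
      using ex_right_gcd[OF rg bg] by blast
    have kP: "k \<in> mspan S" using k(3)[of 0] rP b by simp
    have tk: "t \<preceq>\<^sub>r k" using k(3) tr t by simp
    \<comment> \<open>\<open>k\<close> right-divides \<open>r + d\<close>, because \<open>r\<close>
      conjugates \<open>d\<close> to a positive element, and \<open>b + d\<close>, because this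
      equals \<open>e + b\<close>. So \<open>k - d\<close> right-divides \<open>r\<close> and
      \<open>b\<close>, and with them their gcd \<open>k\<close>.\<close>
    have kd: "k \<preceq>\<^sub>r k + d"
    proof -
      have bd: "e + b = b + d" by (simp add: d_def add.assoc)
      have "r + d - r \<in> mspan S" using mon_conj[OF Y(2), of "- r" S] rconj by simp
      then have "r + d - k \<in> mspan S"
        using mon_plus[OF _ k(1), of "r + d - r"] by (simp add: group_simps del: add_uminus_conv_diff)
      then have 1: "k - d \<preceq>\<^sub>r r" by (simp add: group_simps del: add_uminus_conv_diff)
      have "b + d - k = e + (b - k)" using bd by (metis add_diff_eq)
      then have "b + d - k \<in> mspan S" using mon_plus[OF e k(2)] by simp
      then have "k - d \<preceq>\<^sub>r b" by (simp add: group_simps del: add_uminus_conv_diff)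
      then have "k - d \<preceq>\<^sub>r k" using k(3) 1 by blast
      then show ?thesis by (simp add: group_simps del: add_uminus_conv_diff)
    qed
    \<comment> \<open>\<open>fold_chain\<close> with \<open>h = k\<close> writes \<open>d\<close> in
      letters that \<open>k\<close> conjugates to generators; by minimality these are all of
      \<open>Y\<close>.\<close>
    have "d \<in> mspan {x \<in> Y. \<exists>q\<in>S. k + x = q + k}"
      using fold_chain[OF YS t(1) r_def Y(2) kP k(1) kP kd] by simp
    then have "card Y \<le> card {x \<in> Y. \<exists>q\<in>S. k + x = q + k}" using Y(1) by (intro Y(3)) auto
    then have "{x \<in> Y. \<exists>q\<in>S. k + x = q + k} = Y" using finY by (intro card_seteq) auto
    then have kx: "\<exists>q\<in>S. k + x = q + k" if "x \<in> Y" for x using that by blast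
    have "k + x - k \<in> S" if "x \<in> Y" for x
      using kx[OF that] by (metis add_diff_cancel)
    then have "k + D Y - k \<in> mspan S" using mon_conj[OF D_mon[OF YS], of "- k" S] by simp
    then have kDt: "t \<preceq>\<^sub>r k + D Y"
      using mon_plus[OF _ tk, of "k + D Y - k"] by (simp add: group_simps del: add_uminus_conv_diff)
    have "s \<preceq>\<^sub>r k + D Y" if "s \<in> Y" for s
      using mon_plus[OF kP D_right[OF YS that]] by (simp add: group_simps del: add_uminus_conv_diff)
    then have "D ?Z \<preceq>\<^sub>r k + D Y" using D_lcm[OF Z mon_plus[OF kP DY]] kDt by blast
    then have "r \<preceq>\<^sub>r k" by (simp add: r_def group_simps del: add_uminus_conv_diff)
    then have rb: "r \<preceq>\<^sub>r b" using ler_trans[OF _ k(2)] by blast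
    obtain b2 where b2: "b2 \<in> mspan S" "b = b2 + r" using rb diff_add_cancel by metis
    define Y'' where "Y'' = (\<lambda>x. r + x - r) ` Y"
    have Y'': "Y'' \<subseteq> S"
      using rconj by (auto simp: Y''_def)
    have "len b = len b2 + len r" using len_add[OF b2(1) rP] b2(2) by simp
    moreover have "len r > 0"
    proof -
      have "len r = len (r - t) + 1" using len_add[OF tr mon_gen[OF t(1)]] len_gen[OF t(1)] by simp
      then show ?thesis by simp
    qed
    ultimately have lt: "len b2 < len b" by simp
    have "- b2 + e + b2 = r + d - r" unfolding d_def b2(2) by (simp add: group_simps del: add_uminus_conv_diff)
    moreover have "r + d - r \<in> mspan Y''" using mon_conj[OF Y(2), of "- r" Y''] by (auto simp: Y''_def)
    ultimately have "- b2 + e + b2 \<in> gspan Y''" using mon_grp by metis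
    then have "e \<in> mspan {s \<in> S. - b2 + s + b2 \<in> gspan Y''}" using less.hyps[OF lt Y'' e b2(1)] by blast
    moreover have "- b + s + b \<in> gspan X" if s: "- b2 + s + b2 \<in> gspan Y''" for s
    proof -
      have "- r + y + r \<in> gspan X" if "y \<in> Y''" for y
        using that Y(1) by (auto simp: Y''_def group_simps grp_gen simp del: add_uminus_conv_diff)
      then have "- r + (- b2 + s + b2) + r \<in> gspan X" using grp_conj[OF s] by blast
      moreover have "- r + (- b2 + s + b2) + r = - b + s + b" unfolding b2(2) by (simp add: group_simps del: add_uminus_conv_diff)
      ultimately show ?thesis by simp
    qed
    ultimately show ?thesis by - (erule mon_mono, blast)
  qed
qed

section \<open>Closure of a standard parabolic subgroup under roots\<close>

lemma finite_len_le: "finite {a \<in> mspan S. len a \<le> k}"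
proof (induction k)
  case 0
  have "{a \<in> mspan S. len a \<le> 0} \<subseteq> {0}" using len_eq_0 by auto
  then show ?case using finite_subset by blast
next
  case (Suc k)
  have "{a \<in> mspan S. len a \<le> Suc k} \<subseteq> {0} \<union> (\<lambda>(s, a). s + a) ` (S \<times> {a \<in> mspan S. len a \<le> k})"
  proof
    fix a assume a: "a \<in> {a \<in> mspan S. len a \<le> Suc k}"
    show "a \<in> {0} \<union> (\<lambda>(s, a). s + a) ` (S \<times> {a \<in> mspan S. len a \<le> k})"
    proof (cases "a = 0")
      case False
      then obtain s b where b: "s \<in> S" "b \<in> mspan S" "a = s + b" using mon_first a by blast
      then have "len b \<le> k" using a len_add[OF mon_gen[OF b(1)] b(2)] len_gen by simp
      then show ?thesis using b by auto
    qed simp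
  qed
  then show ?case using Suc fin finite_subset by blast
qed

text \<open>The letters of one word for \<open>e\<close> will do: if \<open>mspan Y\<close> contains
  \<open>e\<close>, it contains the factors of \<open>e\<close>, in particular each of these
  letters.\<close>

lemma mon_letters:
  assumes "e \<in> mspan S"
  shows "\<exists>L\<subseteq>S. e \<in> mspan L \<and> (\<forall>Y\<subseteq>S. e \<in> mspan Y \<longrightarrow> L \<subseteq> Y)"
  using assms
proof (induction rule: mspan.induct)
  case mon_zero
  show ?case using mspan.mon_zero by blast
next
  case (mon_add s a)
  then obtain L where L: "L \<subseteq> S" "a \<in> mspan L" "\<And>Y. Y \<subseteq> S \<Longrightarrow> a \<in> mspan Y \<Longrightarrow> L \<subseteq> Y" by blast
  have "a \<in> mspan (insert s L)" using mon_mono[OF L(2)] by blast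
  then have "s + a \<in> mspan (insert s L)" using mspan.mon_add[of s "insert s L" a] by blast
  moreover have "insert s L \<subseteq> Y" if Y: "Y \<subseteq> S" "s + a \<in> mspan Y" for Y
  proof -
    have "s \<in> mspan Y" "a \<in> mspan Y" using factors[OF Y(1) mon_gen[OF mon_add(1)] mon_add(2) Y(2)] by auto
    then show ?thesis using gen_in_mon[OF Y(1) mon_add(1)] L(3)[OF Y(1)] by blast
  qed
  moreover have "insert s L \<subseteq> S" using mon_add(1) L(1) by blast
  ultimately show ?case by (intro exI[of _ "insert s L"]) simp
qed

lemma le_shift: "c + a \<preceq> c + b \<longleftrightarrow> a \<preceq> b"
proof -
  have "- (c + a) + (c + b) = - a + b" by (simp add: group_simps del: add_uminus_conv_diff)
  then show ?thesis by simp
qed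

lemma nmul_gspan: "\<beta> \<in> gspan X \<Longrightarrow> nmul i \<beta> \<in> gspan X"
  by (induction i) (simp_all add: grp_zero grp_plus)

theorem gspan_root_closed:
  assumes X: "X \<subseteq> S" and \<beta>: "\<beta> \<in> gspan S" and n: "n > 0" "nmul n \<beta> \<in> gspan X"
  shows "\<beta> \<in> gspan X"
proof -
  define I where "I = {p. \<exists>x\<in>gspan X. p \<preceq> x}"
  \<comment> \<open>The intersection of the translates of \<open>I\<close> by
    \<open>- nmul i \<beta>\<close>. The indices \<open>i < n\<close> suffice, because
    \<open>nmul n \<beta>\<close> lies in \<open>gspan X\<close> and so preserves
    \<open>I\<close>.\<close>
  define M where "M = {p. \<forall>i<n. nmul i \<beta> + p \<in> I}"
  have I_shift: "x + p \<in> I" if x: "x \<in> gspan X" and p: "p \<in> I" for x p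
  proof -
    obtain y where y: "y \<in> gspan X" "p \<preceq> y" using p unfolding I_def by blast
    have "x + p \<preceq> x + y" using y(2) le_shift by simp
    then show ?thesis using grp_plus[OF x y(1)] unfolding I_def by blast
  qed
  have M0: "p \<in> I" if "p \<in> M" for p
  proof -
    have "nmul 0 \<beta> + p \<in> I" using that n(1) unfolding M_def by blast
    then show ?thesis by simp
  qed
  have MS: "p \<in> gspan S" if p: "p \<in> M" for p
  proof -
    obtain x where x: "x \<in> gspan X" "p \<preceq> x" using M0[OF p] unfolding I_def by blast
    show ?thesis using lower_in_grp[OF grp_mono[OF x(1) X] x(2)] .
  qed
  have M_plus: "\<beta> + p \<in> M" if p: "p \<in> M" for p
  proof -
    have "nmul i \<beta> + (\<beta> + p) \<in> I" if i: "i < n" for i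
    proof -
      have eq: "nmul i \<beta> + (\<beta> + p) = nmul (Suc i) \<beta> + p"
        unfolding nmul_Suc_right by (simp only: add.assoc)
      show ?thesis
      proof (cases "Suc i = n")
        case True
        then show ?thesis unfolding eq using I_shift[OF n(2) M0[OF p]] by simp
      next
        case False
        then have "Suc i < n" using i by simp
        then show ?thesis unfolding eq using p unfolding M_def by blast
      qed
    qed
    then show ?thesis unfolding M_def by blast
  qed
  have M_minus: "- \<beta> + p \<in> M" if p: "p \<in> M" for p
  proof -
    have "nmul i \<beta> + (- \<beta> + p) \<in> I" if i: "i < n" for i
    proof (cases i)
      case 0
      obtain k where k: "n = Suc k" using n(1) by (cases n) auto
      have "nmul i \<beta> + (- \<beta> + p) = - nmul n \<beta> + (nmul k \<beta> + p)"
        unfolding k nmul_Suc_right 0 by (simp add: group_simps del: add_uminus_conv_diff)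
      moreover have "nmul k \<beta> + p \<in> I" using p k unfolding M_def by blast
      ultimately show ?thesis using I_shift[OF grp_neg[OF n(2)]] by simp
    next
      case (Suc k)
      have "nmul i \<beta> + (- \<beta> + p) = nmul k \<beta> + p"
        unfolding Suc nmul_Suc_right by (simp add: group_simps del: add_uminus_conv_diff)
      then show ?thesis using p i Suc unfolding M_def by simp
    qed
    then show ?thesis unfolding M_def by blast
  qed
  \<comment> \<open>Two elements of \<open>gspan X\<close> have a common upper bound in
    \<open>gspan X\<close>; translated back, it bounds \<open>p\<close> and \<open>q\<close> and
    hence \<open>j\<close>.\<close>
  have M_join: "j \<in> M" if pq: "p \<in> M" "q \<in> M" and j: "\<And>u. p \<preceq> u \<Longrightarrow> q \<preceq> u \<Longrightarrow> j \<preceq> u" for p q j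
  proof -
    have "nmul i \<beta> + j \<in> I" if i: "i < n" for i
    proof -
      define c where "c = nmul i \<beta>"
      have "c + p \<in> I" "c + q \<in> I" using pq i unfolding M_def c_def by blast+
      then obtain x y where xy: "x \<in> gspan X" "c + p \<preceq> x" "y \<in> gspan X" "c + q \<preceq> y"
        unfolding I_def by blast
      obtain w where w: "w \<in> quasi X" "bounds X w x" "bounds X w y"
        using ex_bounds_finite[OF X, of "{x, y}"] xy by auto
      have "x \<preceq> w" "y \<preceq> w" using w mon_le_pos[OF X] unfolding bounds_def by blast+
      then have "c + p \<preceq> c + (- c + w)" "c + q \<preceq> c + (- c + w)"
        using le_trans[OF xy(2), of w] le_trans[OF xy(4), of w] by simp_all
      then have "j \<preceq> - c + w" using j unfolding le_shift by blast
      then have "c + j \<preceq> c + (- c + w)" unfolding le_shift .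
      then have "c + j \<preceq> w" by simp
      then show ?thesis using mon_grp[OF quasi_mon[OF w(1)]] unfolding I_def c_def by blast
    qed
    then show ?thesis unfolding M_def by blast
  qed
  \<comment> \<open>A bound \<open>w\<close> of all \<open>- nmul i \<beta>\<close> puts each
    \<open>nmul i \<beta> - w\<close> below 0, an element of \<open>gspan X\<close>.\<close>
  obtain p0 where p0: "p0 \<in> M"
  proof -
    have "(\<lambda>i. - nmul i \<beta>) ` {..<n} \<subseteq> gspan S"
      using grp_neg[OF nmul_gspan[OF \<beta>]] by blast
    then obtain w where w: "\<forall>g\<in>(\<lambda>i. - nmul i \<beta>) ` {..<n}. bounds S w g"
      using ex_bounds_finite[of S "(\<lambda>i. - nmul i \<beta>) ` {..<n}"] by auto
    have "nmul i \<beta> + - w \<in> I" if "i < n" for i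
    proof -
      have "w + - nmul i \<beta> \<in> mspan S" using w that unfolding bounds_def by blast
      then have "nmul i \<beta> + - w \<preceq> 0" by (simp add: group_simps del: add_uminus_conv_diff)
      then show ?thesis using grp_zero unfolding I_def by blast
    qed
    then have "- w \<in> M" unfolding M_def by blast
    then show ?thesis by (rule that)
  qed
  define U where "U = {p \<in> M. p0 \<preceq> p}"
  have p0U: "p0 \<in> U" using p0 mon_zero unfolding U_def by simp
  have U_directed: "\<exists>u\<in>U. \<forall>f\<in>F. f \<preceq> u" if "finite F" "F \<subseteq> U" for F
    using that
  proof (induction rule: finite_induct)
    case empty
    then show ?case using p0U by blast
  next
    case (insert f F)
    then obtain u where u: "u \<in> U" "\<forall>f\<in>F. f \<preceq> u" by auto
    have fM: "f \<in> M" "p0 \<preceq> f" using insert(4) unfolding U_def by auto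
    have uM: "u \<in> M" using u(1) unfolding U_def by auto
    obtain j where j: "f \<preceq> j" "u \<preceq> j" "\<And>v. f \<preceq> v \<Longrightarrow> u \<preceq> v \<Longrightarrow> j \<preceq> v"
      using ex_join[OF MS[OF fM(1)] MS[OF uM]] by blast
    have "j \<in> U" using M_join[OF fM(1) uM j(3)] le_trans[OF fM(2) j(1)] unfolding U_def by blast
    moreover have "\<forall>g\<in>insert f F. g \<preceq> j" using j(1) u(2) le_trans[OF _ j(2)] by blast
    ultimately show ?case by blast
  qed
  obtain x where x: "\<And>i. i < n \<Longrightarrow> x i \<in> gspan X" "\<And>i. i < n \<Longrightarrow> nmul i \<beta> + p0 \<preceq> x i"
  proof -
    have "\<forall>i. \<exists>x. i < n \<longrightarrow> x \<in> gspan X \<and> nmul i \<beta> + p0 \<preceq> x"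
      using p0 unfolding M_def I_def by blast
    then show ?thesis using that by metis
  qed
  define b0 where "b0 i = - (nmul i \<beta> + p0) + x i" for i
  have b0: "b0 i \<in> mspan S" if "i < n" for i using x(2)[OF that] unfolding b0_def .
  have xb0: "x i = nmul i \<beta> + p0 + b0 i" for i
    unfolding b0_def by simp
  \<comment> \<open>A bound for the complements \<open>b0 i\<close> at \<open>p0\<close>. Being
    quasi-central it bounds suitable complements at all points above \<open>p0\<close> as well, so
    that \<open>B\<close> and \<open>T\<close> do not depend on the point.\<close>
  obtain w where w: "w \<in> quasi S" "\<And>i. i < n \<Longrightarrow> b0 i \<preceq> w"
  proof -
    have "b0 ` {..<n} \<subseteq> gspan S" using mon_grp[OF b0] by blast
    then obtain w where "w \<in> quasi S" "\<forall>g\<in>b0 ` {..<n}. bounds S w g"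
      using ex_bounds_finite[of S "b0 ` {..<n}"] by auto
    then show ?thesis using that unfolding bounds_def by blast
  qed
  define B where "B = {b \<in> mspan S. b \<preceq> w}"
  have "finite B"
  proof (rule finite_subset[OF _ finite_len_le])
    show "B \<subseteq> {a \<in> mspan S. len a \<le> len w}"
    proof
      fix b assume "b \<in> B"
      then have "b \<in> mspan S" "b \<preceq> w" unfolding B_def by auto
      then show "b \<in> {a \<in> mspan S. len a \<le> len w}" using len_add[of b "- b + w"] by simp
    qed
  qed
  define T where "T = PiE {..<n} (\<lambda>_. B)"
  have "finite T" unfolding T_def using \<open>finite B\<close> by (intro finite_PiE) auto
  define pos where "pos p b \<longleftrightarrow> (\<forall>i<n. nmul i \<beta> + p + b i \<in> gspan X)" for p b
  have ex_pos: "\<exists>b\<in>T. pos p b" if p: "p \<in> U" for p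
  proof -
    define u where "u = - p0 + p"
    have uS: "u \<in> mspan S" and pu: "p = p0 + u" using p unfolding U_def u_def by auto
    have "\<exists>b\<in>B. nmul i \<beta> + p + b \<in> gspan X" if i: "i < n" for i
    proof -
      have "nmul i \<beta> + p \<in> I" using p i unfolding U_def M_def by blast
      then obtain y where y: "y \<in> gspan X" "nmul i \<beta> + p \<preceq> y" unfolding I_def by blast
      \<comment> \<open>The complement \<open>b\<close> leads from \<open>u\<close> to its join with
        \<open>b0 i\<close>. After translation both lie below some \<open>v\<close> in
        \<open>gspan X\<close>, so \<open>x i + c\<close> lies between \<open>x i\<close> and
        \<open>v\<close>, and \<open>c\<close>, a factor of an element of \<open>mspan X\<close>,
        belongs to \<open>mspan X\<close>.\<close>
      obtain j where j: "u \<preceq> j" "b0 i \<preceq> j" "\<And>v. u \<preceq> v \<Longrightarrow> b0 i \<preceq> v \<Longrightarrow> j \<preceq> v"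
        using ex_join[OF mon_grp[OF uS] mon_grp[OF b0[OF i]]] by blast
      define b where "b = - u + j"
      define c where "c = - b0 i + j"
      have bS: "b \<in> mspan S" and cS: "c \<in> mspan S" using j unfolding b_def c_def by blast+
      obtain v where v: "v \<in> quasi X" "bounds X v y" "bounds X v (x i)"
        using ex_bounds_finite[OF X, of "{y, x i}"] y x(1)[OF i] by auto
      have yv: "y \<preceq> v" and xv: "x i \<preceq> v" using v mon_le_pos[OF X] unfolding bounds_def by blast+
      define d where "d = nmul i \<beta> + p0"
      have "d + u \<preceq> d + (- d + v)" using le_trans[OF y(2) yv] unfolding d_def pu by (simp add: add.assoc)
      moreover have "d + b0 i \<preceq> d + (- d + v)" using xv unfolding d_def xb0 by simp
      ultimately have "j \<preceq> - d + v" using j(3) unfolding le_shift by blast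
      then have "- (x i + c) + v \<in> mspan S"
        unfolding c_def d_def xb0 by (simp add: group_simps del: add_uminus_conv_diff)
      moreover have "c + (- (x i + c) + v) = - x i + v" by (simp add: group_simps del: add_uminus_conv_diff)
      moreover have "- x i + v \<in> mspan X" using v(3) unfolding bounds_def by blast
      ultimately have "c \<in> mspan X" using factors[OF X cS, of "- (x i + c) + v"] by simp
      then have "x i + c \<in> gspan X" using grp_plus[OF x(1)[OF i] mon_grp] by blast
      moreover have "x i + c = nmul i \<beta> + p + b"
        unfolding c_def b_def xb0 pu by (simp add: group_simps del: add_uminus_conv_diff)
      moreover have "b \<preceq> w"
      proof -
        \<comment> \<open>Moving \<open>w\<close> past \<open>u\<close> shows that \<open>w\<close>,
          and with it \<open>b0 i\<close>, precedes \<open>u + w\<close>. So does \<open>u\<close>,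
          hence the join, and therefore \<open>b\<close> precedes \<open>w\<close>.\<close>
        have "u + w = w + (- w + u + w)" by (simp add: group_simps del: add_uminus_conv_diff)
        then have "w \<preceq> u + w" using quasi_conj1[OF w(1) uS] by (simp add: add.assoc)
        then have "b0 i \<preceq> u + w" using le_trans[OF w(2)[OF i]] by blast
        moreover have "u \<preceq> u + w" using quasi_mon[OF w(1)] by simp
        ultimately have "j \<preceq> u + w" using j(3) by blast
        then show ?thesis unfolding b_def by (simp add: group_simps del: add_uminus_conv_diff)
      qed
      ultimately show ?thesis using bS unfolding B_def by auto
    qed
    then obtain b where b: "\<And>i. i < n \<Longrightarrow> b i \<in> B \<and> nmul i \<beta> + p + b i \<in> gspan X" by metis
    have "restrict b {..<n} \<in> T" "pos p (restrict b {..<n})"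
      using b unfolding T_def pos_def by auto
    then show ?thesis by blast
  qed
  \<comment> \<open>Pigeonhole in a directed set: if each position \<open>b\<close> were avoided
    above some \<open>m b\<close>, a common upper bound in \<open>U\<close> of these finitely many
    points would have no position.\<close>
  have "\<exists>b\<in>T. \<forall>p\<in>U. \<exists>q\<in>U. p \<preceq> q \<and> pos q b"
  proof (rule ccontr)
    assume "\<not> ?thesis"
    then obtain m where m: "\<And>b. b \<in> T \<Longrightarrow> m b \<in> U" "\<And>b q. b \<in> T \<Longrightarrow> q \<in> U \<Longrightarrow> m b \<preceq> q \<Longrightarrow> \<not> pos q b"
      by metis
    obtain u where u: "u \<in> U" "\<forall>f\<in>m ` T. f \<preceq> u"
      using U_directed[of "m ` T"] \<open>finite T\<close> m(1) by blast
    obtain b where "b \<in> T" "pos u b" using ex_pos[OF u(1)] by blast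
    then show False using m(2)[OF _ u(1)] u(2) by blast
  qed
  then obtain b where b: "b \<in> T" "\<And>p. p \<in> U \<Longrightarrow> \<exists>q\<in>U. p \<preceq> q \<and> pos q b" by blast
  obtain q0 where q0: "q0 \<in> U" "pos q0 b" using b(2)[OF p0U] by blast
  have q0M: "q0 \<in> M" and p0q0: "p0 \<preceq> q0" using q0(1) unfolding U_def by auto
  have bS: "b i \<in> mspan S" if "i < n" for i
    using b(1) that unfolding T_def B_def by auto
  define Y where "Y = {s \<in> S. \<forall>i<n. - b i + s + b i \<in> gspan X}"
  have YS: "Y \<subseteq> S" unfolding Y_def by blast
  have diff_Y: "- q0 + q \<in> mspan Y" if q: "q0 \<preceq> q" "pos q b" for q
  proof -
    obtain L where L: "L \<subseteq> S" "- q0 + q \<in> mspan L" "\<And>Z. Z \<subseteq> S \<Longrightarrow> - q0 + q \<in> mspan Z \<Longrightarrow> L \<subseteq> Z"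
      using mon_letters[OF q(1)] by blast
    have "L \<subseteq> {s \<in> S. - b i + s + b i \<in> gspan X}" if i: "i < n" for i
    proof (rule L(3))
      \<comment> \<open>For two points in the same position, the positive difference conjugated by
        \<open>b i\<close> is a quotient of two elements of \<open>gspan X\<close>, so
        \<open>letters_conj\<close> applies.\<close>
      have eq: "- b i + (- q0 + q) + b i = - (nmul i \<beta> + q0 + b i) + (nmul i \<beta> + q + b i)"
        by (simp add: group_simps del: add_uminus_conv_diff)
      have "- b i + (- q0 + q) + b i \<in> gspan X"
        unfolding eq using q0(2) q(2) i unfolding pos_def by (blast intro: grp_plus grp_neg)
      then show "- q0 + q \<in> mspan {s \<in> S. - b i + s + b i \<in> gspan X}"
        using letters_conj[OF X q(1) bS[OF i]] by blast
    qed blast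
    then have "L \<subseteq> Y" using L(1) unfolding Y_def by blast
    then show ?thesis using mon_mono[OF L(2)] by blast
  qed
  have M_le: "\<exists>y\<in>mspan Y. m \<preceq> q0 + y" if m: "m \<in> M" for m
  proof -
    obtain j where j: "m \<preceq> j" "q0 \<preceq> j" "\<And>v. m \<preceq> v \<Longrightarrow> q0 \<preceq> v \<Longrightarrow> j \<preceq> v"
      using ex_join[OF MS[OF m] MS[OF q0M]] by blast
    have "j \<in> U" using M_join[OF m q0M j(3)] le_trans[OF p0q0 j(2)] unfolding U_def by blast
    then obtain q where q: "q \<in> U" "j \<preceq> q" "pos q b" using b(2) by blast
    have "m \<preceq> q0 + (- q0 + q)" using le_trans[OF j(1) q(2)] by simp
    then show ?thesis using diff_Y[OF le_trans[OF j(2) q(2)] q(3)] by blast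
  qed
  have Y_conj: "- b i + y + b i \<in> gspan X" if "y \<in> gspan Y" "i < n" for y i
    using grp_conj[OF that(1), of "b i" X] that(2) unfolding Y_def by blast
  have Y_M: "q0 + y \<in> M" if y: "y \<in> gspan Y" for y
  proof -
    have "nmul i \<beta> + (q0 + y) \<in> I" if i: "i < n" for i
    proof -
      define z where "z = (nmul i \<beta> + q0 + b i) + (- b i + y + b i)"
      have "z \<in> gspan X" unfolding z_def
        using grp_plus[OF _ Y_conj[OF y i]] q0(2) i unfolding pos_def by blast
      moreover have "- (nmul i \<beta> + (q0 + y)) + z = b i"
        unfolding z_def by (simp add: group_simps del: add_uminus_conv_diff)
      ultimately show ?thesis using bS[OF i] unfolding I_def by force
    qed
    then show ?thesis unfolding M_def by blast
  qed
  define \<gamma> where "\<gamma> = - q0 + \<beta> + q0"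
  \<comment> \<open>Both directions of invariance are used: \<open>\<beta> + q0\<close> in
    \<open>M\<close> makes \<open>a\<close> positive, and \<open>- \<beta> + (q0 + y)\<close> in
    \<open>M\<close> makes \<open>a\<close> a left factor of some \<open>z\<close> in
    \<open>mspan Y\<close>, hence a member of \<open>mspan Y\<close>.\<close>
  have "\<gamma> \<in> gspan Y"
  proof -
    obtain y where y: "y \<in> mspan Y" "\<beta> + q0 \<preceq> q0 + y" using M_le[OF M_plus[OF q0M]] by blast
    define a where "a = - \<gamma> + y"
    have "- (\<beta> + q0) + (q0 + y) = a" unfolding a_def \<gamma>_def by (simp add: group_simps del: add_uminus_conv_diff)
    then have aS: "a \<in> mspan S" using y(2) by simp
    obtain z where z: "z \<in> mspan Y" "- \<beta> + (q0 + y) \<preceq> q0 + z"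
      using M_le[OF M_minus[OF Y_M[OF mon_grp[OF y(1)]]]] by blast
    have "- (- \<beta> + (q0 + y)) + (q0 + z) = - a + z"
      unfolding a_def \<gamma>_def by (simp add: group_simps del: add_uminus_conv_diff)
    then have "- a + z \<in> mspan S" using z(2) by simp
    then have "a \<in> mspan Y" using factors[OF YS aS, of "- a + z"] z(1) by simp
    moreover have "\<gamma> = y - a" unfolding a_def by (simp add: group_simps del: add_uminus_conv_diff)
    ultimately show ?thesis using grp_diff[OF mon_grp[OF y(1)] mon_grp] by simp
  qed
  \<comment> \<open>At \<open>i = 0\<close> the position says that \<open>q0 + b 0\<close> lies in
    \<open>gspan X\<close>. Conjugating \<open>\<beta>\<close> by this element instead of
    \<open>q0\<close> lands in \<open>gspan X\<close> too.\<close>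
  define z where "z = q0 + b 0"
  have z: "z \<in> gspan X" using q0(2) n(1) unfolding pos_def z_def by force
  have "\<beta> = z + (- b 0 + \<gamma> + b 0) - z"
    unfolding z_def \<gamma>_def by (simp add: group_simps del: add_uminus_conv_diff)
  then show ?thesis using grp_diff[OF grp_plus[OF z Y_conj[OF \<open>\<gamma> \<in> gspan Y\<close> n(1)]] z] by simp
qed

end

section \<open>Words and Coxeter relations\<close>

fun alt :: "nat \<Rightarrow> 'a \<Rightarrow> 'a \<Rightarrow> 'a list" where
  "alt 0 s t = []"
| "alt (Suc n) s t = s # alt n t s"

lemma length_alt [simp]: "length (alt n s t) = n"
  by (induction n arbitrary: s t) auto

lemma alt_lists: "s \<in> S \<Longrightarrow> t \<in> S \<Longrightarrow> alt n s t \<in> lists S"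
  by (induction n arbitrary: s t) auto

lemma set_alt: "2 \<le> n \<Longrightarrow> set (alt n s t) = {s, t}"
proof -
  assume "2 \<le> n"
  then obtain k where n: "n = Suc (Suc k)" by (metis add_2_eq_Suc le_Suc_ex)
  have "set (alt k s t) \<subseteq> {s, t}" by (induction k arbitrary: s t) auto
  then show ?thesis unfolding n by auto
qed

lemma alt_add: "alt (i + j) s t = alt i s t @ (if even i then alt j s t else alt j t s)"
  by (induction i arbitrary: s t) auto

lemma rev_alt: "rev (alt n s t) = (if odd n then alt n s t else alt n t s)"
proof (induction n)
  case (Suc n)
  have "alt (Suc n) s t = alt n s t @ (if even n then [s] else [t])"
    using alt_add[of n 1 s t] by auto
  then show ?case using Suc by auto
qed simp

lemma alt_of_no_repetition:
  assumes "u \<in> lists {s, t}" "\<nexists>x a y. u = x @ a # a # y"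
  shows "\<exists>a b. {a, b} = {s, t} \<and> u = alt (length u) a b"
  using assms
proof (induction u rule: list.induct)
  case Nil
  then show ?case by auto
next
  case (Cons h u)
  note prems = Cons.prems
  have "\<nexists>x a y. u = x @ a # a # y" using prems(2) by (metis append_Cons)
  then obtain a b where ab: "{a, b} = {s, t}" "u = alt (length u) a b" using Cons by auto
  have h: "h \<in> {a, b}" using Cons.prems(1) ab by auto
  show ?case
  proof (cases u)
    case Nil
    then show ?thesis using prems(1) by auto
  next
    case (Cons h' u')
    have "h' = a" using ab(2) unfolding Cons by simp
    then have "h \<noteq> a" using prems(2) Cons by (metis append_Nil)
    then have "h # u = alt (length (h # u)) b a" using h ab(2) by auto
    then show ?thesis using ab(1) by blast
  qed
qed

inductive wcong :: "('a list \<times> 'a list) set \<Rightarrow> 'a list \<Rightarrow> 'a list \<Rightarrow> bool" for R where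
  wcong_base: "(u, v) \<in> R \<Longrightarrow> wcong R u v"
| wcong_refl: "wcong R u u"
| wcong_sym: "wcong R u v \<Longrightarrow> wcong R v u"
| wcong_trans: "wcong R u v \<Longrightarrow> wcong R v w \<Longrightarrow> wcong R u w"
| wcong_append: "wcong R u u' \<Longrightarrow> wcong R v v' \<Longrightarrow> wcong R (u @ v) (u' @ v')"

lemma wcong_prepend: "wcong R u v \<Longrightarrow> wcong R (w @ u) (w @ v)"
  by (rule wcong_append[OF wcong_refl])

lemma wcong_Cons: "wcong R u v \<Longrightarrow> wcong R (s # u) (s # v)"
  using wcong_prepend[of R u v "[s]"] by simp

lemma wcong_postpend: "wcong R u v \<Longrightarrow> wcong R (u @ w) (v @ w)"
  by (rule wcong_append[OF _ wcong_refl])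

definition braid_rel :: "'a set \<Rightarrow> ('a \<Rightarrow> 'a \<Rightarrow> enat) \<Rightarrow> ('a list \<times> 'a list) set" where
  "braid_rel S m = {(alt n s t, alt n t s) | n s t. s \<in> S \<and> t \<in> S \<and> s \<noteq> t \<and> m s t = enat n}"

definition coxeter_rel :: "'a set \<Rightarrow> ('a \<Rightarrow> 'a \<Rightarrow> enat) \<Rightarrow> ('a list \<times> 'a list) set" where
  "coxeter_rel S m = braid_rel S m \<union> {([s, s], []) | s. s \<in> S}"

subsection \<open>The geometric representation\<close>

text \<open>The numbers game: the contragredient of the geometric representation, on functions on the
  generators.\<close>

definition cox_coeff :: "('a \<Rightarrow> 'a \<Rightarrow> enat) \<Rightarrow> 'a \<Rightarrow> 'a \<Rightarrow> real" where
  "cox_coeff m s t = (if s = t then - 2 else case m s t of enat n \<Rightarrow> 2 * cos (pi / n) | \<infinity> \<Rightarrow> 2)"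

definition fire :: "('a \<Rightarrow> 'a \<Rightarrow> real) \<Rightarrow> 'a \<Rightarrow> ('a \<Rightarrow> real) \<Rightarrow> 'a \<Rightarrow> real" where
  "fire k s f = (\<lambda>u. f u + k s u * f s)"

fun osum :: "real \<Rightarrow> nat \<Rightarrow> real" where
  "osum \<theta> 0 = 0"
| "osum \<theta> (Suc n) = osum \<theta> n + (if odd (Suc n) then sin (real (Suc n) * \<theta>) else 0)"

fun esum :: "real \<Rightarrow> nat \<Rightarrow> real" where
  "esum \<theta> 0 = 0"
| "esum \<theta> (Suc n) = esum \<theta> n + (if even (Suc n) then sin (real (Suc n) * \<theta>) else 0)"

lemma sin_step: "2 * cos \<theta> * sin (real (Suc n) * \<theta>) = sin (real (Suc (Suc n)) * \<theta>) + sin (real n * \<theta>)"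
proof -
  have 1: "real (Suc (Suc n)) * \<theta> = real (Suc n) * \<theta> + \<theta>" and 2: "real n * \<theta> = real (Suc n) * \<theta> - \<theta>"
    by (simp_all add: algebra_simps)
  show ?thesis unfolding 1 2 sin_add sin_diff by simp
qed

text \<open>The product formula \<open>sin_step\<close>, summed over the indices of one parity; the
  isolated \<open>sin \<theta>\<close> is the first odd term.\<close>

lemma osum_esum_step:
  "osum \<theta> (Suc n) = sin \<theta> + 2 * cos \<theta> * esum \<theta> n - osum \<theta> (n - 1) \<and>
   esum \<theta> (Suc n) = 2 * cos \<theta> * osum \<theta> n - esum \<theta> (n - 1)"
proof (induction n)
  case (Suc n)
  define c where "c = 2 * cos \<theta>"
  have o: "osum \<theta> (Suc n) = sin \<theta> + c * esum \<theta> n - osum \<theta> (n - 1)"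
    and e: "esum \<theta> (Suc n) = c * osum \<theta> n - esum \<theta> (n - 1)" using Suc unfolding c_def by auto
  have st: "sin (real (Suc (Suc n)) * \<theta>) = c * sin (real (Suc n) * \<theta>) - sin (real n * \<theta>)"
    using sin_step[of \<theta> n] unfolding c_def by simp
  have op: "osum \<theta> n = osum \<theta> (n - 1) + (if odd n then sin (real n * \<theta>) else 0)"
    and ep: "esum \<theta> n = esum \<theta> (n - 1) + (if even n then sin (real n * \<theta>) else 0)"
    by (cases n; simp)+
  show ?case
  proof (cases "even n")
    case True
    have o1: "osum \<theta> (Suc (Suc n)) = osum \<theta> (Suc n)" and e1: "esum \<theta> (Suc n) = esum \<theta> n"
      and o2: "osum \<theta> (Suc n) = osum \<theta> n + sin (real (Suc n) * \<theta>)"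
      and e2: "esum \<theta> (Suc (Suc n)) = esum \<theta> (Suc n) + sin (real (Suc (Suc n)) * \<theta>)"
      and e3: "esum \<theta> n = esum \<theta> (n - 1) + sin (real n * \<theta>)" and o3: "osum \<theta> n = osum \<theta> (n - 1)"
      using True op ep by simp_all
    have "osum \<theta> (Suc (Suc n)) = sin \<theta> + c * esum \<theta> (Suc n) - osum \<theta> n"
      unfolding o1 e1 using o o3 by linarith
    moreover have "c * osum \<theta> (Suc n) = c * osum \<theta> n + c * sin (real (Suc n) * \<theta>)"
      unfolding o2 by (rule distrib_left)
    then have "esum \<theta> (Suc (Suc n)) = c * osum \<theta> (Suc n) - esum \<theta> n"
      using e e1 e2 e3 st by linarith
    ultimately show ?thesis unfolding c_def diff_Suc_1 by blast
  next
    case False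
    have o1: "osum \<theta> (Suc (Suc n)) = osum \<theta> (Suc n) + sin (real (Suc (Suc n)) * \<theta>)"
      and e1: "esum \<theta> (Suc n) = esum \<theta> n + sin (real (Suc n) * \<theta>)"
      and o2: "osum \<theta> (Suc n) = osum \<theta> n"
      and e2: "esum \<theta> (Suc (Suc n)) = esum \<theta> (Suc n)"
      and e3: "esum \<theta> n = esum \<theta> (n - 1)" and o3: "osum \<theta> n = osum \<theta> (n - 1) + sin (real n * \<theta>)"
      using False op ep by simp_all
    have "esum \<theta> (Suc (Suc n)) = c * osum \<theta> (Suc n) - esum \<theta> n"
      unfolding o2 e2 using e e3 by linarith
    moreover have "c * esum \<theta> (Suc n) = c * esum \<theta> n + c * sin (real (Suc n) * \<theta>)"
      unfolding e1 by (rule distrib_left)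
    then have "osum \<theta> (Suc (Suc n)) = sin \<theta> + c * esum \<theta> (Suc n) - osum \<theta> n"
      using o o1 o2 o3 st by linarith
    ultimately show ?thesis unfolding c_def diff_Suc_1 by blast
  qed
qed simp

text \<open>The total amounts fired at \<open>s\<close> and at \<open>t\<close> are sums of
  Chebyshev quotients \<open>sin (j * \<theta>) / sin \<theta>\<close>; the factor
  \<open>sin \<theta>\<close> clears the denominators.\<close>

lemma fire_alt:
  assumes "k s t = 2 * cos \<theta>" "k t s = 2 * cos \<theta>" "k s s = - 2" "k t t = - 2"
  shows "sin \<theta> * fold (fire k) (alt n s t) f u = sin \<theta> * f u
    + k s u * (osum \<theta> n * f s + esum \<theta> (n - 1) * f t)
    + k t u * (esum \<theta> n * f s + osum \<theta> (n - 1) * f t)"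
  using assms
proof (induction n arbitrary: s t f)
  case (Suc n)
  have IH: "sin \<theta> * fold (fire k) (alt n t s) g u = sin \<theta> * g u
    + k t u * (osum \<theta> n * g t + esum \<theta> (n - 1) * g s)
    + k s u * (esum \<theta> n * g t + osum \<theta> (n - 1) * g s)" for g
    using Suc.IH[of t s g] Suc.prems by auto
  have o: "osum \<theta> (Suc n) = sin \<theta> + 2 * cos \<theta> * esum \<theta> n - osum \<theta> (n - 1)"
    and e: "esum \<theta> (Suc n) = 2 * cos \<theta> * osum \<theta> n - esum \<theta> (n - 1)" using osum_esum_step by auto
  have g: "fire k s f s = - f s" "fire k s f t = f t + 2 * cos \<theta> * f s" "fire k s f u = f u + k s u * f s"
    using Suc.prems by (auto simp: fire_def)
  show ?case unfolding alt.simps fold_Cons o_apply IH g o e diff_Suc_1 by (simp add: algebra_simps)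
qed simp

lemma fire_braid:
  assumes "k s t = 2 * cos (pi / n)" "k t s = 2 * cos (pi / n)" "k s s = - 2" "k t t = - 2" "2 \<le> n"
  shows "fold (fire k) (alt n s t) = fold (fire k) (alt n t s)"
proof (intro ext)
  fix f u
  define \<theta> where "\<theta> = pi / n"
  have n\<theta>: "real n * \<theta> = pi" using assms(5) by (simp add: \<theta>_def)
  have "\<theta> > 0" "\<theta> < pi" using assms(5) by (auto simp: \<theta>_def field_simps)
  then have "sin \<theta> > 0" by (rule sin_gt_zero)
  obtain j where j: "n = Suc j" using assms(5) by (cases n) auto
  \<comment> \<open>The last sine is \<open>sin pi\<close>, so the sums up to \<open>n\<close> and
    up to \<open>n - 1\<close> agree, which makes the formula of \<open>fire_alt\<close> symmetric
    in \<open>s\<close> and \<open>t\<close>.\<close>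
  have "sin (real (Suc j) * \<theta>) = 0" using n\<theta> unfolding j by simp
  then have "osum \<theta> n = osum \<theta> (n - 1)" "esum \<theta> n = esum \<theta> (n - 1)" unfolding j by simp_all
  then have "sin \<theta> * fold (fire k) (alt n s t) f u = sin \<theta> * fold (fire k) (alt n t s) f u"
    using fire_alt[of k s t \<theta> n f u] fire_alt[of k t s \<theta> n f u] assms by (simp add: \<theta>_def[symmetric] add_ac)
  then show "fold (fire k) (alt n s t) f u = fold (fire k) (alt n t s) f u" using \<open>sin \<theta> > 0\<close> by simp
qed

lemma cox_coeff_sym: "artin_datum S m \<Longrightarrow> s \<in> S \<Longrightarrow> t \<in> S \<Longrightarrow> cox_coeff m s t = cox_coeff m t s"
  unfolding artin_datum_def cox_coeff_def by (cases "s = t") auto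

lemma coxeter_fire:
  assumes "artin_datum S m" "wcong (coxeter_rel S m) u v"
  shows "fold (fire (cox_coeff m)) u = fold (fire (cox_coeff m)) v"
  using assms(2)
proof (induction rule: wcong.induct)
  case (wcong_base u v)
  then consider n s t where "u = alt n s t" "v = alt n t s" "s \<in> S" "t \<in> S" "s \<noteq> t" "m s t = enat n"
    | s where "u = [s, s]" "v = []" "s \<in> S" unfolding coxeter_rel_def braid_rel_def by blast
  then show ?case
  proof cases
    case 1
    have c: "cox_coeff m s t = 2 * cos (pi / n)" using 1 by (simp add: cox_coeff_def)
    have "2 \<le> m s t" using assms(1) 1 unfolding artin_datum_def by blast
    then have "2 \<le> n" using 1 by (simp add: numeral_eq_enat)
    moreover have "cox_coeff m s s = - 2" "cox_coeff m t t = - 2" by (simp_all add: cox_coeff_def)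
    ultimately show ?thesis using fire_braid[of "cox_coeff m" s t n] c cox_coeff_sym[OF assms(1) 1(3,4)] 1
      by simp
  next
    case 2
    then show ?thesis by (intro ext) (simp add: fire_def cox_coeff_def algebra_simps)
  qed
qed auto

text \<open>The values at \<open>s\<close> and \<open>t\<close> follow a linear recurrence: each
  firing moves to the next pair of consecutive terms. It is applied to
  \<open>sin (i * \<theta>)\<close> and, for an infinite label, to \<open>i\<close> itself.\<close>

lemma fire_alt_sequence:
  assumes "k s t = c" "k t s = c" "k s s = - 2" "k t t = - 2"
    and "\<And>i. a (Suc (Suc i)) = c * a (Suc i) - a i"
    and "f s = a (Suc i)" "f t = - a i"
  shows "fold (fire k) (alt n s t) f (if even n then s else t) = a (Suc (i + n)) \<and>
    fold (fire k) (alt n s t) f (if even n then t else s) = (- a (i + n) :: real)"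
  using assms
proof (induction n arbitrary: s t f i)
  case (Suc n)
  have g: "fire k s f t = a (Suc (Suc i))" "fire k s f s = - a (Suc i)"
    using Suc.prems by (simp_all add: fire_def algebra_simps)
  show ?case using Suc.IH[of t s "fire k s f" "Suc i"] g Suc.prems by (auto split: if_splits)
qed simp

lemma arith2pi: "0 < x \<Longrightarrow> x < 2 * pi \<Longrightarrow> \<not> (\<exists>n::int. x = real_of_int n * 2 * pi)"
proof
  assume x: "0 < x" "x < 2 * pi" and "\<exists>n::int. x = real_of_int n * 2 * pi"
  then obtain n :: int where n: "x = real_of_int n * 2 * pi" by blast
  have "0 < real_of_int n * (2 * pi)" "real_of_int n * (2 * pi) < 1 * (2 * pi)" using x n by (simp_all add: mult.assoc)
  then have "0 < real_of_int n" "real_of_int n < 1"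
    by (simp_all only: zero_less_mult_pos2[of _ "2 * pi"] mult_less_cancel_right) (auto simp: zero_less_mult_iff)
  then show False by simp
qed

text \<open>Start with the value \<open>a 1\<close> at \<open>s\<close> and 0 elsewhere. A trivial
  power would bring the recurrence back to its start, so \<open>2 * k * \<theta>\<close> would be a
  multiple of \<open>2 * pi\<close> strictly between 0 and \<open>2 * pi\<close>, or, for an
  infinite label, \<open>2 * k\<close> would vanish.\<close>

lemma coxeter_order:
  assumes d: "artin_datum S m" and st: "s \<in> S" "t \<in> S" "s \<noteq> t"
    and k: "0 < k" "enat k < m s t"
  shows "\<not> wcong (coxeter_rel S m) (alt (2 * k) s t) []"
proof
  assume "wcong (coxeter_rel S m) (alt (2 * k) s t) []"
  then have id: "fold (fire (cox_coeff m)) (alt (2 * k) s t) f = f" for f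
    using coxeter_fire[OF d] by (simp add: fun_eq_iff)
  let ?k = "cox_coeff m"
  define c where "c = cox_coeff m s t"
  have kk: "?k s t = c" "?k t s = c" "?k s s = - 2" "?k t t = - 2"
    using cox_coeff_sym[OF d st(1,2)] by (auto simp: c_def cox_coeff_def)
  have *: "a (Suc (2 * k)) = a 1 \<and> a (2 * k) = 0"
    if a: "\<And>i. a (Suc (Suc i)) = c * a (Suc i) - a i" "a 0 = 0" for a :: "nat \<Rightarrow> real"
  proof -
    define f where "f = (\<lambda>u. if u = s then a 1 else 0)"
    have "f s = a (Suc 0)" "f t = - a 0" using st a by (auto simp: f_def)
    from fire_alt_sequence[where k = ?k and a = a and n = "2 * k", OF kk a(1) this]
    show ?thesis unfolding id using st by (simp add: f_def)
  qed
  show False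
  proof (cases "m s t")
    case (enat n)
    define \<theta> where "\<theta> = pi / n"
    have n: "2 \<le> n" using d st enat unfolding artin_datum_def by (metis enat_ord_simps(1) numeral_eq_enat)
    have "\<theta> > 0" "\<theta> < pi" using n by (auto simp: \<theta>_def field_simps)
    then have sp: "sin \<theta> > 0" by (rule sin_gt_zero)
    have c: "c = 2 * cos \<theta>" using enat st by (simp add: c_def cox_coeff_def \<theta>_def)
    have "sin (real (Suc (2 * k)) * \<theta>) = sin \<theta> \<and> sin (real (2 * k) * \<theta>) = 0"
      using *[of "\<lambda>i. sin (real i * \<theta>)"] sin_step[of \<theta>] unfolding c by simp
    moreover have eq: "real (Suc (2 * k)) * \<theta> = real (2 * k) * \<theta> + \<theta>" by (simp add: algebra_simps)
    have "sin (real (Suc (2 * k)) * \<theta>) = sin (real (2 * k) * \<theta>) * cos \<theta> + cos (real (2 * k) * \<theta>) * sin \<theta>"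
      unfolding eq by (rule sin_add)
    ultimately have "cos (real (2 * k) * \<theta>) * sin \<theta> = 1 * sin \<theta>" by simp
    then have "cos (real (2 * k) * \<theta>) = 1" using sp by (metis mult_right_cancel less_irrefl)
    moreover have "0 < real (2 * k) * \<theta>" using k(1) \<open>\<theta> > 0\<close> by simp
    moreover have "real (2 * k) * \<theta> < 2 * pi"
    proof -
      have "k < n" using k(2) enat by simp
      then have "real k * pi < real n * pi" by simp
      then show ?thesis using n by (simp add: \<theta>_def field_simps)
    qed
    ultimately show False using cos_one_2pi_int[of "real (2 * k) * \<theta>"] arith2pi[of "real (2 * k) * \<theta>"] by blast
  next
    case infinity
    have "c = 2" using infinity st by (simp add: c_def cox_coeff_def)
    then show False using *[of real] k(1) by simp
  qed
qed

section \<open>Finite Coxeter groups\<close>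

text \<open>The Coxeter group enters through the values of words in some additive group; the set of
  these values stands for the group.\<close>

locale coxeter_system =
  fixes S :: "'a set" and m :: "'a \<Rightarrow> 'a \<Rightarrow> enat" and c :: "'a \<Rightarrow> 'w::group_add"
  assumes datum: "artin_datum S m"
    and ev_eq_iff: "u \<in> lists S \<Longrightarrow> v \<in> lists S \<Longrightarrow>
      sum_list (map c u) = sum_list (map c v) \<longleftrightarrow> wcong (coxeter_rel S m) u v"
    and finite_ev: "finite ((\<lambda>u. sum_list (map c u)) ` lists S)"
begin

definition ev :: "'a list \<Rightarrow> 'w" where "ev u = sum_list (map c u)"

lemma ev_simps [simp]: "ev [] = 0" "ev (s # u) = c s + ev u" "ev (u @ v) = ev u + ev v"
  by (simp_all add: ev_def)

lemma c_double: "s \<in> S \<Longrightarrow> c s + c s = 0"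
proof -
  assume s: "s \<in> S"
  have "wcong (coxeter_rel S m) [s, s] []" using s by (auto simp: coxeter_rel_def intro: wcong_base)
  then show ?thesis using ev_eq_iff[of "[s, s]" "[]"] s by simp
qed

lemma c_neg: "s \<in> S \<Longrightarrow> - c s = c s"
  by (rule minus_unique) (rule c_double)

lemma c_cancel: "s \<in> S \<Longrightarrow> c s + (c s + x) = x"
  by (simp add: add.assoc[symmetric] c_double)

lemma neg_ev: "u \<in> lists S \<Longrightarrow> - ev u = ev (rev u)"
  by (induction u rule: list.induct) (auto simp: minus_add c_neg simp del: add_uminus_conv_diff)

lemma ev_braid: "(u, v) \<in> braid_rel S m \<Longrightarrow> ev u = ev v"
proof -
  assume a: "(u, v) \<in> braid_rel S m"
  obtain n s t where "u = alt n s t" "v = alt n t s" "s \<in> S" "t \<in> S" using a unfolding braid_rel_def by blast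
  then have l: "u \<in> lists S" "v \<in> lists S" using alt_lists[of s S t n] alt_lists[of t S s n] by simp_all
  have "wcong (coxeter_rel S m) u v" using a unfolding coxeter_rel_def by (blast intro: wcong_base)
  then show ?thesis using ev_eq_iff[OF l] unfolding ev_def by simp
qed

lemma ev_cong: "wcong (coxeter_rel S m) u v \<Longrightarrow> ev u = ev v"
  by (induction rule: wcong.induct) (auto simp: coxeter_rel_def ev_braid c_double)

definition W :: "'w set" where "W = ev ` lists S"

lemma finite_W: "finite W"
  unfolding W_def ev_def using finite_ev .

lemma ev_W [intro]: "u \<in> lists S \<Longrightarrow> ev u \<in> W"
  by (simp add: W_def)

lemma W_E: assumes "x \<in> W" obtains u where "u \<in> lists S" "x = ev u"
  using assms unfolding W_def by blast

lemma W_zero: "0 \<in> W" using ev_W[of "[]"] by simp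

lemma W_c: "s \<in> S \<Longrightarrow> c s \<in> W" using ev_W[of "[s]"] by simp

lemma W_add: "x \<in> W \<Longrightarrow> y \<in> W \<Longrightarrow> x + y \<in> W"
proof -
  assume "x \<in> W" "y \<in> W"
  then obtain u v where "u \<in> lists S" "x = ev u" "v \<in> lists S" "y = ev v" by (elim W_E)
  then show ?thesis using ev_W[of "u @ v"] by simp
qed

lemma W_neg: "x \<in> W \<Longrightarrow> - x \<in> W"
  by (elim W_E) (auto simp: neg_ev in_lists_conv_set)

subsection \<open>The order of a product of two generators\<close>

lemma ev_alt_even: "ev (alt (2 * k) s t) = nmul k (c s + c t)"
  by (induction k) (simp_all add: add.assoc)

lemma ev_alt_odd: "ev (alt (Suc (2 * k)) s t) = nmul k (c s + c t) + c s"
proof -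
  have "ev (alt (Suc (2 * k)) s t) = ev (alt (2 * k) s t) + c s"
    using alt_add[of "2 * k" 1 s t] by simp
  then show ?thesis by (simp only: ev_alt_even)
qed

lemma nmul_st_nonzero:
  assumes "s \<in> S" "t \<in> S" "s \<noteq> t" "0 < k" "enat k < m s t"
  shows "nmul k (c s + c t) \<noteq> 0"
proof -
  have "sum_list (map c (alt (2 * k) s t)) \<noteq> sum_list (map c [])"
    using coxeter_order[OF datum assms] ev_eq_iff[OF alt_lists[OF assms(1,2)] lists.Nil] by blast
  then show ?thesis unfolding ev_alt_even[symmetric] ev_def by simp
qed

lemma c_inj: assumes "s \<in> S" "t \<in> S" "c s = c t" shows "s = t"
proof (rule ccontr)
  assume "s \<noteq> t"
  moreover have "enat 1 < m s t"
  proof -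
    have "2 \<le> m s t" using datum assms \<open>s \<noteq> t\<close> unfolding artin_datum_def by blast
    then show ?thesis by (cases "m s t") (auto simp: numeral_eq_enat)
  qed
  ultimately have "nmul 1 (c s + c t) \<noteq> 0" using nmul_st_nonzero[of s t 1] assms by simp
  then show False using assms c_double by simp
qed

text \<open>By finiteness two multiples of \<open>c s + c t\<close> coincide, which
  \<open>coxeter_order\<close> rules out for an infinite label.\<close>

lemma m_finite:
  assumes st: "s \<in> S" "t \<in> S" "s \<noteq> t"
  obtains n where "m s t = enat n" "2 \<le> n"
proof (cases "m s t")
  case (enat n)
  have "2 \<le> m s t" using datum st unfolding artin_datum_def by blast
  then show ?thesis using enat that by (simp add: numeral_eq_enat)
next
  case infinity
  have "nmul k (c s + c t) \<in> W" for k
    using ev_W[OF alt_lists[OF st(1,2)], of "2 * k"] by (simp add: ev_alt_even)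
  then have "range (\<lambda>k. nmul k (c s + c t)) \<subseteq> W" by auto
  then have "finite (range (\<lambda>k. nmul k (c s + c t)))" using finite_subset[OF _ finite_W] by simp
  then have "\<not> inj (\<lambda>k. nmul k (c s + c t))" using finite_imageD[of "\<lambda>k. nmul k (c s + c t)" UNIV] by auto
  then obtain i j where ij: "i \<noteq> j" "nmul i (c s + c t) = nmul j (c s + c t)" unfolding inj_def by blast
  have "\<exists>k>0. nmul k (c s + c t) = 0"
  proof -
    have *: "nmul (b - a) (c s + c t) = 0" if "a < b" "nmul a (c s + c t) = nmul b (c s + c t)" for a b
    proof -
      have "nmul a (c s + c t) + nmul (b - a) (c s + c t) = nmul a (c s + c t) + 0"
        using nmul_add[of a "b - a" "c s + c t"] that by auto
      then show ?thesis by (simp only: add_left_cancel)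
    qed
    show ?thesis using *[of i j] *[of j i] ij by (metis nat_neq_iff zero_less_diff)
  qed
  then show ?thesis using nmul_st_nonzero[OF st] infinity by auto
qed

lemma nmul_st_zero:
  assumes "s \<in> S" "t \<in> S" "s \<noteq> t" "m s t = enat n"
  shows "nmul n (c s + c t) = 0"
proof -
  have l: "alt n s t \<in> lists S" using alt_lists[OF assms(1,2)] .
  have "(alt n s t, alt n t s) \<in> braid_rel S m" using assms unfolding braid_rel_def by blast
  then have e: "ev (alt n s t) = ev (alt n t s)" by (rule ev_braid)
  have r: "ev (rev (alt n s t)) = ev (alt n s t)" unfolding rev_alt using e by (cases "odd n") simp_all
  have "nmul n (c s + c t) = ev (alt (n + n) s t)" unfolding ev_alt_even[symmetric] mult_2 ..
  also have "\<dots> = ev (alt n s t) + ev (alt n s t)"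
    unfolding alt_add using e by (cases "even n") simp_all
  also have "\<dots> = ev (alt n s t) + - ev (alt n s t)" unfolding neg_ev[OF l] r ..
  finally show ?thesis by simp
qed

subsection \<open>Inversions\<close>

text \<open>\<open>par u r\<close> holds if \<open>r\<close> occurs an odd number of times among the reflections
  \<open>s\<^sub>1 \<dots> s\<^sub>i \<dots> s\<^sub>1\<close> attached to the word \<open>u = s\<^sub>1 \<dots> s\<^sub>k\<close>; this only depends on the element represented by \<open>u\<close>.\<close>

fun par :: "'a list \<Rightarrow> 'w \<Rightarrow> bool" where
  "par [] r \<longleftrightarrow> False"
| "par (s # u) r \<longleftrightarrow> (r = c s) \<noteq> par u (- c s + r + c s)"

lemma par_append: "par (u @ v) r \<longleftrightarrow> par u r \<noteq> par v (- ev u + r + ev u)"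
proof (induction u arbitrary: r)
  case (Cons s u)
  have e: "- ev (s # u) + r + ev (s # u) = - ev u + (- c s + r + c s) + ev u"
    by (simp add: group_simps del: add_uminus_conv_diff)
  show ?case unfolding append_Cons par.simps Cons[of "- c s + r + c s"] e by blast
qed simp

text \<open>The reflection attached to letter \<open>i\<close> of an alternating word, counted from
  0, is the value of the alternating word of length \<open>2 * i + 1\<close>.\<close>

lemma par_alt:
  assumes s: "s \<in> S" and t: "t \<in> S"
  shows "par (alt n s t) r \<longleftrightarrow> odd (card {i. i < n \<and> r = ev (alt (Suc (2 * i)) s t)})"
  using s t
proof (induction n arbitrary: s t r)
  case (Suc n)
  let ?r = "- c s + r + c s"
  have e: "ev (alt (Suc (2 * Suc i)) s t) = c s + ev (alt (Suc (2 * i)) t s) - c s" for i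
  proof -
    have "alt (Suc (2 * Suc i)) s t = s # alt (Suc (2 * i) + 1) t s" by simp
    also have "alt (Suc (2 * i) + 1) t s = alt (Suc (2 * i)) t s @ [s]"
      by (subst alt_add) simp
    finally have "ev (alt (Suc (2 * Suc i)) s t) = c s + (ev (alt (Suc (2 * i)) t s) + c s)"
      by (simp del: alt.simps)
    then show ?thesis using Suc.prems c_neg by (simp add: add.assoc diff_conv_add_uminus del: alt.simps add_uminus_conv_diff)
  qed
  have eq: "r = c s + x - c s \<longleftrightarrow> ?r = x" for x
  proof
    show "r = c s + x - c s \<Longrightarrow> ?r = x" by (simp add: group_simps del: add_uminus_conv_diff)
    assume "?r = x"
    then show "r = c s + x - c s" by (simp add: group_simps del: add_uminus_conv_diff flip: \<open>?r = x\<close>)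
  qed
  have "{i. i < Suc n \<and> r = ev (alt (Suc (2 * i)) s t)} =
    {i. i = 0 \<and> r = c s} \<union> Suc ` {i. i < n \<and> ?r = ev (alt (Suc (2 * i)) t s)}" (is "?A = ?B \<union> Suc ` ?C")
  proof (rule Set.set_eqI)
    fix i show "i \<in> ?A \<longleftrightarrow> i \<in> ?B \<union> Suc ` ?C"
    proof (cases i)
      case 0
      then show ?thesis by auto
    next
      case (Suc j)
      have "r = ev (alt (Suc (2 * Suc j)) s t) \<longleftrightarrow> ?r = ev (alt (Suc (2 * j)) t s)"
        by (simp only: e eq)
      then show ?thesis unfolding Suc by (auto simp del: alt.simps(2) mult_Suc_right)
    qed
  qed
  moreover have "card (?B \<union> Suc ` ?C) = card ?B + card (Suc ` ?C)" by (intro card_Un_disjoint) auto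
  moreover have "card (Suc ` ?C) = card ?C" by (simp add: card_image)
  moreover have "card ?B = (if r = c s then 1 else 0)" by auto
  ultimately show ?case using Suc.IH[of t s ?r] Suc.prems by (auto split: if_splits)
qed simp

text \<open>Since the \<open>n\<close>-fold multiple of \<open>c s + c t\<close> vanishes, the two
  sides of a braid relation have the same reflections in opposite order.\<close>

lemma ev_alt_odd_swap:
  assumes st: "s \<in> S" "t \<in> S" "s \<noteq> t" "m s t = enat n" and i: "i < n"
  shows "ev (alt (Suc (2 * i)) t s) = ev (alt (Suc (2 * (n - 1 - i))) s t)"
proof -
  let ?p = "c s + c t"
  have neg: "- ?p = c t + c s" using c_neg st by (simp add: minus_add del: add_uminus_conv_diff)
  have "nmul (n - 1 - i) ?p + nmul (Suc i) ?p = 0"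
    using nmul_add[of "n - 1 - i" "Suc i" ?p] nmul_st_zero[OF st] i by simp
  then have 1: "nmul (n - 1 - i) ?p = - nmul (Suc i) ?p" by (simp only: add_eq_0_iff2)
  have pq: "?p + (c t + c s) = 0" unfolding neg[symmetric] by (rule add.right_inverse)
  have nn: "nmul k ?p + nmul k (c t + c s) = 0" for k
  proof (induction k)
    case (Suc k)
    have "nmul (Suc k) ?p + nmul (Suc k) (c t + c s) = nmul k ?p + (?p + (c t + c s)) + nmul k (c t + c s)"
      unfolding nmul_Suc_right[of k ?p] nmul.simps(2)[of k "c t + c s"] by (simp only: add.assoc)
    then show ?case unfolding pq using Suc by (simp only: add.right_neutral)
  qed simp
  have 2: "nmul (n - 1 - i) ?p = nmul (Suc i) (c t + c s)"
    unfolding 1 by (rule minus_unique[OF nn])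
  show ?thesis
    unfolding ev_alt_odd 2 nmul_Suc_right using st by (simp only: add.assoc c_double add.right_neutral)
qed

lemma par_braid: "(u, v) \<in> braid_rel S m \<Longrightarrow> par u r = par v r"
proof -
  assume "(u, v) \<in> braid_rel S m"
  then obtain n s t where st: "u = alt n s t" "v = alt n t s" "s \<in> S" "t \<in> S" "s \<noteq> t" "m s t = enat n"
    unfolding braid_rel_def by blast
  have "bij_betw (\<lambda>i. n - 1 - i) {i. i < n \<and> r = ev (alt (Suc (2 * i)) t s)}
     {i. i < n \<and> r = ev (alt (Suc (2 * i)) s t)}"
  proof (rule bij_betw_byWitness[where f' = "\<lambda>i. n - 1 - i"])
    have *: "r = ev (alt (Suc (2 * i)) t s) \<longleftrightarrow> r = ev (alt (Suc (2 * (n - 1 - i))) s t)" if "i < n" for i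
      using ev_alt_odd_swap[OF st(3-6) that] by simp
    have **: "r = ev (alt (Suc (2 * i)) s t) \<longleftrightarrow> r = ev (alt (Suc (2 * (n - 1 - i))) t s)" if "i < n" for i
      using *[of "n - 1 - i"] that by simp
    show "(\<lambda>i. n - 1 - i) ` {i. i < n \<and> r = ev (alt (Suc (2 * i)) t s)} \<subseteq> {i. i < n \<and> r = ev (alt (Suc (2 * i)) s t)}"
      using * by auto
    show "(\<lambda>i. n - 1 - i) ` {i. i < n \<and> r = ev (alt (Suc (2 * i)) s t)} \<subseteq> {i. i < n \<and> r = ev (alt (Suc (2 * i)) t s)}"
      using ** by auto
  qed auto
  then have "card {i. i < n \<and> r = ev (alt (Suc (2 * i)) t s)} = card {i. i < n \<and> r = ev (alt (Suc (2 * i)) s t)}"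
    by (rule bij_betw_same_card)
  then show ?thesis using par_alt[OF st(3,4), of n r] par_alt[OF st(4,3), of n r] st(1,2) by simp
qed

lemma par_cong: "wcong (coxeter_rel S m) u v \<Longrightarrow> par u r = par v r"
proof (induction arbitrary: r rule: wcong.induct)
  case (wcong_base u v)
  then consider "(u, v) \<in> braid_rel S m" | s where "u = [s, s]" "v = []" "s \<in> S"
    unfolding coxeter_rel_def by blast
  then show ?case
  proof cases
    case 1 then show ?thesis by (rule par_braid)
  next
    case 2
    have "- c s + r + c s = c s \<longleftrightarrow> r = c s"
      by (metis add.assoc add_left_cancel add_right_cancel minus_add_cancel)
    then show ?thesis using 2 by auto
  qed
next
  case (wcong_append u u' v v')
  then show ?case using ev_cong[OF wcong_append(1)] by (simp add: par_append)
qed auto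

text \<open>The left inversions of \<open>w\<close>. By \<open>N_ev\<close> any word for
  \<open>w\<close> computes them, and \<open>N_add\<close> is their cocycle rule.\<close>

definition N :: "'w \<Rightarrow> 'w set" where
  "N w = {r. \<exists>u\<in>lists S. ev u = w \<and> par u r}"

lemma N_ev: "u \<in> lists S \<Longrightarrow> r \<in> N (ev u) \<longleftrightarrow> par u r"
proof -
  assume u: "u \<in> lists S"
  have "par v r = par u r" if "v \<in> lists S" "ev v = ev u" for v
    using par_cong[of v u r] ev_eq_iff[OF that(1) u] that(2) unfolding ev_def by blast
  then show ?thesis unfolding N_def mem_Collect_eq using u by metis
qed

lemma N_add: "x \<in> W \<Longrightarrow> y \<in> W \<Longrightarrow> r \<in> N (x + y) \<longleftrightarrow> ((r \<in> N x) \<noteq> (- x + r + x \<in> N y))"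
proof -
  assume "x \<in> W" "y \<in> W"
  then obtain u v where uv: "u \<in> lists S" "x = ev u" "v \<in> lists S" "y = ev v" by (elim W_E)
  show ?thesis using N_ev[of "u @ v" r] N_ev[OF uv(1)] N_ev[OF uv(3)] uv by (simp add: par_append)
qed

lemma N_zero: "r \<notin> N 0"
  using N_ev[of "[]"] by simp

lemma N_c: "s \<in> S \<Longrightarrow> r \<in> N (c s) \<longleftrightarrow> r = c s"
  using N_ev[of "[s]" r] by simp

lemma par_split:
  "par u r \<Longrightarrow> \<exists>u1 s u2. u = u1 @ s # u2 \<and> r = ev u1 + c s - ev u1"
proof (induction u arbitrary: r)
  case (Cons t u)
  show ?case
  proof (cases "r = c t")
    case True
    then show ?thesis by (intro exI[of _ "[]"] exI[of _ t] exI[of _ u]) simp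
  next
    case False
    then have "par u (- c t + r + c t)" using Cons by auto
    then obtain u1 s u2 where u: "u = u1 @ s # u2" "- c t + r + c t = ev u1 + c s - ev u1" using Cons by blast
    have "r = c t + (- c t + r + c t) - c t" by (simp add: group_simps del: add_uminus_conv_diff)
    then have "r = ev (t # u1) + c s - ev (t # u1)"
      unfolding u(2) by (simp add: group_simps del: add_uminus_conv_diff)
    then show ?thesis using u(1) by (metis append_Cons)
  qed
qed simp

text \<open>The strong exchange condition: an inversion is attached to some letter of
  \<open>u\<close>, and multiplying by it deletes that letter.\<close>

lemma exchange:
  assumes u: "u \<in> lists S" and r: "r \<in> N (ev u)"
  shows "\<exists>u1 s u2. u = u1 @ s # u2 \<and> r = ev u1 + c s - ev u1 \<and> r + ev u = ev (u1 @ u2)"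
proof -
  obtain u1 s u2 where s: "u = u1 @ s # u2" "r = ev u1 + c s - ev u1"
    using par_split r N_ev[OF u] by blast
  have "s \<in> S" using u s by simp
  then have "r + ev u = ev (u1 @ u2)"
    using c_cancel unfolding s by (simp add: group_simps del: add_uminus_conv_diff)
  then show ?thesis using s by blast
qed

subsection \<open>Length\<close>

definition l :: "'w \<Rightarrow> nat" where
  "l w = (LEAST k. \<exists>u\<in>lists S. ev u = w \<and> length u = k)"

lemma l_ex: "w \<in> W \<Longrightarrow> \<exists>u\<in>lists S. ev u = w \<and> length u = l w"
proof -
  assume "w \<in> W"
  then obtain u where "u \<in> lists S" "w = ev u" by (rule W_E)
  then have "\<exists>k. \<exists>u\<in>lists S. ev u = w \<and> length u = k" by blast
  then show ?thesis unfolding l_def by (rule LeastI_ex)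
qed

lemma l_le: "u \<in> lists S \<Longrightarrow> l (ev u) \<le> length u"
  unfolding l_def by (rule Least_le) blast

lemma l_zero: "l 0 = 0"
  using l_le[of "[]"] by simp

lemma l_eq_0: "w \<in> W \<Longrightarrow> l w = 0 \<Longrightarrow> w = 0"
  using l_ex[of w] by auto

lemma l_add_le: "x \<in> W \<Longrightarrow> y \<in> W \<Longrightarrow> l (x + y) \<le> l x + l y"
proof -
  assume x: "x \<in> W" and y: "y \<in> W"
  obtain u v where uv: "u \<in> lists S" "ev u = x" "length u = l x" "v \<in> lists S" "ev v = y" "length v = l y"
    using l_ex[OF x] l_ex[OF y] by blast
  then show ?thesis using l_le[of "u @ v"] by simp
qed

lemma l_neg: "x \<in> W \<Longrightarrow> l (- x) = l x"
proof -
  have *: "l (- x) \<le> l x" if x: "x \<in> W" for x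
  proof -
    obtain u where u: "u \<in> lists S" "ev u = x" "length u = l x" using l_ex[OF x] by blast
    then show ?thesis using l_le[of "rev u"] neg_ev[OF u(1)] by (simp add: in_lists_conv_set)
  qed
  assume x: "x \<in> W"
  show ?thesis using *[OF x] *[OF W_neg[OF x]] by simp
qed

lemma N_W_less:
  assumes w: "w \<in> W" and r: "r \<in> N w"
  shows "r + w \<in> W" "l (r + w) < l w"
proof -
  obtain u where u: "u \<in> lists S" "ev u = w" "length u = l w" using l_ex[OF w] by blast
  obtain u1 s u2 where s: "u = u1 @ s # u2" "r + w = ev (u1 @ u2)" using exchange[OF u(1)] r u(2) by blast
  have l: "u1 @ u2 \<in> lists S" using u s by simp
  show "r + w \<in> W" unfolding s(2) using ev_W[OF l] .
  have "l (r + w) \<le> length (u1 @ u2)" unfolding s(2) using l_le[OF l] .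
  then show "l (r + w) < l w" using u(3) s(1) by simp
qed

lemma l_c: "s \<in> S \<Longrightarrow> l (c s) = 1"
proof -
  assume s: "s \<in> S"
  have "l (c s) \<le> 1" using l_le[of "[s]"] s by simp
  moreover have "l (c s) \<noteq> 0"
  proof
    assume "l (c s) = 0"
    then have "c s = 0" by (rule l_eq_0[OF W_c[OF s]])
    then show False using N_c[OF s, of "c s"] N_zero[of "c s"] by simp
  qed
  ultimately show ?thesis by simp
qed

lemma l_descent: "s \<in> S \<Longrightarrow> w \<in> W \<Longrightarrow> c s \<in> N w \<Longrightarrow> l w = Suc (l (c s + w))"
proof -
  assume s: "s \<in> S" and w: "w \<in> W" and d: "c s \<in> N w"
  have "l w \<le> l (c s) + l (c s + w)"
    using l_add_le[OF W_c[OF s] W_add[OF W_c[OF s] w]] c_cancel[OF s] by simp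
  then show ?thesis using N_W_less[OF w d] l_c[OF s] by simp
qed

lemma l_ascent: "s \<in> S \<Longrightarrow> w \<in> W \<Longrightarrow> c s \<notin> N w \<Longrightarrow> l (c s + w) = Suc (l w)"
proof -
  assume s: "s \<in> S" and w: "w \<in> W" and d: "c s \<notin> N w"
  have "c s \<in> N (c s + w)" using N_add[OF W_c[OF s] w] N_c[OF s] d by (simp add: add.assoc)
  then show ?thesis using l_descent[OF s W_add[OF W_c[OF s] w]] c_cancel[OF s] by simp
qed

lemma l_descent_iff: "s \<in> S \<Longrightarrow> w \<in> W \<Longrightarrow> c s \<in> N w \<longleftrightarrow> l (c s + w) < l w"
  using l_descent[of s w] l_ascent[of s w] by (cases "c s \<in> N w") auto

definition reduced :: "'a list \<Rightarrow> bool" where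
  "reduced u \<longleftrightarrow> u \<in> lists S \<and> length u = l (ev u)"

definition red :: "'w \<Rightarrow> 'a list" where
  "red w = (SOME u. u \<in> lists S \<and> ev u = w \<and> length u = l w)"

lemma red: assumes "w \<in> W" shows "red w \<in> lists S" "ev (red w) = w" "length (red w) = l w" "reduced (red w)"
proof -
  have "red w \<in> lists S \<and> ev (red w) = w \<and> length (red w) = l w"
    unfolding red_def using l_ex[OF assms] by (intro someI_ex[of "\<lambda>u. u \<in> lists S \<and> ev u = w \<and> length u = l w"]) blast
  then show "red w \<in> lists S" "ev (red w) = w" "length (red w) = l w" "reduced (red w)"
    by (simp_all add: reduced_def)
qed

lemma reduced_append:
  assumes "reduced (u @ v)"
  shows "reduced u" "reduced v" "l (ev u + ev v) = l (ev u) + l (ev v)"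
proof -
  have uv: "u \<in> lists S" "v \<in> lists S" and len: "length u + length v = l (ev u + ev v)"
    using assms by (simp_all add: reduced_def)
  have "l (ev u + ev v) \<le> l (ev u) + l (ev v)" using l_add_le[OF ev_W ev_W, OF uv] .
  then have "length u = l (ev u)" "length v = l (ev v)" using len l_le[OF uv(1)] l_le[OF uv(2)] by linarith+
  then show "reduced u" "reduced v" "l (ev u + ev v) = l (ev u) + l (ev v)"
    using uv len by (simp_all add: reduced_def)
qed

lemma reduced_appendI:
  "reduced u \<Longrightarrow> reduced v \<Longrightarrow> l (ev u + ev v) = l (ev u) + l (ev v) \<Longrightarrow> reduced (u @ v)"
  by (simp add: reduced_def)

subsection \<open>Parabolic subgroups of the Coxeter group\<close>

definition WJ :: "'a set \<Rightarrow> 'w set" where "WJ J = ev ` lists J"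

lemma lists_sub: "J \<subseteq> S \<Longrightarrow> u \<in> lists J \<Longrightarrow> u \<in> lists S"
  using lists_mono by blast

lemma WJ_ev: "u \<in> lists J \<Longrightarrow> ev u \<in> WJ J"
  by (simp add: WJ_def)

lemma WJ_E: assumes "x \<in> WJ J" obtains u where "u \<in> lists J" "x = ev u"
  using assms unfolding WJ_def by blast

lemma WJ_W: "J \<subseteq> S \<Longrightarrow> x \<in> WJ J \<Longrightarrow> x \<in> W"
  by (elim WJ_E) (simp add: ev_W lists_sub)

lemma WJ_zero: "0 \<in> WJ J" using WJ_ev[of "[]" J] by simp

lemma WJ_c: "s \<in> J \<Longrightarrow> c s \<in> WJ J" using WJ_ev[of "[s]" J] by simp

lemma WJ_add: assumes "x \<in> WJ J" "y \<in> WJ J" shows "x + y \<in> WJ J"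
proof -
  obtain u v where "u \<in> lists J" "x = ev u" "v \<in> lists J" "y = ev v" using assms by (elim WJ_E)
  then show ?thesis using WJ_ev[of "u @ v" J] by simp
qed

lemma WJ_neg: assumes "J \<subseteq> S" "x \<in> WJ J" shows "- x \<in> WJ J"
proof -
  obtain u where "u \<in> lists J" "x = ev u" using assms by (elim WJ_E)
  then show ?thesis using WJ_ev[of "rev u" J] neg_ev[of u] lists_sub[OF assms(1)]
    by (simp add: in_lists_conv_set)
qed

lemma W_eq_WJ: "W = WJ S"
  by (simp add: W_def WJ_def)

text \<open>Shortest among words over \<open>J\<close> only; that such a word is shortest over
  \<open>S\<close> too follows in \<open>jred_reduced\<close>.\<close>

definition jred :: "'a set \<Rightarrow> 'a list \<Rightarrow> bool" where
  "jred J p \<longleftrightarrow> p \<in> lists J \<and> (\<forall>q\<in>lists J. ev q = ev p \<longrightarrow> length p \<le> length q)"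

lemma ex_jred: assumes "x \<in> WJ J" obtains p where "jred J p" "ev p = x"
proof -
  obtain u where "u \<in> lists J" "x = ev u" using assms by (elim WJ_E)
  then obtain p where "p \<in> lists J \<and> ev p = x" "\<forall>q. q \<in> lists J \<and> ev q = x \<longrightarrow> length p \<le> length q"
    using ex_has_least_nat[of "\<lambda>p. p \<in> lists J \<and> ev p = x" u length] by blast
  then show ?thesis using that unfolding jred_def by blast
qed

text \<open>A new first letter \<open>a\<close> is no inversion of \<open>ev p\<close>, since an
  exchange would shorten the word within \<open>J\<close>. Its conjugate by \<open>ev p\<close> lies
  in \<open>WJ J\<close> and so is no inversion of \<open>v\<close>. By the cocycle rule
  \<open>a\<close> lengthens the sum.\<close>

lemma l_jred:
  assumes J: "J \<subseteq> S" and v: "v \<in> W" "\<And>r. r \<in> N v \<Longrightarrow> r \<notin> WJ J" and "jred J p"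
  shows "l (ev p + v) = length p + l v"
  using assms(4)
proof (induction p)
  case (Cons a p)
  have a: "a \<in> J" and p: "p \<in> lists J" using Cons.prems by (simp_all add: jred_def)
  have aS: "a \<in> S" and pS: "p \<in> lists S" using a p J lists_sub by auto
  have "jred J p" unfolding jred_def
  proof (intro conjI ballI impI)
    fix q assume "q \<in> lists J" "ev q = ev p"
    then have "a # q \<in> lists J" "ev (a # q) = ev (a # p)" using a by simp_all
    then have "length (a # p) \<le> length (a # q)" using Cons.prems unfolding jred_def by blast
    then show "length p \<le> length q" by simp
  qed (rule p)
  then have IH: "l (ev p + v) = length p + l v" by (rule Cons.IH)
  have "c a \<notin> N (ev p)"
  proof
    assume "c a \<in> N (ev p)"
    then obtain u1 s u2 where s: "p = u1 @ s # u2" "c a + ev p = ev (u1 @ u2)" using exchange[OF pS] by blast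
    have "u1 @ u2 \<in> lists J" "ev (u1 @ u2) = ev (a # p)" using p s by simp_all
    then have "length (a # p) \<le> length (u1 @ u2)" using Cons.prems unfolding jred_def by blast
    then show False using s(1) by simp
  qed
  moreover have "- ev p + c a + ev p \<in> WJ J"
    using WJ_add[OF WJ_add[OF WJ_neg[OF J WJ_ev[OF p]] WJ_c[OF a]] WJ_ev[OF p]] .
  then have "- ev p + c a + ev p \<notin> N v" using v(2) by blast
  ultimately have "c a \<notin> N (ev p + v)" using N_add[OF ev_W[OF pS] v(1)] by blast
  then show ?case using l_ascent[OF aS W_add[OF ev_W[OF pS] v(1)]] IH by (simp add: add.assoc)
qed simp

lemma jred_reduced: "J \<subseteq> S \<Longrightarrow> jred J p \<Longrightarrow> reduced p"
  using l_jred[of J 0 p] W_zero N_zero l_zero lists_sub[of J p] unfolding reduced_def jred_def by auto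

lemma reduced_jred: "p \<in> lists J \<Longrightarrow> J \<subseteq> S \<Longrightarrow> reduced p \<Longrightarrow> jred J p"
proof -
  assume p: "p \<in> lists J" and J: "J \<subseteq> S" and r: "reduced p"
  have "length p \<le> length q" if "q \<in> lists J" "ev q = ev p" for q
    using l_le[OF lists_sub[OF J that(1)]] r that(2) unfolding reduced_def by simp
  then show ?thesis using p unfolding jred_def by blast
qed

text \<open>For \<open>v\<close> take a shortest element of the coset of \<open>w\<close>: an
  inversion in \<open>WJ J\<close> would lead to a shorter element of the same coset.\<close>

lemma parabolic_decomposition:
  assumes J: "J \<subseteq> S" and w: "w \<in> W"
  obtains u v where "u \<in> WJ J" "v \<in> W" "w = u + v" "\<And>r. r \<in> N v \<Longrightarrow> r \<notin> WJ J"
proof -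
  define P where "P v \<longleftrightarrow> v \<in> W \<and> w - v \<in> WJ J" for v
  have "P w" unfolding P_def using w WJ_zero by simp
  then obtain v where v: "P v" "\<And>y. P y \<Longrightarrow> l v \<le> l y" using ex_has_least_nat[of P w l] by blast
  have "r \<notin> WJ J" if r: "r \<in> N v" for r
  proof
    assume rJ: "r \<in> WJ J"
    have "w - (r + v) = (w - v) + - r" by (simp add: group_simps del: add_uminus_conv_diff)
    then have "w - (r + v) \<in> WJ J" using WJ_add[OF _ WJ_neg[OF J rJ]] v(1) unfolding P_def by simp
    then have "P (r + v)" using N_W_less(1)[OF _ r] v(1) unfolding P_def by blast
    then show False using v(2) N_W_less(2)[OF _ r] v(1) unfolding P_def by fastforce
  qed
  then show ?thesis using that[of "w - v" v] v(1) unfolding P_def by simp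
qed

text \<open>The \<open>{s, t}\<close>-part \<open>u\<close> of \<open>w\<close> has both generators
  as inversions. A shortest word for it is alternating in some \<open>a\<close>, \<open>b\<close>,
  and \<open>c b\<close> being an inversion forces \<open>(a b)^(i+1) = 1\<close> with
  \<open>i\<close> below its length. So the word has at least \<open>n\<close> letters and begins
  with the longest element of \<open>WJ {s, t}\<close>.\<close>

lemma rank_two:
  assumes st: "s \<in> S" "t \<in> S" "s \<noteq> t" "m s t = enat n" and w: "w \<in> W" "c s \<in> N w" "c t \<in> N w"
  shows "l w = n + l (- ev (alt n s t) + w)" "reduced (alt n s t)"
proof -
  let ?J = "{s, t}"
  have J: "?J \<subseteq> S" using st by blast
  obtain u v where uv: "u \<in> WJ ?J" "v \<in> W" "w = u + v" "\<And>r. r \<in> N v \<Longrightarrow> r \<notin> WJ ?J"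
    using parabolic_decomposition[OF J w(1)] by metis
  obtain p where p: "jred ?J p" "ev p = u" by (rule ex_jred[OF uv(1)])
  have uW: "u \<in> W" using WJ_W[OF J uv(1)] .
  have red_p: "reduced p" using jred_reduced[OF J p(1)] .
  have pJ: "p \<in> lists ?J" using p(1) by (simp add: jred_def)
  have pS: "p \<in> lists S" using lists_sub[OF J pJ] .
  have Nu: "c x \<in> N u" if "x \<in> ?J" for x
  proof -
    have "- u + c x + u \<in> WJ ?J"
      using WJ_add[OF WJ_add[OF WJ_neg[OF J uv(1)] WJ_c[OF that]] uv(1)] .
    then have "- u + c x + u \<notin> N v" using uv(4) by blast
    moreover have "c x \<in> N (u + v)" using w that uv(3) by auto
    ultimately show ?thesis using N_add[OF uW uv(2)] by blast
  qed
  have norep: "\<nexists>x a y. p = x @ a # a # y"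
  proof
    assume "\<exists>x a y. p = x @ a # a # y"
    then obtain x a y where xy: "p = x @ a # a # y" by blast
    have "a \<in> S" using pS xy by simp
    then have "ev p = ev (x @ y)" unfolding xy using c_cancel by simp
    moreover have "x @ y \<in> lists ?J" using pJ xy by simp
    ultimately have "length p \<le> length (x @ y)" using p(1) unfolding jred_def by metis
    then show False using xy by simp
  qed
  obtain a b where ab: "{a, b} = ?J" "p = alt (length p) a b" using alt_of_no_repetition[OF pJ norep] by blast
  have abS: "a \<in> S" "b \<in> S" "a \<noteq> b" and mab: "m a b = enat n"
  proof -
    have "m s t = m t s" using datum st unfolding artin_datum_def by blast
    then show "a \<in> S" "b \<in> S" "a \<noteq> b" "m a b = enat n" using ab(1) st by (auto simp: doubleton_eq_iff)
  qed
  have "c b \<in> N (ev p)" using Nu[of b] ab(1) p(2) by auto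
  then have "par (alt (length p) a b) (c b)" using N_ev[OF pS] ab(2) by simp
  then have "odd (card {i. i < length p \<and> c b = ev (alt (Suc (2 * i)) a b)})"
    using par_alt[OF abS(1,2)] by blast
  then have "{i. i < length p \<and> c b = ev (alt (Suc (2 * i)) a b)} \<noteq> {}" by (metis card.empty even_zero)
  then obtain i where i: "i < length p" "c b = ev (alt (Suc (2 * i)) a b)" by blast
  have "nmul (Suc i) (c a + c b) = (nmul i (c a + c b) + c a) + c b"
    unfolding nmul_Suc_right by (simp only: add.assoc)
  also have "\<dots> = c b + c b" using i(2) unfolding ev_alt_odd by simp
  also have "\<dots> = 0" using c_double[OF abS(2)] .
  finally have "nmul (Suc i) (c a + c b) = 0" .
  then have "\<not> enat (Suc i) < m a b" using nmul_st_nonzero[OF abS, of "Suc i"] by blast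
  then have "n \<le> length p" using i(1) mab by simp
  then obtain j where j: "length p = n + j" using le_Suc_ex by blast
  define rest where "rest = (if even n then alt j a b else alt j b a)"
  have p_split: "p = alt n a b @ rest" using ab(2) unfolding j alt_add rest_def .
  have "{a, b} = {s, t}" by (rule ab(1))
  then have ev_eq: "ev (alt n a b) = ev (alt n s t)"
  proof -
    have "(alt n s t, alt n t s) \<in> braid_rel S m" using st unfolding braid_rel_def by blast
    then have "ev (alt n s t) = ev (alt n t s)" by (rule ev_braid)
    then show ?thesis using ab(1) by (auto simp: doubleton_eq_iff)
  qed
  have red2: "reduced (alt n a b)" "reduced rest" using reduced_append[of "alt n a b" rest] red_p p_split by simp_all
  then have "n = l (ev (alt n s t))" unfolding reduced_def ev_eq by simp
  then show "reduced (alt n s t)" unfolding reduced_def using alt_lists[OF st(1,2)] by simp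
  have restJ: "rest \<in> lists ?J" using pJ p_split by simp
  have "- ev (alt n s t) + w = ev rest + v"
    unfolding ev_eq[symmetric] uv(3) p(2)[symmetric] p_split by (simp add: add.assoc)
  then have "l (- ev (alt n s t) + w) = length rest + l v"
    using l_jred[OF J uv(2,4) reduced_jred[OF restJ J red2(2)]] by simp
  moreover have "l w = length p + l v" using l_jred[OF J uv(2,4) p(1)] uv(3) p(2) by simp
  ultimately show "l w = n + l (- ev (alt n s t) + w)" using p_split by simp
qed

subsection \<open>The weak order\<close>

text \<open>The right weak order: some reduced word for \<open>y\<close> begins with a reduced word
  for \<open>x\<close>.\<close>

definition wle :: "'w \<Rightarrow> 'w \<Rightarrow> bool" where
  "wle x y \<longleftrightarrow> x \<in> W \<and> y \<in> W \<and> l y = l x + l (- x + y)"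

lemma wle_W: assumes "wle x y" shows "x \<in> W" "y \<in> W" "- x + y \<in> W"
  using assms W_add[OF W_neg, of x y] unfolding wle_def by simp_all

lemma wle_refl: "x \<in> W \<Longrightarrow> wle x x"
  by (simp add: wle_def l_zero)

lemma wle_zero: "x \<in> W \<Longrightarrow> wle 0 x"
  by (simp add: wle_def l_zero W_zero)

lemma wle_add: "x \<in> W \<Longrightarrow> y \<in> W \<Longrightarrow> l (x + y) = l x + l y \<Longrightarrow> wle x (x + y)"
  by (simp add: wle_def W_add)

lemma wle_shift:
  assumes x: "wle x y" and v: "wle v (- x + y)"
  shows "wle (x + v) y" "wle x (x + v)"
proof -
  have W: "x \<in> W" "y \<in> W" "v \<in> W" "- v + (- x + y) \<in> W" using wle_W[OF x] wle_W[OF v] by blast+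
  have eq: "- (x + v) + y = - v + (- x + y)" by (simp add: group_simps del: add_uminus_conv_diff)
  have "l y = l x + (l v + l (- v + (- x + y)))" using x v unfolding wle_def by simp
  moreover have "l y \<le> l (x + v) + l (- v + (- x + y))"
    using l_add_le[OF W_add[OF W(1,3)] W(4)] unfolding eq[symmetric] by simp
  moreover have "l (x + v) \<le> l x + l v" using l_add_le[OF W(1,3)] .
  ultimately have "l y = l (x + v) + l (- v + (- x + y))" "l (x + v) = l x + l v" by linarith+
  then show "wle (x + v) y" "wle x (x + v)" unfolding wle_def eq using W W_add by simp_all
qed

lemma wle_trans:
  assumes "wle x y" "wle y z" shows "wle x z"
proof -
  have W: "x \<in> W" "y \<in> W" "z \<in> W" "- x + y \<in> W" "- y + z \<in> W" "- x + z \<in> W"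
    using wle_W[OF assms(1)] wle_W[OF assms(2)] W_add[OF W_neg, of x z] by simp_all
  have eq: "(- x + y) + (- y + z) = - x + z" by (simp add: add.assoc)
  have "l z = l x + l (- x + y) + l (- y + z)" using assms unfolding wle_def by simp
  moreover have "l (- x + z) \<le> l (- x + y) + l (- y + z)" using l_add_le[OF W(4,5)] unfolding eq .
  moreover have "l z \<le> l x + l (- x + z)" using l_add_le[OF W(1,6)] by simp
  ultimately have "l z = l x + l (- x + z)" by linarith
  then show ?thesis using W unfolding wle_def by blast
qed

lemma wle_antisym: assumes "wle x y" "l y \<le> l x" shows "x = y"
proof -
  have "l (- x + y) = 0" using assms unfolding wle_def by linarith
  then have "- x + y = 0" using l_eq_0 wle_W(3)[OF assms(1)] by blast
  then show ?thesis by (metis add.right_neutral add_minus_cancel)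
qed

lemma wle_c: "s \<in> S \<Longrightarrow> z \<in> W \<Longrightarrow> wle (c s) z \<longleftrightarrow> c s \<in> N z"
  using l_descent[of s z] l_ascent[of s z] l_c[of s] W_c[of s] c_neg[of s]
  unfolding wle_def by (cases "c s \<in> N z") auto

lemma wle_cancel:
  assumes "wle (x + v) y" "wle x (x + v)"
  shows "wle v (- x + y)"
proof -
  have xy: "wle x y" using wle_trans[OF assms(2,1)] .
  have eq: "- (x + v) + y = - v + (- x + y)" by (simp add: group_simps del: add_uminus_conv_diff)
  have "v \<in> W" using wle_W(3)[OF assms(2)] by simp
  moreover have "l y = l x + l v + l (- v + (- x + y))" using assms unfolding wle_def eq by simp
  moreover have "l y = l x + l (- x + y)" using xy unfolding wle_def by blast
  ultimately have "l (- x + y) = l v + l (- v + (- x + y))" by linarith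
  then show ?thesis using \<open>v \<in> W\<close> wle_W(3)[OF xy] unfolding wle_def by blast
qed

lemma reduced_wle: "reduced (u @ v) \<Longrightarrow> wle (ev u) (ev (u @ v))"
proof -
  assume a: "reduced (u @ v)"
  have "u \<in> lists S" "v \<in> lists S" using a unfolding reduced_def by simp_all
  then show ?thesis using wle_add[OF ev_W ev_W, of u v] reduced_append(3)[OF a] by simp
qed

lemma ex_first:
  assumes "z \<in> W" "z \<noteq> 0" shows "\<exists>s\<in>S. wle (c s) z"
proof -
  obtain s q where q: "red z = s # q" using red(2)[OF assms(1)] assms(2) by (cases "red z") auto
  then have "reduced ([s] @ q)" using red(4)[OF assms(1)] by simp
  then have "wle (ev [s]) (ev ([s] @ q))" by (rule reduced_wle)
  then have "wle (c s) (ev (red z))" unfolding q by simp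
  then have "wle (c s) z" unfolding red(2)[OF assms(1)] .
  moreover have "s \<in> S" using red(1)[OF assms(1)] q by simp
  ultimately show ?thesis by blast
qed

text \<open>Seen from \<open>a\<close>, an upper bound has \<open>s\<close> and \<open>t\<close> as
  descents, so by \<open>rank_two\<close> it begins with the longest element of
  \<open>WJ {s, t}\<close>; appended to \<open>a\<close> this is the join.\<close>

lemma wjoin_generators:
  assumes st: "s \<in> S" "t \<in> S" and a: "wle a (a + c s)" "wle a (a + c t)"
    and z: "wle (a + c s) z" "wle (a + c t) z"
  shows "\<exists>j. wle (a + c s) j \<and> wle (a + c t) j \<and>
    (\<forall>u. wle (a + c s) u \<longrightarrow> wle (a + c t) u \<longrightarrow> wle j u)"
proof (cases "s = t")
  case True
  then show ?thesis using wle_refl wle_W(1)[OF z(1)] by blast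
next
  case False
  obtain n where n: "m s t = enat n" using m_finite[OF st False] by blast
  define A where "A = ev (alt n s t)"
  have "(alt n s t, alt n t s) \<in> braid_rel S m" using st n False unfolding braid_rel_def by blast
  then have A': "A = ev (alt n t s)" unfolding A_def by (rule ev_braid)
  have n0: "n > 0"
    using m_finite[OF st False] n by force
  have mts: "m t s = enat n" using datum st n False unfolding artin_datum_def by metis
  have key: "wle A (- a + u) \<and> reduced (alt n s t) \<and> reduced (alt n t s)"
    if u: "wle (a + c s) u" "wle (a + c t) u" for u
  proof -
    have au: "- a + u \<in> W" using wle_W(3)[OF wle_trans[OF a(1) u(1)]] .
    have d: "c s \<in> N (- a + u)" "c t \<in> N (- a + u)"
      using wle_cancel[OF u(1) a(1)] wle_cancel[OF u(2) a(2)] wle_c[OF st(1) au] wle_c[OF st(2) au] by auto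
    note r = rank_two[OF st False n au d]
    have "reduced (alt n t s)" using rank_two(2)[OF st(2,1) _ mts au d(2,1)] False by blast
    moreover have "wle A (- a + u)"
      unfolding wle_def A_def using r au ev_W[OF alt_lists[OF st]] by (simp add: reduced_def)
    ultimately show ?thesis using r by blast
  qed
  have az: "wle a z" using wle_trans[OF a(1) z(1)] .
  have Az: "wle a (a + A)" using wle_shift(2)[OF az] key[OF z] by blast
  have first: "wle (c x) A" if "reduced (alt n x y)" "A = ev (alt n x y)" for x y
  proof -
    obtain k where k: "n = Suc k" using n0 by (cases n) auto
    have "reduced ([x] @ alt k y x)" using that(1) unfolding k by simp
    then have "wle (ev [x]) (ev ([x] @ alt k y x))" by (rule reduced_wle)
    then show ?thesis using that(2) unfolding k by simp
  qed
  have "wle (a + c s) (a + A)" "wle (a + c t) (a + A)"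
    using wle_shift(1)[OF Az, of "c s"] wle_shift(1)[OF Az, of "c t"]
      first[of s t] first[of t s] key[OF z] A_def A' by (simp_all)
  moreover have "wle (a + A) u" if u: "wle (a + c s) u" "wle (a + c t) u" for u
    using wle_shift(1)[OF wle_trans[OF a(1) u(1)]] key[OF u] by blast
  ultimately show ?thesis by blast
qed

lemma bounded_wjoin:
  assumes "wle x z" "wle y z"
  shows "\<exists>j. wle x j \<and> wle y j \<and> (\<forall>u. wle x u \<longrightarrow> wle y u \<longrightarrow> wle u z \<longrightarrow> wle j u)"
proof -
  \<comment> \<open>\<open>wle\<close> is reflexive on \<open>W\<close> only, while the criterion
    asks for a relation reflexive on the whole type.\<close>
  define le where "le a b \<longleftrightarrow> wle a b \<or> a = b" for a b
  define C where "C a b \<longleftrightarrow> wle a b \<and> (\<exists>s\<in>S. b = a + c s)" for a b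
  have leW: "le a b \<longleftrightarrow> wle a b" if "a \<in> W" for a b
    using that wle_refl unfolding le_def by blast
  have xy: "x \<in> W" "y \<in> W" using wle_W(1) assms by blast+
  have "\<exists>j. le x j \<and> le y j \<and> (\<forall>u. le x u \<longrightarrow> le y u \<longrightarrow> le u z \<longrightarrow> le j u)"
  proof (rule local_join_imp_join[where le = le and C = C and rk = "\<lambda>a z. l z - l a" and a = 0])
    show "le a a" for a by (simp add: le_def)
    show "le a b \<Longrightarrow> le b d \<Longrightarrow> le a d" for a b d unfolding le_def using wle_trans by blast
    show "C a b \<Longrightarrow> le a b" for a b unfolding C_def le_def by blast
    show "\<exists>b. C a b \<and> le b x" if ax: "le a x" "a \<noteq> x" for a x
    proof -
      have ax': "wle a x" using ax unfolding le_def by blast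
      have "- a + x \<noteq> 0" using ax(2) by (metis add.right_neutral add_minus_cancel)
      then obtain s where s: "s \<in> S" "wle (c s) (- a + x)" using ex_first wle_W(3)[OF ax'] by blast
      then show ?thesis using wle_shift[OF ax' s(2)] unfolding C_def le_def by blast
    qed
    show "l z - l b < l z - l a" if ab: "C a b" "le b z" for a b z
    proof -
      obtain s where s: "s \<in> S" "b = a + c s" "wle a b" using ab unfolding C_def by blast
      have "l b = l a + 1" using s l_c unfolding wle_def by simp
      moreover have "wle b z" using ab(2) leW wle_W(2)[OF s(3)] by blast
      then have "l b \<le> l z" unfolding wle_def by simp
      ultimately show ?thesis by simp
    qed
    show "\<exists>j. le x j \<and> le y j \<and> (\<forall>u. le x u \<longrightarrow> le y u \<longrightarrow> le u z \<longrightarrow> le j u)"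
      if C: "C a x" "C a y" and z: "le x z" "le y z" for a x y z
    proof -
      obtain s t where s: "s \<in> S" "t \<in> S" "x = a + c s" "y = a + c t" "wle a x" "wle a y"
        using C unfolding C_def by blast
      have W: "x \<in> W" "y \<in> W" using wle_W(2) s by blast+
      obtain j where j: "wle x j" "wle y j" "\<And>u. wle x u \<Longrightarrow> wle y u \<Longrightarrow> wle j u"
        using wjoin_generators[OF s(1,2), of a z] z s leW[OF W(1)] leW[OF W(2)] by auto
      have "le x j" "le y j" using j(1,2) unfolding le_def by blast+
      moreover have "le j u" if "le x u" "le y u" for u
        using j(3)[of u] that leW[OF W(1)] leW[OF W(2)] unfolding le_def by blast
      ultimately show ?thesis by blast
    qed
    show "le 0 x" "le 0 y" using xy wle_zero unfolding le_def by blast+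
    show "le x z" "le y z" using assms unfolding le_def by blast+
  qed
  then obtain j where j: "le x j" "le y j" "\<And>u. le x u \<Longrightarrow> le y u \<Longrightarrow> le u z \<Longrightarrow> le j u" by blast
  have "wle x j" "wle y j" using j(1,2) leW xy by blast+
  moreover have "wle j u" if "wle x u" "wle y u" "wle u z" for u
    using j(3)[of u] that leW[OF wle_W(2)[OF \<open>wle x j\<close>]] unfolding le_def by blast
  ultimately show ?thesis by blast
qed

lemma WJ_reduced:
  assumes "J \<subseteq> S" "x \<in> WJ J" obtains p where "p \<in> lists J" "reduced p" "ev p = x"
proof -
  obtain p where p: "jred J p" "ev p = x" using ex_jred[OF assms(2)] by blast
  then show ?thesis using that[of p] jred_reduced[OF assms(1)] unfolding jred_def by blast
qed

subsection \<open>Longest elements\<close>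

text \<open>A reflection \<open>r\<close> is an inversion of itself, so by the cocycle rule it is an
  inversion of exactly one of \<open>w\<close> and \<open>r + w\<close>, the longer one.\<close>

lemma reflection_in_N:
  assumes x: "x \<in> W" and s: "s \<in> S" and w: "w \<in> W"
    and max: "l (x + c s - x + w) \<le> l w"
  shows "x + c s - x \<in> N w"
proof (rule ccontr)
  define r where "r = x + c s - x"
  assume "x + c s - x \<notin> N w"
  then have nr: "r \<notin> N w" by (simp add: r_def)
  have nx: "- x \<in> W" using W_neg[OF x] .
  have rW: "r \<in> W" unfolding r_def diff_conv_add_uminus using W_add[OF W_add[OF x W_c[OF s]] nx] .
  have e: "- x + r + x = c s" by (simp add: r_def group_simps del: add_uminus_conv_diff)
  have r2: "r + (r + w) = w"
    unfolding r_def using c_cancel[OF s] by (simp add: group_simps del: add_uminus_conv_diff)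
  have 1: "r \<in> N x \<longleftrightarrow> c s \<in> N (- x)"
    using N_add[OF x nx, of r] N_zero[of r] unfolding e by simp
  have "c s \<in> N (c s + - x) \<longleftrightarrow> c s \<notin> N (- x)"
    using N_add[OF W_c[OF s] nx, of "c s"] N_c[OF s] by simp
  moreover have "r = x + (c s + - x)" by (simp add: r_def group_simps del: add_uminus_conv_diff)
  ultimately have "r \<in> N r" using N_add[OF x W_add[OF W_c[OF s] nx], of r] 1 unfolding e by metis
  then have "r \<in> N (r + w)" using N_add[OF rW w, of r] nr by simp
  then have "l (r + (r + w)) < l (r + w)" using N_W_less(2)[OF W_add[OF rW w]] by blast
  then show False using max unfolding r2 r_def[symmetric] by simp
qed

text \<open>If \<open>w\<close> has greatest length in \<open>WJ J\<close>, all conjugates within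
  \<open>WJ J\<close> of generators in \<open>J\<close> are inversions of \<open>w\<close>. Reduced
  words are then prefixes of \<open>w\<close>, letter by letter: the reflection of the next letter
  is an inversion of \<open>w\<close> but not of the part already read.\<close>

lemma ex_longest:
  assumes J: "J \<subseteq> S"
  shows "\<exists>w\<in>WJ J. \<forall>u\<in>WJ J. wle u w"
proof -
  have "WJ J \<subseteq> W" using WJ_W[OF J] by blast
  then have "finite (WJ J)" using finite_subset[OF _ finite_W] by simp
  then have "finite (l ` WJ J)" "l ` WJ J \<noteq> {}" using WJ_zero by auto
  then have "Max (l ` WJ J) \<in> l ` WJ J" by (rule Max_in)
  then obtain w where w: "w \<in> WJ J" "l w = Max (l ` WJ J)" by auto
  have max: "l u \<le> l w" if "u \<in> WJ J" for u using w(2) that \<open>finite (l ` WJ J)\<close> by simp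
  have wW: "w \<in> W" using WJ_W[OF J w(1)] .
  have "wle (ev p) w" if "p \<in> lists J" "reduced p" for p
    using that
  proof (induction p rule: rev_induct)
    case Nil
    then show ?case using wle_zero[OF wW] by simp
  next
    case (snoc s p)
    have s: "s \<in> J" "s \<in> S" and p: "p \<in> lists J" "p \<in> lists S" using snoc.prems lists_sub[OF J] J by auto
    have rp: "reduced p" using reduced_append[OF snoc.prems(2)] by blast
    have IH: "wle (ev p) w" using snoc.IH p rp by blast
    define z where "z = - ev p + w"
    define r where "r = ev p + c s - ev p"
    have zW: "z \<in> W" and wz: "w = ev p + z" using wle_W(3)[OF IH] by (simp_all add: z_def)
    have pW: "ev p \<in> W" using ev_W[OF p(2)] .
    have rJ: "r \<in> WJ J" unfolding r_def diff_conv_add_uminus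
      using WJ_add[OF WJ_add[OF WJ_ev[OF p(1)] WJ_c[OF s(1)]] WJ_neg[OF J WJ_ev[OF p(1)]]] .
    have "r \<in> N w"
      using reflection_in_N[OF pW s(2) wW] max[OF WJ_add[OF rJ w(1)]] unfolding r_def by blast
    moreover have "r \<notin> N (ev p)"
    proof
      assume "r \<in> N (ev p)"
      then have "l (r + ev p) < l (ev p)" using N_W_less(2)[OF pW] by blast
      moreover have "r + ev p = ev (p @ [s])" by (simp add: r_def)
      moreover have "l (ev (p @ [s])) = length p + 1" "l (ev p) = length p"
        using snoc.prems(2) rp unfolding reduced_def by simp_all
      ultimately show False by simp
    qed
    moreover have "- ev p + r + ev p = c s" by (simp add: r_def group_simps del: add_uminus_conv_diff)
    ultimately have "c s \<in> N z" using N_add[OF pW zW, of r] unfolding wz by simp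
    then have "wle (c s) (- ev p + w)" using wle_c[OF s(2) zW] unfolding z_def by blast
    then show ?case using wle_shift(1)[OF IH] by simp
  qed
  then have "wle u w" if u: "u \<in> WJ J" for u
  proof -
    obtain p where "p \<in> lists J" "reduced p" "ev p = u" using WJ_reduced[OF J u] by blast
    then show ?thesis using \<open>\<And>p. p \<in> lists J \<Longrightarrow> reduced p \<Longrightarrow> wle (ev p) w\<close> by blast
  qed
  then show ?thesis using w(1) by blast
qed

definition wJ :: "'a set \<Rightarrow> 'w" where
  "wJ J = (SOME w. w \<in> WJ J \<and> (\<forall>u\<in>WJ J. wle u w))"

lemma wJ: assumes "J \<subseteq> S" shows "wJ J \<in> WJ J" "\<And>u. u \<in> WJ J \<Longrightarrow> wle u (wJ J)"
proof -
  have "\<exists>w. w \<in> WJ J \<and> (\<forall>u\<in>WJ J. wle u w)" using ex_longest[OF assms] by blast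
  then have "wJ J \<in> WJ J \<and> (\<forall>u\<in>WJ J. wle u (wJ J))" unfolding wJ_def by (rule someI_ex)
  then show "wJ J \<in> WJ J" "\<And>u. u \<in> WJ J \<Longrightarrow> wle u (wJ J)" by blast+
qed

lemma wJ_W: "J \<subseteq> S \<Longrightarrow> wJ J \<in> W"
  by (rule WJ_W[OF _ wJ(1)])

text \<open>If \<open>w\<close> is a proper prefix of \<open>wJ J\<close>, the next letter in a
  reduced word for \<open>wJ J\<close> would have to lengthen \<open>w\<close>.\<close>

lemma wJ_unique:
  assumes J: "J \<subseteq> S" and w: "w \<in> WJ J" and d: "\<And>s. s \<in> J \<Longrightarrow> l (w + c s) < l w"
  shows "w = wJ J"
proof (rule ccontr)
  assume ne: "w \<noteq> wJ J"
  have le: "wle w (wJ J)" using wJ(2)[OF J w] .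
  have zJ: "- w + wJ J \<in> WJ J" using WJ_add[OF WJ_neg[OF J w] wJ(1)[OF J]] .
  obtain p where p: "p \<in> lists J" "reduced p" "ev p = - w + wJ J" using WJ_reduced[OF J zJ] by blast
  have wJp: "wJ J = w + ev p" unfolding p(3) by simp
  then have "p \<noteq> []" using ne by auto
  then obtain s q where sq: "p = s # q" by (cases p) auto
  have s: "s \<in> J" "s \<in> S" and q: "q \<in> lists S" using p(1) sq J lists_sub[OF J, of q] by auto
  have wW: "w \<in> W" using WJ_W[OF J w] .
  have "wJ J = (w + c s) + ev q" unfolding wJp sq by (simp add: add.assoc)
  then have "l (wJ J) \<le> l (w + c s) + length q"
    using l_add_le[OF W_add[OF wW W_c[OF s(2)]] ev_W[OF q]] l_le[OF q] by simp
  moreover have "l (wJ J) = l w + length p" using le p(2,3) unfolding wle_def reduced_def by simp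
  ultimately show False using d[OF s(1)] sq by simp
qed

lemma wJ_descent:
  assumes J: "J \<subseteq> S" and u: "u \<in> WJ J"
  shows "l (wJ J) = l (wJ J + u) + l u"
proof -
  have "wJ J + u \<in> WJ J" using WJ_add[OF wJ(1)[OF J] u] .
  then have "l (wJ J) = l (wJ J + u) + l (- (wJ J + u) + wJ J)" using wJ(2)[OF J] unfolding wle_def by blast
  moreover have "- (wJ J + u) + wJ J = - u" by (simp add: group_simps del: add_uminus_conv_diff)
  ultimately show ?thesis using l_neg[OF WJ_W[OF J u]] by simp
qed

text \<open>The conjugate of \<open>c s\<close> is the complement of \<open>c s + wJ J\<close> in
  \<open>wJ J\<close>, so its length is \<open>l (wJ J) - l (c s + wJ J) = 1\<close>.\<close>

lemma wJ_conj:
  assumes J: "J \<subseteq> S" and s: "s \<in> J"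
  shows "\<exists>s'\<in>J. - wJ J + c s + wJ J = c s'"
proof -
  have sS: "s \<in> S" using J s by blast
  define r where "r = - wJ J + c s + wJ J"
  have yJ: "c s + wJ J \<in> WJ J" using WJ_add[OF WJ_c[OF s] wJ(1)[OF J]] .
  have "l (wJ J) = l (c s + wJ J) + l (- (c s + wJ J) + wJ J)" using wJ(2)[OF J yJ] unfolding wle_def by blast
  moreover have "- (c s + wJ J) + wJ J = r"
    unfolding r_def minus_add c_neg[OF sS] by (simp add: add.assoc)
  moreover have "l (wJ J) = 1 + l (c s + wJ J)"
    using wJ(2)[OF J WJ_c[OF s]] l_c[OF sS] unfolding wle_def c_neg[OF sS] by simp
  ultimately have lr: "l r = 1" by simp
  have "r \<in> WJ J" unfolding r_def using WJ_add[OF WJ_neg[OF J wJ(1)[OF J]] yJ] by (simp add: add.assoc)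
  then obtain p where p: "p \<in> lists J" "reduced p" "ev p = r" using WJ_reduced[OF J] by blast
  then have "length p = 1" using lr unfolding reduced_def by simp
  then obtain s' where "p = [s']" by (cases p) auto
  then have "s' \<in> J" "r = c s'" using p by auto
  then show ?thesis unfolding r_def by blast
qed

abbreviation w0 :: 'w where "w0 \<equiv> wJ S"

lemma wle_w0: "x \<in> W \<Longrightarrow> wle x w0"
  using wJ(2)[of S x] W_eq_WJ by simp

lemma ex_wmeet:
  assumes "x \<in> W" "y \<in> W"
  shows "\<exists>z. wle z x \<and> wle z y \<and> (\<forall>u. wle u x \<longrightarrow> wle u y \<longrightarrow> wle u z)"
proof -
  have bd: "\<forall>z. wle z x \<and> wle z y \<longrightarrow> l z < Suc (l x)" unfolding wle_def by auto
  obtain z where z: "wle z x" "wle z y" "\<And>u. wle u x \<Longrightarrow> wle u y \<Longrightarrow> l u \<le> l z"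
    using ex_has_greatest_nat[of "\<lambda>z. wle z x \<and> wle z y" 0 l, OF _ bd] wle_zero assms by blast
  have "wle u z" if u: "wle u x" "wle u y" for u
  proof -
    obtain j where j: "wle u j" "wle z j" "\<And>v. wle u v \<Longrightarrow> wle z v \<Longrightarrow> wle v w0 \<Longrightarrow> wle j v"
      using bounded_wjoin[of u w0 z] wle_w0 wle_W(1)[OF u(1)] wle_W(1)[OF z(1)] by blast
    have "wle j x" "wle j y" using j(3) u z wle_w0 assms by blast+
    then have "z = j" using wle_antisym[OF j(2)] z(3) by blast
    then show ?thesis using j(1) by simp
  qed
  then show ?thesis using z by blast
qed

subsection \<open>Matsumoto's theorem\<close>

text \<open>Reduced words with different first letters \<open>s\<close> and \<open>t\<close> are
  compared through \<open>alt n s t @ q\<close> and \<open>alt n t s @ q\<close>, supplied by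
  \<open>rank_two\<close>: each shares its first letter with one of the given words, and the two
  differ by one braid relation.\<close>

lemma matsumoto:
  assumes "reduced u" "reduced v" "ev u = ev v"
  shows "wcong (braid_rel S m) u v"
  using assms
proof (induction "length u" arbitrary: u v rule: less_induct)
  case less
  have len: "length u = length v" using less.prems unfolding reduced_def by simp
  show ?case
  proof (cases u)
    case Nil
    then show ?thesis using len wcong_refl by simp
  next
    case (Cons s u')
    then obtain t v' where v: "v = t # v'" using len by (cases v) auto
    have uS: "u \<in> lists S" "v \<in> lists S" using less.prems unfolding reduced_def by auto
    have st: "s \<in> S" "t \<in> S" using uS Cons v by auto
    have ru: "reduced ([s] @ u')" "reduced ([t] @ v')" using less.prems Cons v by simp_all
    have ru': "reduced u'" "reduced v'" using reduced_append(2)[OF ru(1)] reduced_append(2)[OF ru(2)] .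
    have e: "c s + ev u' = c t + ev v'" using less.prems Cons v by simp
    show ?thesis
    proof (cases "s = t")
      case True
      then have "ev u' = ev v'" using e by simp
      then show ?thesis using less.hyps[of u' v'] ru' Cons v True wcong_Cons by simp
    next
      case False
      define w where "w = ev u"
      have w: "w \<in> W" "w = ev v" unfolding w_def using less.prems ev_W[OF uS(1)] by auto
      have "wle (c s) w" "wle (c t) w"
        using reduced_wle[OF ru(1)] reduced_wle[OF ru(2)] Cons v w(2) unfolding w_def by simp_all
      then have d: "c s \<in> N w" "c t \<in> N w" using wle_c[OF st(1) w(1)] wle_c[OF st(2) w(1)] by auto
      obtain n where n: "m s t = enat n" "2 \<le> n" using m_finite[OF st False] by blast
      have mts: "m t s = enat n" using datum st n False unfolding artin_datum_def by metis
      note r = rank_two[OF st False n(1) w(1) d]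
      have r': "reduced (alt n t s)" using rank_two(2)[OF st(2,1) _ mts w(1) d(2,1)] False by blast
      have b: "(alt n s t, alt n t s) \<in> braid_rel S m" using st n(1) False unfolding braid_rel_def by blast
      have eb: "ev (alt n s t) = ev (alt n t s)" by (rule ev_braid[OF b])
      define z where "z = - ev (alt n s t) + w"
      have zW: "z \<in> W" unfolding z_def using W_add[OF W_neg[OF ev_W[OF alt_lists[OF st]]] w(1)] .
      have wz: "w = ev (alt n s t) + z" "w = ev (alt n t s) + z" by (simp_all add: z_def eb)
      obtain k where k: "n = Suc k" using n(2) by (cases n) auto
      define q where "q = red z"
      have q: "reduced q" "ev q = z" using red[OF zW] by (simp_all add: q_def)
      have lz: "l w = n + l z" using r(1) unfolding z_def .
      have ln: "l (ev (alt n s t)) = n" "l (ev (alt n t s)) = n" using r(2) r' unfolding reduced_def by simp_all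
      have "l (ev (alt n s t) + ev q) = l (ev (alt n s t)) + l (ev q)"
        "l (ev (alt n t s) + ev q) = l (ev (alt n t s)) + l (ev q)"
        using lz ln wz q(2) by simp_all
      then have R: "reduced (alt n s t @ q)" "reduced (alt n t s @ q)"
        using reduced_appendI[OF r(2) q(1)] reduced_appendI[OF r' q(1)] by blast+
      have R': "reduced (alt k t s @ q)" "reduced (alt k s t @ q)"
        using reduced_append(2)[of "[s]" "alt k t s @ q"] reduced_append(2)[of "[t]" "alt k s t @ q"] R
        unfolding k by simp_all
      have "c s + ev (alt k t s @ q) = c s + ev u'" "c t + ev (alt k s t @ q) = c t + ev v'"
        using wz q(2) w(2) Cons v unfolding k w_def by (simp_all add: add.assoc)
      then have E: "ev u' = ev (alt k t s @ q)" "ev v' = ev (alt k s t @ q)" by simp_all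
      have "wcong (braid_rel S m) u' (alt k t s @ q)" "wcong (braid_rel S m) v' (alt k s t @ q)"
        using less.hyps[of u' "alt k t s @ q"] less.hyps[of v' "alt k s t @ q"] ru' R' E Cons v len by simp_all
      then have "wcong (braid_rel S m) u (alt n s t @ q)" "wcong (braid_rel S m) v (alt n t s @ q)"
        using wcong_Cons[of _ u' "alt k t s @ q" s] wcong_Cons[of _ v' "alt k s t @ q" t]
        unfolding k Cons v by simp_all
      moreover have "wcong (braid_rel S m) (alt n s t @ q) (alt n t s @ q)"
        using wcong_postpend[OF wcong_base[OF b]] .
      ultimately show ?thesis using wcong_trans wcong_sym by blast
    qed
  qed
qed

subsection \<open>The positive monoid\<close>

abbreviation peq :: "'a list \<Rightarrow> 'a list \<Rightarrow> bool" (infix \<open>\<approx>\<close> 50) where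
  "u \<approx> v \<equiv> wcong (braid_rel S m) u v"

lemma braid_relE:
  assumes "(u, v) \<in> braid_rel S m"
  obtains n s t where "u = alt n s t" "v = alt n t s" "s \<in> S" "t \<in> S" "s \<noteq> t" "m s t = enat n" "2 \<le> n"
proof -
  obtain n s t where st: "u = alt n s t" "v = alt n t s" "s \<in> S" "t \<in> S" "s \<noteq> t" "m s t = enat n"
    using assms unfolding braid_rel_def by blast
  moreover obtain n' where "m s t = enat n'" "2 \<le> n'" using m_finite[OF st(3-5)] by blast
  ultimately show ?thesis using that by simp
qed

lemma peq_ev: "u \<approx> v \<Longrightarrow> ev u = ev v"
  by (induction rule: wcong.induct) (auto simp: ev_braid)

lemma peq_length: "u \<approx> v \<Longrightarrow> length u = length v"
  by (induction rule: wcong.induct) (auto simp: braid_rel_def)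

lemma peq_set: "u \<approx> v \<Longrightarrow> set u = set v"
proof (induction rule: wcong.induct)
  case (wcong_base u v)
  then obtain n s t where "u = alt n s t" "v = alt n t s" "2 \<le> n" by (rule braid_relE)
  then show ?case by (simp add: set_alt insert_commute)
qed auto

lemma peq_lists: "u \<approx> v \<Longrightarrow> u \<in> lists J \<longleftrightarrow> v \<in> lists J"
  using peq_set[of u v] by (simp add: in_lists_conv_set)

lemma peq_reduced: "u \<approx> v \<Longrightarrow> reduced u \<longleftrightarrow> reduced v"
  using peq_ev[of u v] peq_length[of u v] peq_lists[of u v S] by (simp add: reduced_def)

lemma peq_Cons: "u \<approx> v \<Longrightarrow> s # u \<approx> s # v"
  by (rule wcong_Cons)

lemmas peq_append = wcong_append[of "braid_rel S m"]
lemmas peq_trans [trans] = wcong_trans[of "braid_rel S m"]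
lemmas peq_sym = wcong_sym[of "braid_rel S m"]
lemmas peq_refl [simp] = wcong_refl[of "braid_rel S m"]

lemma red_append:
  assumes "x \<in> W" "y \<in> W" "l (x + y) = l x + l y"
  shows "red x @ red y \<approx> red (x + y)"
proof (rule matsumoto)
  show "reduced (red x @ red y)"
    using reduced_appendI[OF red(4)[OF assms(1)] red(4)[OF assms(2)]] red(2) assms by simp
  show "reduced (red (x + y))" using red(4)[OF W_add[OF assms(1,2)]] .
  show "ev (red x @ red y) = ev (red (x + y))" using red(2) assms W_add by simp
qed

lemma red_zero [simp]: "red 0 = []"
  using red(3)[OF W_zero] l_zero by simp

lemma red_c: "s \<in> S \<Longrightarrow> red (c s) = [s]"
proof -
  assume s: "s \<in> S"
  have "length (red (c s)) = 1" using red(3)[OF W_c[OF s]] l_c[OF s] by simp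
  then obtain t where t: "red (c s) = [t]" by (cases "red (c s)") auto
  then have "c t = c s" "t \<in> S" using red(1,2)[OF W_c[OF s]] by simp_all
  then show ?thesis using c_inj[OF _ s] t by blast
qed

subsection \<open>The greatest simple prefix\<close>

definition wmeet :: "'w \<Rightarrow> 'w \<Rightarrow> 'w" where
  "wmeet x y = (SOME z. wle z x \<and> wle z y \<and> (\<forall>u. wle u x \<longrightarrow> wle u y \<longrightarrow> wle u z))"

lemma wmeet:
  assumes "x \<in> W" "y \<in> W"
  shows "wle (wmeet x y) x" "wle (wmeet x y) y" "\<And>u. wle u x \<Longrightarrow> wle u y \<Longrightarrow> wle u (wmeet x y)"
proof -
  have "wle (wmeet x y) x \<and> wle (wmeet x y) y \<and> (\<forall>u. wle u x \<longrightarrow> wle u y \<longrightarrow> wle u (wmeet x y))"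
    unfolding wmeet_def by (rule someI_ex[OF ex_wmeet[OF assms]])
  then show "wle (wmeet x y) x" "wle (wmeet x y) y" "\<And>u. wle u x \<Longrightarrow> wle u y \<Longrightarrow> wle u (wmeet x y)"
    by blast+
qed

text \<open>The set of simple elements that can be appended to \<open>x\<close> without losing length is the interval
  below \<open>- x + w0\<close>, so \<open>act x w\<close> is the greatest simple prefix of \<open>x w\<close> and \<open>rem x w\<close> the remainder.\<close>

definition act :: "'w \<Rightarrow> 'w \<Rightarrow> 'w" where "act x w = x + wmeet w (- x + w0)"

definition rem :: "'w \<Rightarrow> 'w \<Rightarrow> 'w" where "rem x w = - wmeet w (- x + w0) + w"

lemma w0_W: "w0 \<in> W"
  by (rule wJ_W) simp

lemma wle_compl: "x \<in> W \<Longrightarrow> z \<in> W \<Longrightarrow> wle z (- x + w0) \<longleftrightarrow> l (x + z) = l x + l z"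
proof
  assume W: "x \<in> W" "z \<in> W" and "wle z (- x + w0)"
  then have "wle x (x + z)" using wle_shift(2)[OF wle_w0[OF W(1)]] by blast
  then show "l (x + z) = l x + l z" unfolding wle_def by simp
next
  assume W: "x \<in> W" "z \<in> W" and "l (x + z) = l x + l z"
  then show "wle z (- x + w0)" using wle_cancel[OF wle_w0[OF W_add[OF W]] wle_add[OF W]] by blast
qed

lemma compl_W: "x \<in> W \<Longrightarrow> - x + w0 \<in> W"
  using W_add[OF W_neg w0_W] .

lemma act_rem:
  assumes "x \<in> W" "w \<in> W"
  shows "act x w \<in> W" "rem x w \<in> W" "wmeet w (- x + w0) \<in> W"
    "l (act x w) = l x + l (wmeet w (- x + w0))" "l w = l (wmeet w (- x + w0)) + l (rem x w)"
proof -
  let ?b = "wmeet w (- x + w0)"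
  note b = wmeet[OF assms(2) compl_W[OF assms(1)]]
  show bW: "?b \<in> W" using wle_W(1)[OF b(1)] .
  show "act x w \<in> W" "rem x w \<in> W" unfolding act_def rem_def
    using W_add[OF assms(1) bW] W_add[OF W_neg[OF bW] assms(2)] .
  show "l (act x w) = l x + l ?b" unfolding act_def using wle_compl[OF assms(1) bW] b(2) by blast
  show "l w = l ?b + l (rem x w)" using b(1) unfolding wle_def rem_def by blast
qed

text \<open>Simple prefixes are found one factor at a time. If \<open>u\<close> is the greatest
  simple prefix of \<open>y w\<close>, the part \<open>d\<close> of \<open>u\<close> that
  \<open>x\<close> absorbs contains \<open>y\<close>, because lengths add in \<open>x + y\<close>;
  what follows \<open>y\<close> in \<open>d\<close> is the part \<open>a\<close> of \<open>w\<close>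
  that \<open>x + y\<close> absorbs.\<close>

lemma act_cocycle:
  assumes W: "x \<in> W" "y \<in> W" "w \<in> W" and len: "l (x + y) = l x + l y"
  shows "act (x + y) w = act x (act y w)" "rem (x + y) w = rem x (act y w) + rem y w"
    "l (rem (x + y) w) = l (rem x (act y w)) + l (rem y w)"
proof -
  have xy: "x + y \<in> W" using W_add W by blast
  define b where "b = wmeet w (- y + w0)"
  define a where "a = wmeet w (- (x + y) + w0)"
  define u where "u = y + b"
  define d where "d = wmeet u (- x + w0)"
  note bm = wmeet[OF W(3) compl_W[OF W(2)], folded b_def]
  note am = wmeet[OF W(3) compl_W[OF xy], folded a_def]
  have aW: "a \<in> W" and bW: "b \<in> W" using wle_W(1) am(1) bm(1) by blast+
  have uW: "u \<in> W" unfolding u_def using W_add[OF W(2) bW] .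
  note dm = wmeet[OF uW compl_W[OF W(1)], folded d_def]
  have dW: "d \<in> W" using wle_W(1)[OF dm(1)] .
  have yu: "wle y u" unfolding u_def using wle_compl[OF W(2) bW] bm(2) wle_add[OF W(2) bW] by blast
  have "wle y (- x + w0)" using wle_compl[OF W(1,2)] len by blast
  then have yd: "wle y d" using dm(3) yu by blast
  define d' where "d' = - y + d"
  have d'W: "d' \<in> W" unfolding d'_def using wle_W(3)[OF yd] .
  have dd: "d = y + d'" by (simp add: d'_def)
  have ld: "l d = l y + l d'" using yd unfolding wle_def d'_def by blast
  have "wle d' (- y + u)" using wle_cancel[of y d' u] dm(1) yd unfolding dd by blast
  then have d'b: "wle d' b" unfolding u_def by simp
  have "l (x + d) = l x + l d" using wle_compl[OF W(1) dW] dm(2) by blast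
  then have "l (x + y + d') = l (x + y) + l d'" unfolding ld using len unfolding dd by (simp add: add.assoc)
  then have "wle d' (- (x + y) + w0)" using wle_compl[OF xy d'W] by blast
  then have d'a: "wle d' a" using am(3) wle_trans[OF d'b bm(1)] by blast
  have la: "l (x + y + a) = l x + l y + l a" using wle_compl[OF xy aW] am(2) len by simp
  have yaW: "y + a \<in> W" using W_add[OF W(2) aW] .
  have "l (x + (y + a)) \<le> l x + l (y + a)" "l (y + a) \<le> l y + l a"
    using l_add_le[OF W(1) yaW] l_add_le[OF W(2) aW] .
  then have lya: "l (y + a) = l y + l a" "l (x + (y + a)) = l x + l (y + a)"
    using la by (simp_all add: add.assoc)
  have "wle a (- y + w0)" using wle_compl[OF W(2) aW] lya by blast
  then have ab: "wle a b" using bm(3) am(1) by blast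
  have "wle (y + a) u" using wle_shift(1)[OF yu, of a] ab unfolding u_def by simp
  moreover have "wle (y + a) (- x + w0)" using wle_compl[OF W(1) yaW] lya(2) by blast
  ultimately have "wle (y + a) d" using dm(3) by blast
  then have "wle a d'" unfolding d'_def using wle_cancel[of y a d] wle_add[OF W(2) aW lya(1)] by blast
  then have "d' = a" using wle_antisym[OF d'a] unfolding wle_def by linarith
  then have d: "d = y + a" using dd by simp
  have actu: "act y w = u" unfolding act_def u_def b_def ..
  show "act (x + y) w = act x (act y w)"
    unfolding actu unfolding act_def a_def[symmetric] d_def[symmetric] d by (simp only: add.assoc)
  have r1: "rem x u = - a + b"
    unfolding rem_def d_def[symmetric] d unfolding u_def by (simp add: group_simps del: add_uminus_conv_diff)
  have r2: "rem y w = - b + w" "rem (x + y) w = - a + w" unfolding rem_def a_def b_def by blast+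
  show "rem (x + y) w = rem x (act y w) + rem y w"
    unfolding actu r1 r2 by (simp add: add.assoc)
  show "l (rem (x + y) w) = l (rem x (act y w)) + l (rem y w)"
    unfolding actu r1 r2 using ab am(1) bm(1) unfolding wle_def by linarith
qed

text \<open>A state is a simple prefix together with a word for the rest; a step puts one letter in
  front. Under \<open>foldr\<close> the last letter of a word acts first.\<close>

definition step :: "'a \<Rightarrow> 'w \<times> 'a list \<Rightarrow> 'w \<times> 'a list" where
  "step s p = (act (c s) (fst p), red (rem (c s) (fst p)) @ snd p)"

lemma step_Cons:
  "fst (foldr step (s # u) p) = act (c s) (fst (foldr step u p))"
  "snd (foldr step (s # u) p) = red (rem (c s) (fst (foldr step u p))) @ snd (foldr step u p)"
  by (simp_all only: foldr.simps o_apply step_def fst_conv snd_conv)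

lemma run_W: "u \<in> lists S \<Longrightarrow> fst p \<in> W \<Longrightarrow> fst (foldr step u p) \<in> W"
  by (induction u rule: list.induct) (auto simp: step_Cons act_rem W_c simp del: foldr.simps(2))

text \<open>By the cocycle rule a reduced word acts like its value. Both sides of a braid relation
  are reduced, so runs respect \<open>\<approx>\<close>.\<close>

lemma run_reduced:
  assumes "reduced u" "fst p \<in> W"
  shows "fst (foldr step u p) = act (ev u) (fst p)
    \<and> snd (foldr step u p) \<approx> red (rem (ev u) (fst p)) @ snd p"
  using assms(1)
proof (induction u)
  case Nil
  let ?w = "fst p"
  have "wle ?w (- 0 + w0)" using wle_w0[OF assms(2)] by simp
  moreover have "- 0 + w0 \<in> W" using w0_W by simp
  ultimately have "wle ?w (wmeet ?w (- 0 + w0))" "wle (wmeet ?w (- 0 + w0)) ?w"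
    using wmeet[OF assms(2), of "- 0 + w0"] wle_refl[OF assms(2)] by blast+
  then have "wmeet ?w (- 0 + w0) = ?w" using wle_antisym unfolding wle_def by fastforce
  then show ?case unfolding act_def rem_def by simp
next
  case (Cons s u)
  let ?w = "fst p"
  have r: "reduced ([s] @ u)" using Cons.prems by simp
  note ra = reduced_append[OF r]
  have uS: "u \<in> lists S" "s \<in> S" using Cons.prems unfolding reduced_def by auto
  have W: "c s \<in> W" "ev u \<in> W" using W_c[OF uS(2)] ev_W[OF uS(1)] .
  define w1 where "w1 = act (ev u) ?w"
  have IH: "fst (foldr step u p) = w1" "snd (foldr step u p) \<approx> red (rem (ev u) ?w) @ snd p"
    using Cons.IH[OF ra(2)] unfolding w1_def by blast+
  have "l (c s + ev u) = l (c s) + l (ev u)" using ra(3) by simp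
  note co = act_cocycle[OF W assms(2) this, folded w1_def]
  have w1: "w1 \<in> W" unfolding w1_def using act_rem(1)[OF W(2) assms(2)] .
  have "red (rem (c s) w1) @ red (rem (ev u) ?w) \<approx> red (rem (c s + ev u) ?w)"
    unfolding co(2) using red_append[OF act_rem(2)[OF W(1) w1] act_rem(2)[OF W(2) assms(2)]] co(2,3) by simp
  then have "red (rem (c s) w1) @ red (rem (ev u) ?w) @ snd p \<approx> red (rem (c s + ev u) ?w) @ snd p"
    using peq_append[OF _ peq_refl, of _ _ "snd p"] by fastforce
  moreover have "red (rem (c s) w1) @ snd (foldr step u p) \<approx> red (rem (c s) w1) @ red (rem (ev u) ?w) @ snd p"
    using peq_append[OF peq_refl IH(2)] .
  ultimately have "red (rem (c s) w1) @ snd (foldr step u p) \<approx> red (rem (c s + ev u) ?w) @ snd p"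
    using peq_trans by blast
  then show ?case unfolding step_Cons using IH(1) co(1) by simp
qed

lemma alt_reduced:
  assumes st: "s \<in> S" "t \<in> S" "s \<noteq> t" "m s t = enat n" shows "reduced (alt n s t)"
  using rank_two(2)[OF st w0_W] wle_c[OF st(1) w0_W] wle_c[OF st(2) w0_W] wle_w0 W_c st by blast

lemma run_snd_cong:
  "fst p = fst p' \<Longrightarrow> snd p \<approx> snd p' \<Longrightarrow>
    fst (foldr step u p) = fst (foldr step u p') \<and> snd (foldr step u p) \<approx> snd (foldr step u p')"
proof (induction u)
  case (Cons s u)
  then show ?case unfolding step_Cons using peq_append[OF peq_refl, of "snd (foldr step u p)"] by simp
qed simp

lemma run_cong:
  assumes "u \<approx> v" "u \<in> lists S" "fst p \<in> W" "fst p = fst p'" "snd p \<approx> snd p'"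
  shows "fst (foldr step u p) = fst (foldr step v p') \<and> snd (foldr step u p) \<approx> snd (foldr step v p')"
  using assms
proof (induction arbitrary: p p' rule: wcong.induct)
  case (wcong_base u v)
  obtain n s t where st: "u = alt n s t" "v = alt n t s" "s \<in> S" "t \<in> S" "s \<noteq> t" "m s t = enat n"
    using wcong_base(1) by (rule braid_relE)
  have r: "reduced u" unfolding st(1) using alt_reduced[OF st(3-6)] .
  have v: "reduced v" using r peq_reduced[OF wcong.wcong_base[OF wcong_base(1)]] by blast
  have e: "ev u = ev v" using ev_braid[OF wcong_base(1)] .
  note ru = run_reduced[OF r wcong_base(3), unfolded e] and rv = run_reduced[OF v wcong_base(3)]
  have "fst (foldr step u p) = fst (foldr step v p) \<and> snd (foldr step u p) \<approx> snd (foldr step v p)"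
    using ru rv peq_trans[OF conjunct2[OF ru] peq_sym[OF conjunct2[OF rv]]] by simp
  then have 1: "fst (foldr step u p) = fst (foldr step v p)" "snd (foldr step u p) \<approx> snd (foldr step v p)"
    by blast+
  have 2: "fst (foldr step v p) = fst (foldr step v p')" "snd (foldr step v p) \<approx> snd (foldr step v p')"
    using run_snd_cong[OF wcong_base(4,5), of v] by blast+
  show ?case using 1(1) 2(1) peq_trans[OF 1(2) 2(2)] by simp
next
  case (wcong_refl u)
  then show ?case using run_snd_cong by blast
next
  case (wcong_sym u v)
  have "u \<in> lists S" using wcong_sym.prems(1) peq_lists[OF wcong_sym.hyps] by blast
  moreover have "fst p' \<in> W" "snd p' \<approx> snd p" using wcong_sym.prems(2,3) peq_sym[OF wcong_sym.prems(4)] by simp_all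
  ultimately have *: "fst (foldr step u p') = fst (foldr step v p)" "snd (foldr step u p') \<approx> snd (foldr step v p)"
    using wcong_sym.IH[of p' p, OF _ _ wcong_sym.prems(3)[symmetric]] by blast+
  show ?case using *(1) peq_sym[OF *(2)] by simp
next
  case (wcong_trans u v w)
  have v: "v \<in> lists S" using wcong_trans.prems(1) peq_lists[OF wcong_trans.hyps(1)] by blast
  have 1: "fst (foldr step u p) = fst (foldr step v p)" "snd (foldr step u p) \<approx> snd (foldr step v p)"
    using wcong_trans.IH(1)[OF wcong_trans.prems(1,2) HOL.refl peq_refl] by blast+
  have 2: "fst (foldr step v p) = fst (foldr step w p')" "snd (foldr step v p) \<approx> snd (foldr step w p')"
    using wcong_trans.IH(2)[OF v wcong_trans.prems(2-4)] by blast+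
  show ?case using 1(1) 2(1) peq_trans[OF 1(2) 2(2)] by simp
next
  case (wcong_append u u' v v')
  have uv: "u \<in> lists S" "v \<in> lists S" using wcong_append.prems(1) by auto
  have v: "fst (foldr step v p) = fst (foldr step v' p')" "snd (foldr step v p) \<approx> snd (foldr step v' p')"
    using wcong_append.IH(2)[OF uv(2) wcong_append.prems(2-4)] by auto
  show ?case using wcong_append.IH(1)[OF uv(1) run_W[OF uv(2) wcong_append.prems(2)] v] by simp
qed

lemma run_value:
  assumes "u \<in> lists S" "fst p \<in> W"
  shows "u @ red (fst p) @ snd p \<approx> red (fst (foldr step u p)) @ snd (foldr step u p)"
  using assms(1)
proof (induction u rule: list.induct)
  case Nil
  then show ?case by simp
next
  case (Cons s u)
  define w1 q1 where "w1 = fst (foldr step u p)" and "q1 = snd (foldr step u p)"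
  have s: "s \<in> S" and u: "u \<in> lists S" using Cons.prems by auto
  have IH: "u @ red (fst p) @ snd p \<approx> red w1 @ q1" using Cons.IH[OF u] unfolding w1_def q1_def .
  have w1: "w1 \<in> W" unfolding w1_def using run_W[OF u assms(2)] .
  define b where "b = wmeet w1 (- c s + w0)"
  note ar = act_rem[OF W_c[OF s] w1, folded b_def]
  have w1b: "w1 = b + rem (c s) w1" unfolding rem_def b_def by simp
  have ab: "act (c s) w1 = c s + b" unfolding act_def b_def ..
  have "red b @ red (rem (c s) w1) \<approx> red w1"
    using red_append[OF ar(3) ar(2)] ar(5) w1b by simp
  then have 1: "s # red w1 @ q1 \<approx> [s] @ (red b @ red (rem (c s) w1)) @ q1"
    using peq_append[OF peq_refl peq_append[OF _ peq_refl], of _ _ "[s]"] peq_sym by fastforce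
  have "[s] @ red b \<approx> red (act (c s) w1)"
    using red_append[OF W_c[OF s] ar(3)] ar(4) unfolding ab red_c[OF s] by simp
  then have 2: "([s] @ red b) @ red (rem (c s) w1) @ q1 \<approx> red (act (c s) w1) @ red (rem (c s) w1) @ q1"
    by (rule peq_append[OF _ peq_refl])
  have "s # u @ red (fst p) @ snd p \<approx> s # red w1 @ q1" using peq_Cons[OF IH] .
  also have "s # red w1 @ q1 \<approx> red (act (c s) w1) @ red (rem (c s) w1) @ q1" using peq_trans[OF 1] 2 by simp
  finally show ?case unfolding step_Cons w1_def q1_def by simp
qed

definition dw :: "'a list" where "dw = red w0"

lemma dw: "dw \<in> lists S" "reduced dw" "ev dw = w0"
  unfolding dw_def using red[OF w0_W] by blast+

text \<open>Nothing can be appended to \<open>w0\<close>, so the whole old prefix passes to the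
  remainder.\<close>

lemma run_dw:
  assumes "fst p \<in> W"
  shows "fst (foldr step dw p) = w0" "snd (foldr step dw p) \<approx> red (fst p) @ snd p"
proof -
  have "wle (wmeet (fst p) 0) 0" using wmeet(2)[OF assms W_zero] .
  then have "wmeet (fst p) 0 = 0" using wle_antisym l_zero by fastforce
  then have "act w0 (fst p) = w0" "rem w0 (fst p) = fst p" unfolding act_def rem_def by simp_all
  then show "fst (foldr step dw p) = w0" "snd (foldr step dw p) \<approx> red (fst p) @ snd p"
    using run_reduced[OF dw(2) assms] dw(3) by simp_all
qed

text \<open>The remainder after running \<open>dw @ u\<close> is a word for \<open>u\<close>, and by
  \<open>run_cong\<close> it depends only on the class of \<open>dw @ u\<close>.\<close>

lemma cancel_dw:
  assumes "u \<in> lists S" "v \<in> lists S" "dw @ u \<approx> dw @ v"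
  shows "u \<approx> v"
proof -
  have *: "snd (foldr step (dw @ u) (0, [])) \<approx> u" if u: "u \<in> lists S" for u
  proof -
    define p where "p = foldr step u (0, [])"
    have "fst p \<in> W" unfolding p_def using run_W[OF u] W_zero by simp
    then have "snd (foldr step dw p) \<approx> red (fst p) @ snd p" using run_dw(2) by blast
    moreover have "u \<approx> red (fst p) @ snd p" using run_value[OF u, of "(0, [])"] W_zero unfolding p_def by simp
    ultimately have "snd (foldr step dw p) \<approx> u" using peq_trans peq_sym by blast
    then show ?thesis unfolding p_def by simp
  qed
  have "dw @ u \<in> lists S" using dw(1) assms by simp
  then have "snd (foldr step (dw @ u) (0, [])) \<approx> snd (foldr step (dw @ v) (0, []))"
    using run_cong[OF assms(3), of "(0, [])" "(0, [])"] W_zero by simp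
  then show ?thesis using *[OF assms(1)] *[OF assms(2)] peq_trans peq_sym by blast
qed

text \<open>The greatest simple prefix \<open>x\<close> of the common multiple has \<open>s\<close>
  and \<open>t\<close> as descents, so \<open>rank_two\<close> makes it begin with
  \<open>alt n s t\<close>.\<close>

lemma garside_lemma:
  assumes st: "s \<in> S" "t \<in> S" "s \<noteq> t" "m s t = enat n"
    and ab: "a \<in> lists S" "b \<in> lists S" "s # a \<approx> t # b"
  shows "\<exists>q\<in>lists S. s # a \<approx> alt n s t @ q"
proof -
  define x where "x = fst (foldr step (s # a) (0, []))"
  define q where "q = snd (foldr step (s # a) (0, []))"
  have saS: "s # a \<in> lists S" using st ab by simp
  have x: "x = fst (foldr step (t # b) (0, []))"
    unfolding x_def using run_cong[OF ab(3) saS, of "(0, [])" "(0, [])"] W_zero by simp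
  have xW: "x \<in> W" unfolding x_def using run_W[OF saS] W_zero by simp
  have D: "c y \<in> N (fst (foldr step (y # e) (0, [])))" if y: "y \<in> S" and e: "e \<in> lists S" for y e
  proof -
    define w1 where "w1 = fst (foldr step e (0, []))"
    have w1: "w1 \<in> W" unfolding w1_def using run_W[OF e] W_zero by simp
    note ar = act_rem[OF W_c[OF y] w1]
    have "wle (c y) (act (c y) w1)" unfolding act_def
      using wle_add[OF W_c[OF y] ar(3)] ar(4) unfolding act_def by blast
    then show ?thesis unfolding step_Cons using wle_c[OF y ar(1)] unfolding w1_def by blast
  qed
  have d: "c s \<in> N x" "c t \<in> N x" using D[OF st(1) ab(1)] D[OF st(2) ab(2)] unfolding x[symmetric] x_def[symmetric] .
  note r = rank_two[OF st xW d]
  define z where "z = - ev (alt n s t) + x"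
  have zW: "z \<in> W" unfolding z_def using W_add[OF W_neg[OF ev_W[OF alt_lists[OF st(1,2)]]] xW] .
  have xz: "x = ev (alt n s t) + z" unfolding z_def by simp
  have "l (ev (alt n s t) + z) = l (ev (alt n s t)) + l z"
    using r unfolding reduced_def z_def[symmetric] xz[symmetric] by simp
  then have "reduced (alt n s t @ red z)" using reduced_appendI[OF r(2) red(4)[OF zW]] red(2)[OF zW] by simp
  moreover have "ev (red x) = ev (alt n s t @ red z)" using red(2)[OF xW] red(2)[OF zW] xz by simp
  ultimately have "red x \<approx> alt n s t @ red z" using matsumoto[OF red(4)[OF xW]] by blast
  then have "red x @ q \<approx> alt n s t @ (red z @ q)" using peq_append[OF _ peq_refl, of _ _ q] by fastforce
  moreover have sx: "s # a \<approx> red x @ q"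
    using run_value[OF saS, of "(0, [])"] W_zero unfolding x_def q_def by simp
  ultimately have fin: "s # a \<approx> alt n s t @ (red z @ q)" using peq_trans by blast
  then have "red z @ q \<in> lists S" using peq_lists[OF fin] saS by simp
  then show ?thesis using fin by blast
qed

subsection \<open>Longest elements in the positive monoid\<close>

definition dJ :: "'a set \<Rightarrow> 'a list" where "dJ J = red (wJ J)"

lemma dJ: assumes "J \<subseteq> S" shows "reduced (dJ J)" "ev (dJ J) = wJ J" "dJ J \<in> lists J"
proof -
  show r: "reduced (dJ J)" "ev (dJ J) = wJ J" unfolding dJ_def using red[OF wJ_W[OF assms]] by blast+
  obtain p where p: "p \<in> lists J" "reduced p" "ev p = wJ J" using WJ_reduced[OF assms wJ(1)[OF assms]] by blast
  have "p \<approx> dJ J" using matsumoto[OF p(2) r(1)] p(3) r(2) by simp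
  then show "dJ J \<in> lists J" using peq_lists p(1) by blast
qed

lemma dJ_peqI:
  assumes "J \<subseteq> S" "u \<in> lists S" "ev u = wJ J" "length u = l (wJ J)"
  shows "u \<approx> dJ J"
proof (rule matsumoto)
  show "reduced u" using assms(2-4) by (simp add: reduced_def)
qed (use dJ[OF assms(1)] assms(3) in simp_all)

lemma dJ_conj:
  assumes J: "J \<subseteq> S" and s: "s \<in> J"
  obtains s' p where "s' \<in> J" "p \<in> lists S" "s # dJ J \<approx> dJ J @ [s']" "s # p \<approx> dJ J" "p @ [s'] \<approx> dJ J"
    "- wJ J + c s + wJ J = c s'"
proof -
  obtain s' where s': "s' \<in> J" "- wJ J + c s + wJ J = c s'" using wJ_conj[OF J s] by blast
  have sS: "s \<in> S" "s' \<in> S" using J s s'(1) by auto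
  have e: "c s + wJ J = wJ J + c s'" unfolding s'(2)[symmetric] by (simp add: add.assoc)
  define p where "p = red (c s + wJ J)"
  have cw: "c s + wJ J \<in> W" using W_add[OF W_c[OF sS(1)] wJ_W[OF J]] .
  note p = red[OF cw, folded p_def]
  have "l (wJ J) = 1 + l (c s + wJ J)"
    using wJ(2)[OF J WJ_c[OF s]] l_c[OF sS(1)] unfolding wle_def c_neg[OF sS(1)] by simp
  then have len: "length p + 1 = l (wJ J)" using p(3) by simp
  have 1: "s # p \<approx> dJ J"
    using dJ_peqI[OF J, of "s # p"] p sS len c_cancel[OF sS(1)] by simp
  have 2: "p @ [s'] \<approx> dJ J"
    using dJ_peqI[OF J, of "p @ [s']"] p sS len unfolding e by (simp add: add.assoc c_double)
  have "s # dJ J \<approx> s # p @ [s']" using peq_Cons[OF peq_sym[OF 2]] .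
  also have "s # p @ [s'] \<approx> dJ J @ [s']" using peq_append[OF 1 peq_refl, of "[s']"] by simp
  finally have "s # dJ J \<approx> dJ J @ [s']" .
  then show ?thesis using that[OF s'(1) p(1) _ 1 2 s'(2)] by blast
qed

lemma dJ_S: "dJ S = dw"
  by (simp add: dJ_def dw_def)

text \<open>The letter \<open>s\<close> can be completed on the left to \<open>dw\<close>, which is
  cancellable.\<close>

lemma cancel_Cons:
  assumes s: "s \<in> S" and u: "u \<in> lists S" "v \<in> lists S" and eq: "s # u \<approx> s # v"
  shows "u \<approx> v"
proof -
  have cw: "w0 + c s \<in> W" using W_add[OF w0_W W_c[OF s]] .
  define p where "p = red (w0 + c s)"
  note p = red[OF cw, folded p_def]
  have "l w0 = l (w0 + c s) + 1" using wJ_descent[of S "c s"] WJ_c[OF s] l_c[OF s] by simp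
  then have ps: "p @ [s] \<approx> dw"
    using dJ_peqI[of S "p @ [s]"] p s unfolding dJ_S by (simp add: add.assoc c_double)
  have "dw @ u \<approx> p @ s # u" using peq_append[OF peq_sym[OF ps] peq_refl, of u] by simp
  also have "p @ s # u \<approx> p @ s # v" using peq_append[OF peq_refl eq] .
  also have "p @ s # v \<approx> dw @ v" using peq_append[OF ps peq_refl, of v] by simp
  finally show ?thesis using cancel_dw[OF u] by blast
qed

lemma cancel_left:
  assumes "p \<in> lists S" "u \<in> lists S" "v \<in> lists S" "p @ u \<approx> p @ v"
  shows "u \<approx> v"
  using assms(1,4)
proof (induction p rule: list.induct)
  case (Cons s p)
  then have "p @ u \<approx> p @ v" using cancel_Cons[of s "p @ u" "p @ v"] assms(2,3) by simp
  then show ?case using Cons by simp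
qed simp

definition zw :: "'a list" where "zw = dw @ dw"

lemma zw_lists: "zw \<in> lists S"
  unfolding zw_def using dw(1) by simp

lemma w0_neg: "- w0 = w0"
  using wle_antisym[OF wle_w0[OF W_neg[OF w0_W]]] l_neg[OF w0_W] by simp

text \<open>Passing \<open>dw\<close> twice conjugates the letter by \<open>w0 + w0\<close>, which
  is zero as \<open>w0\<close> is its own inverse.\<close>

lemma zw_central_gen: assumes s: "s \<in> S" shows "[s] @ zw \<approx> zw @ [s]"
proof -
  obtain s' p where s': "s' \<in> S" "s # dw \<approx> dw @ [s']" "- w0 + c s + w0 = c s'"
    using dJ_conj[of S s] s unfolding dJ_S by blast
  obtain s'' p where s'': "s'' \<in> S" "s' # dw \<approx> dw @ [s'']" "- w0 + c s' + w0 = c s''"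
    using dJ_conj[of S s'] s' unfolding dJ_S by blast
  have "c s'' = - w0 + (- w0 + (c s + (w0 + w0)))" using s''(3) s'(3) by (simp add: add.assoc flip: s''(3) s'(3))
  moreover have "w0 + w0 = 0" using add.left_inverse[of w0] unfolding w0_neg .
  ultimately have "c s'' = c s" unfolding w0_neg by (simp add: add.assoc[symmetric])
  then have eq: "s'' = s" using c_inj s''(1) s by blast
  have "[s] @ zw \<approx> (dw @ [s']) @ dw" unfolding zw_def using peq_append[OF s'(2) peq_refl, of dw] by simp
  also have "(dw @ [s']) @ dw \<approx> dw @ (dw @ [s''])" using peq_append[OF peq_refl s''(2), of dw] by simp
  finally show ?thesis unfolding zw_def eq by simp
qed

lemma zw_central: "u \<in> lists S \<Longrightarrow> u @ zw \<approx> zw @ u"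
proof (induction u rule: list.induct)
  case (Cons s u)
  have s: "s \<in> S" and u: "u \<in> lists S" using Cons.prems by auto
  have "(s # u) @ zw \<approx> [s] @ zw @ u" using peq_Cons[OF Cons.IH[OF u]] by simp
  also have "[s] @ zw @ u \<approx> zw @ (s # u)" using peq_append[OF zw_central_gen[OF s] peq_refl, of u] by simp
  finally show ?case .
qed simp

lemma ex_complement:
  assumes s: "s \<in> S"
  shows "\<exists>p\<in>lists S. s # p \<approx> zw \<and> p @ [s] \<approx> zw"
proof -
  obtain s' p where p: "p \<in> lists S" "s # p \<approx> dw"
    using dJ_conj[of S s] s unfolding dJ_S by blast
  define q where "q = p @ dw"
  have q: "q \<in> lists S" unfolding q_def using p(1) dw(1) by simp
  have 1: "s # q \<approx> zw" unfolding q_def zw_def using peq_append[OF p(2) peq_refl, of dw] by simp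
  \<comment> \<open>By centrality \<open>s q s\<close> equals \<open>zw s\<close> and so
    \<open>s zw\<close>; cancelling \<open>s\<close> makes the right complement a left
    complement.\<close>
  have "s # (q @ [s]) \<approx> zw @ [s]" using peq_append[OF 1 peq_refl, of "[s]"] by simp
  also have "zw @ [s] \<approx> s # zw" using peq_sym[OF zw_central_gen[OF s]] by simp
  finally have "q @ [s] \<approx> zw" using cancel_Cons[OF s] q s zw_lists by simp
  then show ?thesis using q 1 by blast
qed

end

section \<open>The Garside structure of an Artin--Tits group of spherical type\<close>

lemma alt_word_eq: "alt_word n s t = map (\<lambda>s. (s, True)) (alt n s t)"
  by (induction n arbitrary: s t) auto

definition signed_sum :: "('a \<Rightarrow> 'g::group_add) \<Rightarrow> 'a gword \<Rightarrow> 'g" where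
  "signed_sum g u = sum_list (map (\<lambda>(s, b). if b then g s else - g s) u)"

lemma signed_sum_simps [simp]:
  "signed_sum g [] = 0"
  "signed_sum g ((s, b) # u) = (if b then g s else - g s) + signed_sum g u"
  "signed_sum g (u @ v) = signed_sum g u + signed_sum g v"
  by (simp_all add: signed_sum_def)

lemma signed_sum_pos: "signed_sum g (map (\<lambda>s. (s, True)) u) = sum_list (map g u)"
  by (induction u) simp_all

locale artin_system = coxeter_system S m c
  for S :: "'a set" and m :: "'a \<Rightarrow> 'a \<Rightarrow> enat" and c :: "'a \<Rightarrow> 'w::group_add" +
  fixes g :: "'a \<Rightarrow> 'g::group_add"
  assumes signed_sum_eq_iff: "u \<in> gwords S \<Longrightarrow> v \<in> gwords S \<Longrightarrow>
    signed_sum g u = signed_sum g v \<longleftrightarrow> pres_eq S (artin_relations S m) u v"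
begin

definition gv :: "'a list \<Rightarrow> 'g" where "gv u = sum_list (map g u)"

lemma gv_simps [simp]: "gv [] = 0" "gv (s # u) = g s + gv u" "gv (u @ v) = gv u + gv v"
  by (simp_all add: gv_def)

lemma pos_gwords: "map (\<lambda>s. (s, True)) u \<in> gwords S \<longleftrightarrow> u \<in> lists S"
  by (auto simp: gwords_def in_lists_conv_set)

lemma braid_gv: "(u, v) \<in> braid_rel S m \<Longrightarrow> gv u = gv v"
proof -
  assume "(u, v) \<in> braid_rel S m"
  then obtain n s t where st: "u = alt n s t" "v = alt n t s" "s \<in> S" "t \<in> S" "s \<noteq> t" "m s t = enat n"
    by (rule braid_relE)
  have l: "alt_word n s t \<in> gwords S" "alt_word n t s \<in> gwords S"
    unfolding alt_word_eq pos_gwords using alt_lists[OF st(3,4)] alt_lists[OF st(4,3)] by blast+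
  have "(alt_word n s t, alt_word n t s) \<in> artin_relations S m"
    unfolding artin_relations_def using st by blast
  then have "pres_eq S (artin_relations S m) (alt_word n s t) (alt_word n t s)"
    using l by (rule pres_eq.rel)
  then have "signed_sum g (alt_word n s t) = signed_sum g (alt_word n t s)"
    using signed_sum_eq_iff[OF l] by blast
  then show ?thesis unfolding alt_word_eq signed_sum_pos gv_def st(1,2) .
qed

lemma peq_gv: "u \<approx> v \<Longrightarrow> gv u = gv v"
  by (induction rule: wcong.induct) (auto simp: braid_gv)

subsection \<open>The positive monoid embeds into the group\<close>

definition compl :: "'a \<Rightarrow> 'a list" where
  "compl s = (SOME p. p \<in> lists S \<and> s # p \<approx> zw \<and> p @ [s] \<approx> zw)"

lemma compl: assumes "s \<in> S" shows "compl s \<in> lists S" "s # compl s \<approx> zw" "compl s @ [s] \<approx> zw"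
proof -
  have "\<exists>p. p \<in> lists S \<and> s # p \<approx> zw \<and> p @ [s] \<approx> zw" using ex_complement[OF assms] by blast
  then have "compl s \<in> lists S \<and> s # compl s \<approx> zw \<and> compl s @ [s] \<approx> zw"
    unfolding compl_def by (rule someI_ex)
  then show "compl s \<in> lists S" "s # compl s \<approx> zw" "compl s @ [s] \<approx> zw" by blast+
qed

text \<open>A signed word \<open>u\<close> represents the fraction with numerator \<open>numer u\<close> and denominator the power
  \<open>negs u\<close> of the central element \<open>zw\<close>.\<close>

definition numer :: "'a gword \<Rightarrow> 'a list" where
  "numer u = concat (map (\<lambda>(s, b). if b then [s] else compl s) u)"

definition negs :: "'a gword \<Rightarrow> nat" where
  "negs u = length (filter (\<lambda>(s, b). \<not> b) u)"

definition zpow :: "nat \<Rightarrow> 'a list" where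
  "zpow k = concat (replicate k zw)"

lemma zpow_add: "zpow (i + j) = zpow i @ zpow j"
  by (simp add: zpow_def replicate_add)

lemma zpow_lists: "zpow k \<in> lists S"
  using zw_lists by (induction k) (auto simp: zpow_def)

lemma zpow_central: "u \<in> lists S \<Longrightarrow> u @ zpow k \<approx> zpow k @ u"
proof (induction k)
  case (Suc k)
  have "u @ zpow (Suc k) \<approx> zw @ u @ zpow k"
    using peq_append[OF zw_central[OF Suc.prems] peq_refl, of "zpow k"] by (simp add: zpow_def)
  also have "zw @ u @ zpow k \<approx> zpow (Suc k) @ u"
    using peq_append[OF peq_refl Suc.IH[OF Suc.prems], of zw] by (simp add: zpow_def)
  finally show ?case .
qed (simp add: zpow_def)

lemma numer_lists: "u \<in> gwords S \<Longrightarrow> numer u \<in> lists S"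
proof (induction u)
  case (Cons a u)
  obtain s b where a: "a = (s, b)" by (cases a)
  have "s \<in> S" "u \<in> gwords S" using Cons.prems a by (auto simp: gwords_def)
  then show ?case using Cons.IH compl(1)[of s] by (simp add: numer_def a)
qed (simp add: numer_def)

text \<open>Equality of fractions by cross multiplication. Transitivity uses left cancellation,
  products use central denominators, and a letter next to its inverse contributes \<open>zw\<close>
  over \<open>zw\<close>.\<close>

lemma pres_eq_numer:
  "pres_eq S (artin_relations S m) u v \<Longrightarrow> zpow (negs v) @ numer u \<approx> zpow (negs u) @ numer v"
proof (induction rule: pres_eq.induct)
  case (refl u)
  then show ?case by simp
next
  case (sym u v)
  then show ?case by (simp add: peq_sym)
next
  case (trans u v w)
  have l: "numer u \<in> lists S" "numer v \<in> lists S" "numer w \<in> lists S"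
    using pres_eq_gwords[OF trans.hyps(1)] pres_eq_gwords[OF trans.hyps(2)] numer_lists by auto
  have "zpow (negs v) @ zpow (negs w) @ numer u \<approx> zpow (negs w) @ zpow (negs v) @ numer u"
    unfolding append_assoc[symmetric] zpow_add[symmetric] by (simp add: add.commute)
  also have "zpow (negs w) @ zpow (negs v) @ numer u \<approx> zpow (negs w) @ zpow (negs u) @ numer v"
    using peq_append[OF peq_refl trans.IH(1)] .
  also have "zpow (negs w) @ zpow (negs u) @ numer v \<approx> zpow (negs u) @ zpow (negs w) @ numer v"
    unfolding append_assoc[symmetric] zpow_add[symmetric] by (simp add: add.commute)
  also have "zpow (negs u) @ zpow (negs w) @ numer v \<approx> zpow (negs u) @ zpow (negs v) @ numer w"
    using peq_append[OF peq_refl trans.IH(2)] .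
  also have "zpow (negs u) @ zpow (negs v) @ numer w \<approx> zpow (negs v) @ zpow (negs u) @ numer w"
    unfolding append_assoc[symmetric] zpow_add[symmetric] by (simp add: add.commute)
  finally have "zpow (negs v) @ zpow (negs w) @ numer u \<approx> zpow (negs v) @ zpow (negs u) @ numer w" .
  moreover have "zpow (negs w) @ numer u \<in> lists S" "zpow (negs u) @ numer w \<in> lists S"
    using l zpow_lists by simp_all
  ultimately show ?case using cancel_left[OF zpow_lists] by blast
next
  case (append u u' v v')
  have l: "numer u \<in> lists S" "numer u' \<in> lists S"
    using pres_eq_gwords[OF append.hyps(1)] numer_lists by auto
  have n: "numer (x @ y) = numer x @ numer y" "negs (x @ y) = negs x + negs y" for x y
    by (simp_all add: numer_def negs_def)
  have *: "zpow i @ zpow j @ x @ y \<approx> (zpow i @ x) @ (zpow j @ y)" if "x \<in> lists S" for i j x y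
    using peq_append[OF peq_refl peq_append[OF peq_sym[OF zpow_central[OF that]] peq_refl], of "zpow i" j y] by simp
  have "zpow (negs (u' @ v')) @ numer (u @ v) \<approx> (zpow (negs u') @ numer u) @ (zpow (negs v') @ numer v)"
    using *[OF l(1)] unfolding n zpow_add append_assoc .
  also have "(zpow (negs u') @ numer u) @ (zpow (negs v') @ numer v) \<approx>
      (zpow (negs u) @ numer u') @ (zpow (negs v) @ numer v')"
    using peq_append[OF append.IH] .
  also have "(zpow (negs u) @ numer u') @ (zpow (negs v) @ numer v') \<approx> zpow (negs (u @ v)) @ numer (u' @ v')"
    using peq_sym[OF *[OF l(2)]] unfolding n zpow_add append_assoc .
  finally show ?case .
next
  case (cancel s b)
  then show ?case using compl[OF cancel] by (cases b) (simp_all add: numer_def negs_def zpow_def)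
next
  case (rel u v)
  then obtain n s t where st: "u = alt_word n s t" "v = alt_word n t s" "s \<in> S" "t \<in> S" "s \<noteq> t" "m s t = enat n"
    unfolding artin_relations_def by blast
  have num: "numer (map (\<lambda>s. (s, True)) x) = x" "negs (map (\<lambda>s. (s, True)) x) = 0" for x
    by (induction x) (simp_all add: numer_def negs_def)
  have "(alt n s t, alt n t s) \<in> braid_rel S m" using st unfolding braid_rel_def by blast
  then show ?case unfolding st(1,2) alt_word_eq num by (simp add: zpow_def wcong_base)
qed

lemma gv_eq_iff: "u \<in> lists S \<Longrightarrow> v \<in> lists S \<Longrightarrow> gv u = gv v \<longleftrightarrow> u \<approx> v"
proof
  assume uv: "u \<in> lists S" "v \<in> lists S" and "gv u = gv v"
  then have "pres_eq S (artin_relations S m) (map (\<lambda>s. (s, True)) u) (map (\<lambda>s. (s, True)) v)"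
    using signed_sum_eq_iff[of "map (\<lambda>s. (s, True)) u" "map (\<lambda>s. (s, True)) v"]
    unfolding pos_gwords signed_sum_pos gv_def by blast
  then have "zpow (negs (map (\<lambda>s. (s, True)) v)) @ numer (map (\<lambda>s. (s, True)) u) \<approx>
    zpow (negs (map (\<lambda>s. (s, True)) u)) @ numer (map (\<lambda>s. (s, True)) v)" by (rule pres_eq_numer)
  moreover have "numer (map (\<lambda>s. (s, True)) x) = x" "negs (map (\<lambda>s. (s, True)) x) = 0" for x
    by (induction x) (simp_all add: numer_def negs_def)
  ultimately show "u \<approx> v" by (simp add: zpow_def)
qed (rule peq_gv)

subsection \<open>The Garside structure\<close>

lemma mspan_gv: "mspan (g ` J) = gv ` lists J"
proof
  show "mspan (g ` J) \<subseteq> gv ` lists J"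
  proof
    fix a assume "a \<in> mspan (g ` J)"
    then show "a \<in> gv ` lists J"
    proof (induction rule: mspan.induct)
      case mon_zero
      show ?case using image_eqI[of 0 gv "[]" "lists J"] by simp
    next
      case (mon_add s a)
      then obtain x u where "x \<in> J" "s = g x" "u \<in> lists J" "a = gv u" by blast
      then show ?case using image_eqI[of "s + a" gv "x # u" "lists J"] by simp
    qed
  qed
  have "gv u \<in> mspan (g ` J)" if "u \<in> lists J" for u
    using that by (induction u rule: list.induct) (auto intro: mspan.intros)
  then show "gv ` lists J \<subseteq> mspan (g ` J)" by blast
qed

lemma gv_mspan: "u \<in> lists J \<Longrightarrow> gv u \<in> mspan (g ` J)"
  unfolding mspan_gv by blast

lemma mspanE: assumes "a \<in> mspan (g ` J)" obtains u where "u \<in> lists J" "a = gv u"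
  using assms unfolding mspan_gv by blast

definition glen :: "'g \<Rightarrow> nat" where
  "glen a = length (SOME u. u \<in> lists S \<and> gv u = a)"

lemma glen: assumes "u \<in> lists S" shows "glen (gv u) = length u"
proof -
  define v where "v = (SOME v. v \<in> lists S \<and> gv v = gv u)"
  have "v \<in> lists S \<and> gv v = gv u"
    unfolding v_def by (rule someI[of "\<lambda>v. v \<in> lists S \<and> gv v = gv u" u]) (simp add: assms)
  then have "v \<approx> u" using gv_eq_iff assms by blast
  then have "length v = length u" by (rule peq_length)
  then show ?thesis by (simp add: glen_def v_def)
qed

definition gD :: "'g set \<Rightarrow> 'g" where
  "gD X = gv (dJ {s \<in> S. g s \<in> X})"

lemma g_inj: "s \<in> S \<Longrightarrow> t \<in> S \<Longrightarrow> g s = g t \<Longrightarrow> s = t"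
  using gv_eq_iff[of "[s]" "[t]"] peq_set[of "[s]" "[t]"] by auto

lemma sub_gens:
  assumes "X \<subseteq> g ` S" obtains J where "J \<subseteq> S" "X = g ` J" "gD X = gv (dJ J)"
proof -
  have "X = g ` {s \<in> S. g s \<in> X}" using assms by blast
  then show ?thesis using that[of "{s \<in> S. g s \<in> X}"] unfolding gD_def by blast
qed

lemma gD_image: "J \<subseteq> S \<Longrightarrow> gD (g ` J) = gv (dJ J)"
proof -
  assume J: "J \<subseteq> S"
  then have "{s \<in> S. g s \<in> g ` J} = J" using g_inj by blast
  then show ?thesis unfolding gD_def by simp
qed

lemma minus_gv: "gv (u @ v) = a \<Longrightarrow> - gv u + a = gv v"
  by (auto simp: add.assoc)

lemma dJ_lists: "J \<subseteq> S \<Longrightarrow> dJ J \<in> lists S"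
  using dJ(3) lists_sub by blast

text \<open>\<open>y\<close> is a descent of \<open>U + c x\<close>, which it shortens to
  \<open>U'\<close>, but not of \<open>U\<close>. By the cocycle rule its conjugate by
  \<open>U\<close> is an inversion of \<open>c x\<close>, hence \<open>c x\<close> itself, and
  \<open>c y + U = U + c x\<close>.\<close>

lemma fold_W:
  assumes "y \<in> S" "x \<in> S" "U \<in> W" "U' \<in> W" "l (c y + U) = Suc (l U)" "l (U + c x) = Suc (l U)"
    and "c y + U = U' + c x" "l U' = l U"
  shows "U = U'"
proof -
  have e: "c y + (U + c x) = U'"
    using assms(7) by (simp add: add.assoc[symmetric]) (simp add: add.assoc c_double[OF assms(2)])
  have Ux: "U + c x \<in> W" using W_add[OF assms(3) W_c[OF assms(2)]] .
  have "c y \<in> N (U + c x)" using l_descent_iff[OF assms(1) Ux] e assms(6,8) by simp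
  moreover have "c y \<notin> N U" using l_descent_iff[OF assms(1,3)] assms(5) by simp
  ultimately have "- U + c y + U \<in> N (c x)" using N_add[OF assms(3) W_c[OF assms(2)]] by blast
  then have "- U + c y + U = c x" using N_c[OF assms(2)] by blast
  then have "c y + U = U + c x" by (metis add.assoc add_minus_cancel)
  then show ?thesis using assms(7) by simp
qed

lemma fold_words:
  assumes J: "J \<subseteq> S" and t: "t \<in> S" and u: "u \<in> lists S" "v \<in> lists S" "v @ u @ dJ J \<approx> dJ (insert t J)"
    and u': "u' \<in> lists S" "v' \<in> lists S" "v' @ u' @ dJ J \<approx> dJ (insert t J)"
    and x: "x \<in> J" and y: "y \<in> S" and eq: "y # u \<approx> u' @ [x]"
  shows "u \<approx> u'"
proof -
  have xS: "x \<in> S" using J x by blast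
  \<comment> \<open>\<open>u @ dJ J\<close> is the end of a reduced word, and \<open>dJ J\<close>
    can be rewritten to begin with \<open>x\<close>.\<close>
  have *: "reduced (u @ [x])" if "v @ u @ dJ J \<approx> dJ (insert t J)" for u v
  proof -
    have "insert t J \<subseteq> S" using J t by blast
    then have "reduced (v @ u @ dJ J)" using peq_reduced[OF that] dJ(1) by blast
    then have 1: "reduced (u @ dJ J)" using reduced_append(2)[of v] by blast
    obtain s' p where "x # p \<approx> dJ J" using dJ_conj[OF J x] by blast
    then have "u @ x # p \<approx> u @ dJ J" by (rule peq_append[OF peq_refl])
    then have "reduced ((u @ [x]) @ p)" using 1 peq_reduced[of "u @ x # p" "u @ dJ J"] by simp
    then show ?thesis using reduced_append(1) by blast
  qed
  have r: "reduced (u @ [x])" "reduced (u' @ [x])" using *[OF u(3)] *[OF u'(3)] .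
  have ry: "reduced (y # u)" using r(2) peq_reduced[OF eq] by blast
  have ru: "reduced u" "reduced u'" using reduced_append(1)[OF r(1)] reduced_append(1)[OF r(2)] .
  have len: "length u = length u'" using peq_length[OF eq] by simp
  have W: "ev u \<in> W" "ev u' \<in> W" using ev_W u(1) u'(1) by blast+
  have "ev u = ev u'"
  proof (rule fold_W[OF y xS W])
    show "l (c y + ev u) = Suc (l (ev u))" using ry ru unfolding reduced_def by simp
    show "l (ev u + c x) = Suc (l (ev u))" using r(1) ru unfolding reduced_def by simp
    show "c y + ev u = ev u' + c x" using peq_ev[OF eq] by simp
    show "l (ev u') = l (ev u)" using ru len unfolding reduced_def by simp
  qed
  then show ?thesis using matsumoto ru by blast
qed

lemma garside_group: "garside_group (g ` S) gD glen"
proof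
  show "finite (g ` S)" using datum unfolding artin_datum_def by simp
  show "glen s = 1" if s: "s \<in> g ` S" for s
  proof -
    obtain x where x: "x \<in> S" "s = g x" using s by blast
    then show ?thesis using glen[of "[x]"] by simp
  qed
  show "glen (a + b) = glen a + glen b" if ab: "a \<in> mspan (g ` S)" "b \<in> mspan (g ` S)" for a b
  proof -
    obtain u v where "u \<in> lists S" "a = gv u" "v \<in> lists S" "b = gv v" using ab by (elim mspanE)
    then show ?thesis using glen[of "u @ v"] glen[of u] glen[of v] by simp
  qed
  show "\<exists>j. - s + j \<in> mspan (g ` S) \<and> - t + j \<in> mspan (g ` S) \<and>
      (\<forall>d. - s + d \<in> mspan (g ` S) \<longrightarrow> - t + d \<in> mspan (g ` S) \<longrightarrow> - j + d \<in> mspan (g ` S))"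
    if st: "s \<in> g ` S" "t \<in> g ` S" "s \<noteq> t" for s t
  proof -
    obtain x y where xy: "x \<in> S" "s = g x" "y \<in> S" "t = g y" "x \<noteq> y" using st by blast
    obtain n where n: "m x y = enat n" "2 \<le> n" using m_finite[OF xy(1,3,5)] by blast
    obtain k where k: "n = Suc k" using n(2) by (cases n) auto
    have b: "gv (alt n x y) = gv (alt n y x)"
      using braid_gv[of "alt n x y" "alt n y x"] xy n(1) unfolding braid_rel_def by blast
    have "- s + gv (alt n x y) = gv (alt k y x)" using xy(2) unfolding k by (simp add: add.assoc)
    moreover have "- t + gv (alt n x y) = gv (alt k x y)" unfolding b using xy(4) unfolding k by (simp add: add.assoc)
    moreover have "alt k y x \<in> lists S" "alt k x y \<in> lists S" using alt_lists[OF xy(3,1)] alt_lists[OF xy(1,3)] by blast+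
    ultimately have 1: "- s + gv (alt n x y) \<in> mspan (g ` S)" "- t + gv (alt n x y) \<in> mspan (g ` S)"
      using gv_mspan by simp_all
    have "- gv (alt n x y) + d \<in> mspan (g ` S)" if d: "- s + d \<in> mspan (g ` S)" "- t + d \<in> mspan (g ` S)" for d
    proof -
      obtain u where u: "u \<in> lists S" "- s + d = gv u" using d(1) by (rule mspanE)
      obtain v where v: "v \<in> lists S" "- t + d = gv v" using d(2) by (rule mspanE)
      have du: "d = gv (x # u)" and dv: "d = gv (y # v)"
        using u(2) v(2) xy by (simp_all flip: u(2) v(2))
      then have "x # u \<approx> y # v" using gv_eq_iff[of "x # u" "y # v"] u v xy by simp
      then obtain q where q: "q \<in> lists S" "x # u \<approx> alt n x y @ q"
        using garside_lemma[OF xy(1,3,5) n(1) u(1) v(1)] by blast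
      have "gv (alt n x y @ q) = d" using peq_gv[OF q(2)] du by simp
      then have "- gv (alt n x y) + d = gv q" by (rule minus_gv)
      then show ?thesis using gv_mspan[OF q(1)] by simp
    qed
    then show ?thesis using 1 by blast
  qed
  show "a \<in> mspan X \<and> b \<in> mspan X"
    if h: "X \<subseteq> g ` S" "a \<in> mspan (g ` S)" "b \<in> mspan (g ` S)" "a + b \<in> mspan X" for X a b
  proof -
    obtain J where J: "J \<subseteq> S" "X = g ` J" using sub_gens[OF h(1)] by blast
    obtain u where u: "u \<in> lists S" "a = gv u" using h(2) by (rule mspanE)
    obtain v where v: "v \<in> lists S" "b = gv v" using h(3) by (rule mspanE)
    obtain w where w: "w \<in> lists J" "a + b = gv w" using h(4) unfolding J(2) by (rule mspanE)
    have "u @ v \<approx> w" using gv_eq_iff[of "u @ v" w] u v w lists_sub[OF J(1) w(1)] by simp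
    then have "u @ v \<in> lists J" using peq_lists w(1) by blast
    then show ?thesis using gv_mspan[of u J] gv_mspan[of v J] u(2) v(2) J(2) by simp
  qed
  show "gD X \<in> mspan X" if h: "X \<subseteq> g ` S" for X
  proof -
    obtain J where J: "J \<subseteq> S" "X = g ` J" "gD X = gv (dJ J)" using sub_gens[OF h] by blast
    show ?thesis unfolding J(3) unfolding J(2) using gv_mspan[OF dJ(3)[OF J(1)]] .
  qed
  show "- gD X + s + gD X \<in> X" if h: "X \<subseteq> g ` S" "s \<in> X" for X s
  proof -
    obtain J where J: "J \<subseteq> S" "X = g ` J" "gD X = gv (dJ J)" using sub_gens[OF h(1)] by blast
    obtain x where x: "x \<in> J" "s = g x" using h(2) J(2) by blast
    obtain x' where x': "x' \<in> J" "x # dJ J \<approx> dJ J @ [x']" using dJ_conj[OF J(1) x(1)] by blast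
    have "gv (dJ J @ [x']) = s + gD X" using peq_gv[OF x'(2)] x(2) J(3) by simp
    then have "- gD X + (s + gD X) = gv [x']" unfolding J(3) by (rule minus_gv)
    then show ?thesis using x'(1) J(2) by (simp add: add.assoc)
  qed
  show "- s + gD X \<in> mspan (g ` S)" if h: "X \<subseteq> g ` S" "s \<in> X" for X s
  proof -
    obtain J where J: "J \<subseteq> S" "X = g ` J" "gD X = gv (dJ J)" using sub_gens[OF h(1)] by blast
    obtain x where x: "x \<in> J" "s = g x" using h(2) J(2) by blast
    obtain p where p: "p \<in> lists S" "x # p \<approx> dJ J" using dJ_conj[OF J(1) x(1)] by blast
    have "gD X = s + gv p" using peq_gv[OF p(2)] x(2) J(3) by simp
    then show ?thesis using gv_mspan[OF p(1)] by simp
  qed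
  show "d = gD X" if h: "X \<subseteq> g ` S" "d \<in> mspan (g ` S)" "gD X - d \<in> mspan (g ` S)"
    "\<And>s. s \<in> X \<Longrightarrow> d - s \<in> mspan (g ` S)" for X d
  proof -
    obtain J where J: "J \<subseteq> S" "X = g ` J" "gD X = gv (dJ J)" using sub_gens[OF h(1)] by blast
    obtain u where u: "u \<in> lists S" "d = gv u" using h(2) by (rule mspanE)
    obtain v where v: "v \<in> lists S" "gD X - d = gv v" using h(3) by (rule mspanE)
    have "gv (v @ u) = gv (dJ J)" using u(2) v(2) J(3) by (simp flip: v(2))
    then have vu: "v @ u \<approx> dJ J" using gv_eq_iff[of "v @ u" "dJ J"] u(1) v(1) dJ_lists[OF J(1)] by simp
    then have "reduced (v @ u)" "v @ u \<in> lists J"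
      using peq_reduced[OF vu] peq_lists[OF vu] dJ[OF J(1)] by blast+
    then have ru: "reduced u" "u \<in> lists J" using reduced_append(2)[of v u] by simp_all
    \<comment> \<open>\<open>u\<close> is a reduced word over \<open>J\<close> that every letter of
      \<open>J\<close> right-divides; each of them therefore shortens it, which characterises the
      longest element.\<close>
    have "ev u = wJ J"
    proof (rule wJ_unique[OF J(1) WJ_ev[OF ru(2)]])
      fix x assume x: "x \<in> J"
      then have "g x \<in> X" using J(2) by blast
      then obtain q where q: "q \<in> lists S" "d - g x = gv q" using h(4) mspanE by blast
      have "gv (q @ [x]) = gv u" using q(2) u(2) by (simp flip: q(2))
      moreover have xS: "x \<in> S" using J(1) x by blast
      ultimately have qu: "q @ [x] \<approx> u" using gv_eq_iff[of "q @ [x]" u] q(1) u(1) by simp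
      have "ev u + c x = ev q" using peq_ev[OF qu] c_double[OF xS] by (simp add: add.assoc flip: peq_ev[OF qu])
      then have "l (ev u + c x) \<le> length q" using l_le[OF q(1)] by simp
      also have "length q < l (ev u)" using ru(1) peq_length[OF qu] unfolding reduced_def by simp
      finally show "l (ev u + c x) < l (ev u)" .
    qed
    then have "u \<approx> dJ J" using matsumoto[OF ru(1) dJ(1)[OF J(1)]] dJ(2)[OF J(1)] by simp
    then show ?thesis unfolding u(2) J(3) by (rule peq_gv)
  qed
  show "a + s + s + b \<noteq> gD X"
    if h: "X \<subseteq> g ` S" "a \<in> mspan (g ` S)" "b \<in> mspan (g ` S)" "s \<in> g ` S" for X a b s
  proof
    assume e: "a + s + s + b = gD X"
    obtain J where J: "J \<subseteq> S" "X = g ` J" "gD X = gv (dJ J)" using sub_gens[OF h(1)] by blast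
    obtain u where u: "u \<in> lists S" "a = gv u" using h(2) by (rule mspanE)
    obtain v where v: "v \<in> lists S" "b = gv v" using h(3) by (rule mspanE)
    obtain x where x: "x \<in> S" "s = g x" using h(4) by blast
    have "gv (u @ [x, x] @ v) = gv (dJ J)" using e u(2) v(2) x(2) J(3) by (simp add: add.assoc)
    then have "u @ [x, x] @ v \<approx> dJ J"
      using gv_eq_iff[of "u @ [x, x] @ v" "dJ J"] u(1) v(1) x(1) dJ_lists[OF J(1)] by simp
    then have "reduced (u @ [x, x] @ v)" using peq_reduced dJ(1)[OF J(1)] by blast
    then have "reduced ([x, x] @ v)" by (rule reduced_append(2))
    then have "reduced [x, x]" by (rule reduced_append(1))
    then show False using c_double[OF x(1)] l_zero unfolding reduced_def by simp
  qed
  show "p = p'" if h: "X \<subseteq> g ` S" "t \<in> g ` S" "p \<in> mspan (g ` S)" "p' \<in> mspan (g ` S)"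
    "gD (insert t X) - gD X - p \<in> mspan (g ` S)" "gD (insert t X) - gD X - p' \<in> mspan (g ` S)"
    "x \<in> X" "q \<in> g ` S" "q + p = p' + x" for X t p p' x q
  proof -
    obtain J where J: "J \<subseteq> S" "X = g ` J" "gD X = gv (dJ J)" using sub_gens[OF h(1)] by blast
    obtain t0 where t0: "t0 \<in> S" "t = g t0" using h(2) by blast
    have Z: "insert t0 J \<subseteq> S" using J(1) t0(1) by blast
    have D: "gD (insert t X) = gv (dJ (insert t0 J))" using gD_image[OF Z] J(2) t0(2) by simp
    obtain u where u: "u \<in> lists S" "p = gv u" using h(3) by (rule mspanE)
    obtain u' where u': "u' \<in> lists S" "p' = gv u'" using h(4) by (rule mspanE)
    obtain v where v: "v \<in> lists S" "gD (insert t X) - gD X - p = gv v" using h(5) by (rule mspanE)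
    obtain v' where v': "v' \<in> lists S" "gD (insert t X) - gD X - p' = gv v'" using h(6) by (rule mspanE)
    obtain x0 where x0: "x0 \<in> J" "x = g x0" using h(7) J(2) by blast
    obtain y where y: "y \<in> S" "q = g y" using h(8) by blast
    have xS: "x0 \<in> S" using J(1) x0(1) by blast
    have "gv v + (gv u + gv (dJ J)) = gv (dJ (insert t0 J))"
      unfolding v(2)[symmetric] u(2)[symmetric] J(3)[symmetric] D by (simp add: group_simps del: add_uminus_conv_diff)
    then have e1: "v @ u @ dJ J \<approx> dJ (insert t0 J)"
      using gv_eq_iff[of "v @ u @ dJ J" "dJ (insert t0 J)"] u(1) v(1) dJ_lists[OF J(1)] dJ_lists[OF Z] by simp
    have "gv v' + (gv u' + gv (dJ J)) = gv (dJ (insert t0 J))"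
      unfolding v'(2)[symmetric] u'(2)[symmetric] J(3)[symmetric] D by (simp add: group_simps del: add_uminus_conv_diff)
    then have e2: "v' @ u' @ dJ J \<approx> dJ (insert t0 J)"
      using gv_eq_iff[of "v' @ u' @ dJ J" "dJ (insert t0 J)"] u'(1) v'(1) dJ_lists[OF J(1)] dJ_lists[OF Z] by simp
    have "gv (y # u) = gv (u' @ [x0])" using h(9) u(2) u'(2) x0(2) y(2) by simp
    then have e3: "y # u \<approx> u' @ [x0]" using gv_eq_iff[of "y # u" "u' @ [x0]"] u(1) u'(1) y(1) xS by simp
    have "u \<approx> u'" using fold_words[OF J(1) t0(1) u(1) v(1) e1 u'(1) v'(1) e2 x0(1) y(1) e3] .
    then show ?thesis unfolding u(2) u'(2) by (rule peq_gv)
  qed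
qed

end

subsection \<open>The group of bijections of a type\<close>

text \<open>A type of class \<open>group_add\<close> in which groups given by a carrier set can be
  represented, so that the results stated for such types apply to them.\<close>

typedef 'b bijection = "{f :: 'b \<Rightarrow> 'b. bij f}"
  by (rule exI[of _ id]) simp

setup_lifting type_definition_bijection

instantiation bijection :: (type) group_add
begin

lift_definition zero_bijection :: "'a bijection" is id by simp
lift_definition plus_bijection :: "'a bijection \<Rightarrow> 'a bijection \<Rightarrow> 'a bijection" is "\<lambda>f g. f \<circ> g"
  by (rule bij_comp)
lift_definition uminus_bijection :: "'a bijection \<Rightarrow> 'a bijection" is "inv_into UNIV"
  by (rule bij_imp_bij_inv)
definition minus_bijection :: "'a bijection \<Rightarrow> 'a bijection \<Rightarrow> 'a bijection" where
  "minus_bijection f g = f + - g"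

instance
proof
  fix f g h :: "'a bijection"
  show "f + g + h = f + (g + h)" by transfer (rule comp_assoc)
  show "0 + f = f" "f + 0 = f" by (transfer, simp)+
  show "- f + f = 0" by transfer (simp add: bij_is_inj)
  show "f + - g = f - g" by (simp add: minus_bijection_def)
qed

end

text \<open>Left translation, extended by the identity outside the carrier so that it is a bijection
  of the whole type.\<close>

definition cayley :: "('b, 'c) monoid_scheme \<Rightarrow> 'b \<Rightarrow> 'b bijection" where
  "cayley G x = Abs_bijection (\<lambda>h. if h \<in> carrier G then x \<otimes>\<^bsub>G\<^esub> h else h)"

context group
begin

lemma cayley_bij: assumes x: "x \<in> carrier G"
  shows "bij (\<lambda>h. if h \<in> carrier G then x \<otimes> h else h)"
proof (rule o_bij)
  let ?f = "\<lambda>x h. if h \<in> carrier G then x \<otimes> h else h"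
  show "?f (inv x) \<circ> ?f x = id" "?f x \<circ> ?f (inv x) = id"
    using x by (auto simp: fun_eq_iff m_assoc[symmetric])
qed

lemma Rep_cayley: "x \<in> carrier G \<Longrightarrow> Rep_bijection (cayley G x) = (\<lambda>h. if h \<in> carrier G then x \<otimes> h else h)"
  unfolding cayley_def using cayley_bij by (intro Abs_bijection_inverse) simp

lemma cayley_mult: "x \<in> carrier G \<Longrightarrow> y \<in> carrier G \<Longrightarrow> cayley G (x \<otimes> y) = cayley G x + cayley G y"
  by (simp add: Rep_bijection_inject[symmetric] plus_bijection.rep_eq Rep_cayley fun_eq_iff m_assoc)

lemma cayley_one: "cayley G \<one> = 0"
  by (auto simp: Rep_bijection_inject[symmetric] zero_bijection.rep_eq Rep_cayley fun_eq_iff)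

lemma cayley_inv: "x \<in> carrier G \<Longrightarrow> cayley G (inv x) = - cayley G x"
  using cayley_mult[of "inv x" x] cayley_one by (simp add: add_eq_0_iff2)

lemma cayley_inj: "x \<in> carrier G \<Longrightarrow> y \<in> carrier G \<Longrightarrow> cayley G x = cayley G y \<longleftrightarrow> x = y"
proof
  assume xy: "x \<in> carrier G" "y \<in> carrier G" and "cayley G x = cayley G y"
  then have "Rep_bijection (cayley G x) \<one> = Rep_bijection (cayley G y) \<one>" by simp
  then show "x = y" using xy by (simp add: Rep_cayley)
qed simp

lemma cayley_pow: "x \<in> carrier G \<Longrightarrow> cayley G (x [^] n) = nmul n (cayley G x)" for n :: nat
  by (induction n) (simp_all add: cayley_one cayley_mult nmul_Suc_right del: nmul.simps(2))

lemma cayley_generate: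
  assumes X: "X \<subseteq> carrier G" and x: "x \<in> carrier G"
  shows "cayley G x \<in> gspan (cayley G ` X) \<longleftrightarrow> x \<in> generate G X"
proof
  assume "x \<in> generate G X"
  then show "cayley G x \<in> gspan (cayley G ` X)"
  proof (induction rule: generate.induct)
    case one
    then show ?case by (simp add: cayley_one grp_zero)
  next
    case (incl h)
    then show ?case by (simp add: grp_gen)
  next
    case (inv h)
    then have "h \<in> carrier G" "cayley G h \<in> gspan (cayley G ` X)" using X by (auto intro: grp_gen)
    then show ?case by (simp add: cayley_inv grp_neg)
  next
    case (eng h1 h2)
    then show ?case using generate_in_carrier[OF X] by (simp add: cayley_mult grp_plus)
  qed
next
  have "\<exists>x\<in>generate G X. a = cayley G x" if "a \<in> gspan (cayley G ` X)" for a
    using that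
  proof (induction rule: gspan.induct)
    case grp_zero
    show ?case using generate.one cayley_one by metis
  next
    case (grp_add s a)
    then obtain h x where h: "h \<in> X" "s = cayley G h" "x \<in> generate G X" "a = cayley G x" by blast
    have "h \<in> generate G X" using generate.incl[OF h(1)] .
    then have "h \<otimes> x \<in> generate G X" "s + a = cayley G (h \<otimes> x)"
      using h generate.eng[of h G X x] generate_in_carrier[OF X] by (simp_all add: cayley_mult)
    then show ?case by blast
  next
    case (grp_minus s a)
    then obtain h x where h: "h \<in> X" "s = cayley G h" "x \<in> generate G X" "a = cayley G x" by blast
    have ih: "inv h \<in> generate G X" using generate.inv[OF h(1)] .
    have hc: "h \<in> carrier G" using h(1) X by blast
    have "inv h \<otimes> x \<in> generate G X" using generate.eng[OF ih h(3)] .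
    moreover have "- s + a = cayley G (inv h \<otimes> x)"
      using h hc generate_in_carrier[OF X] by (simp add: cayley_mult cayley_inv)
    ultimately show ?case by blast
  qed
  then show "cayley G x \<in> gspan (cayley G ` X) \<Longrightarrow> x \<in> generate G X"
    using cayley_inj[OF x] generate_in_carrier[OF X] by metis
qed

end

subsection \<open>The Artin group and the Coxeter group as groups of bijections\<close>

definition aclass :: "'a set \<Rightarrow> ('a \<Rightarrow> 'a \<Rightarrow> enat) \<Rightarrow> 'a gword \<Rightarrow> 'a gword set" where
  "aclass S m u = pres_rel S (artin_relations S m) `` {u}"

lemma aclass_mult: "u \<in> gwords S \<Longrightarrow> v \<in> gwords S \<Longrightarrow>
    aclass S m u \<otimes>\<^bsub>artin_group S m\<^esub> aclass S m v = aclass S m (u @ v)"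
  unfolding aclass_def artin_group_def by (rule presented_group_mult)

lemma aclass_carrier: "u \<in> gwords S \<Longrightarrow> aclass S m u \<in> carrier (artin_group S m)"
  unfolding aclass_def artin_group_def by (rule class_in_presented_group)

lemma aclassE:
  assumes "x \<in> carrier (artin_group S m)"
  obtains u where "u \<in> gwords S" "x = aclass S m u"
  using assms carrier_presented_groupE unfolding aclass_def artin_group_def by metis

lemma aclass_eq_iff:
  "u \<in> gwords S \<Longrightarrow> v \<in> gwords S \<Longrightarrow> aclass S m u = aclass S m v \<longleftrightarrow> pres_eq S (artin_relations S m) u v"
  unfolding aclass_def by (subst eq_equiv_class_iff[OF equiv_pres_rel]) (simp_all add: pres_rel_def)

lemma aclass_one: "\<one>\<^bsub>artin_group S m\<^esub> = aclass S m []"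
  by (simp add: aclass_def artin_group_def presented_group_def)

lemma aclass_gen: "artin_gen S m s = aclass S m [(s, True)]"
  by (simp add: aclass_def artin_gen_def pres_gen_def)

lemma aclass_gen_inv:
  assumes s: "s \<in> S" shows "inv\<^bsub>artin_group S m\<^esub> aclass S m [(s, True)] = aclass S m [(s, False)]"
proof -
  interpret group "artin_group S m" by (rule group_artin_group)
  have w: "[(s, b)] \<in> gwords S" for b using s by (simp add: gwords_def)
  have n: "[(s, False), (s, True)] \<in> gwords S" "[] \<in> gwords S" using s by (simp_all add: gwords_def)
  have "pres_eq S (artin_relations S m) [(s, False), (s, True)] []"
    using pres_eq.cancel[OF s, of _ False] by simp
  then have "aclass S m ([(s, False)] @ [(s, True)]) = aclass S m []"
    using aclass_eq_iff[OF n] by simp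
  then have "aclass S m [(s, False)] \<otimes>\<^bsub>artin_group S m\<^esub> aclass S m [(s, True)] = \<one>\<^bsub>artin_group S m\<^esub>"
    unfolding aclass_mult[OF w w] aclass_one .
  then show ?thesis using inv_equality aclass_carrier[OF w] by metis
qed

definition abij :: "'a set \<Rightarrow> ('a \<Rightarrow> 'a \<Rightarrow> enat) \<Rightarrow> 'a \<Rightarrow> 'a gword set bijection" where
  "abij S m s = cayley (artin_group S m) (artin_gen S m s)"

lemma signed_sum_abij: "u \<in> gwords S \<Longrightarrow> signed_sum (abij S m) u = cayley (artin_group S m) (aclass S m u)"
proof (induction u)
  case Nil
  interpret group "artin_group S m" by (rule group_artin_group)
  show ?case using cayley_one by (simp add: aclass_one)
next
  case (Cons a u)
  interpret group "artin_group S m" by (rule group_artin_group)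
  obtain s b where a: "a = (s, b)" by (cases a)
  have s: "s \<in> S" and u: "u \<in> gwords S" using Cons.prems a by (auto simp: gwords_def)
  have w: "[(s, b)] \<in> gwords S" for b using s by (simp add: gwords_def)
  have "cayley (artin_group S m) (aclass S m [(s, b)]) = (if b then abij S m s else - abij S m s)"
    using aclass_gen_inv[OF s, of m] cayley_inv[OF aclass_carrier[OF w[of True]]]
    by (auto simp: abij_def aclass_gen)
  moreover have "aclass S m (a # u) = aclass S m [(s, b)] \<otimes>\<^bsub>artin_group S m\<^esub> aclass S m u"
    using aclass_mult[OF w u] a by simp
  ultimately show ?case
    using Cons.IH[OF u] cayley_mult[OF aclass_carrier[OF w] aclass_carrier[OF u]] a by simp
qed

abbreviation acl :: "'a set \<Rightarrow> ('a \<Rightarrow> 'a \<Rightarrow> enat) \<Rightarrow> 'a gword set set" where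
  "acl S m \<equiv> normal_closure (artin_group S m)
        ((\<lambda>s. artin_gen S m s [^]\<^bsub>artin_group S m\<^esub> (2::nat)) ` S)"

text \<open>Signs may be forgotten because generators of the Coxeter group are their own
  inverses.\<close>

lemma pres_eq_coxeter:
  "pres_eq S (artin_relations S m) u v \<Longrightarrow> wcong (coxeter_rel S m) (map fst u) (map fst v)"
proof (induction rule: pres_eq.induct)
  case (cancel s b)
  then show ?case by (auto intro: wcong_base simp: coxeter_rel_def)
next
  case (rel u v)
  then obtain n s t where st: "u = alt_word n s t" "v = alt_word n t s" "s \<in> S" "t \<in> S" "s \<noteq> t" "m s t = enat n"
    unfolding artin_relations_def by blast
  have "map fst (alt_word n s t) = alt n s t" for s t :: 'a
    unfolding alt_word_eq by (simp add: comp_def)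
  moreover have "(alt n s t, alt n t s) \<in> coxeter_rel S m"
    using st unfolding coxeter_rel_def braid_rel_def by blast
  ultimately show ?case unfolding st by (simp add: wcong_base)
qed (auto intro: wcong.intros)

text \<open>The classes of words that become trivial once signs are forgotten form a normal subgroup
  \<open>K\<close> containing the squares, hence the normal closure.\<close>

lemma normal_closure_coxeter:
  assumes u: "u \<in> gwords S" and "aclass S m u \<in> acl S m"
  shows "wcong (coxeter_rel S m) (map fst u) []"
proof -
  let ?A = "artin_group S m" and ?R = "coxeter_rel S m"
  interpret group ?A by (rule group_artin_group)
  define K where "K = {aclass S m u | u. u \<in> gwords S \<and> wcong ?R (map fst u) []}"
  have K: "aclass S m v \<in> K \<longleftrightarrow> wcong ?R (map fst v) []" if v: "v \<in> gwords S" for v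
  proof
    assume "aclass S m v \<in> K"
    then obtain w where w: "w \<in> gwords S" "aclass S m v = aclass S m w" "wcong ?R (map fst w) []"
      unfolding K_def by blast
    then have "pres_eq S (artin_relations S m) v w" using aclass_eq_iff[OF v w(1)] by blast
    then show "wcong ?R (map fst v) []" using wcong_trans[OF pres_eq_coxeter w(3)] by blast
  qed (use v K_def in blast)
  have Nil: "[] \<in> gwords S" by (simp add: gwords_def)
  have inv: "\<exists>v\<in>gwords S. inv\<^bsub>?A\<^esub> aclass S m u = aclass S m v \<and> wcong ?R (map fst v @ map fst u) []
      \<and> wcong ?R (map fst u @ map fst v) []" if u: "u \<in> gwords S" for u
  proof -
    have uc: "aclass S m u \<in> carrier ?A" using aclass_carrier[OF u] .
    obtain v where v: "v \<in> gwords S" "inv\<^bsub>?A\<^esub> aclass S m u = aclass S m v" using inv_closed[OF uc] by (rule aclassE)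
    have "aclass S m (v @ u) = aclass S m []" "aclass S m (u @ v) = aclass S m []"
      using l_inv[OF uc] r_inv[OF uc] unfolding v(2) aclass_mult[OF v(1) u] aclass_mult[OF u v(1)] aclass_one .
    then have "pres_eq S (artin_relations S m) (v @ u) []" "pres_eq S (artin_relations S m) (u @ v) []"
      using aclass_eq_iff Nil append_in_gwords u v(1) by metis+
    then show ?thesis using pres_eq_coxeter[of S m "v @ u" "[]"] pres_eq_coxeter[of S m "u @ v" "[]"] v by auto
  qed
  have "K \<lhd> ?A"
    unfolding normal_inv_iff
  proof (intro conjI ballI)
    show "subgroup K ?A"
    proof
      show "K \<subseteq> carrier ?A" unfolding K_def using aclass_carrier by blast
      show "\<one>\<^bsub>?A\<^esub> \<in> K" unfolding aclass_one using K[OF Nil] wcong_refl by simp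
      show "x \<otimes>\<^bsub>?A\<^esub> y \<in> K" if xy: "x \<in> K" "y \<in> K" for x y
      proof -
        obtain u v where uv: "u \<in> gwords S" "x = aclass S m u" "wcong ?R (map fst u) []"
          "v \<in> gwords S" "y = aclass S m v" "wcong ?R (map fst v) []"
          using xy unfolding K_def by blast
        have "wcong ?R (map fst (u @ v)) []" using wcong_append[OF uv(3,6)] by simp
        then show ?thesis using K[OF append_in_gwords[OF uv(1,4)]] uv aclass_mult[OF uv(1,4)] by simp
      qed
      show "inv\<^bsub>?A\<^esub> x \<in> K" if xK: "x \<in> K" for x
      proof -
        obtain u where u: "u \<in> gwords S" "x = aclass S m u" "wcong ?R (map fst u) []"
          using xK unfolding K_def by blast
        obtain v where v: "v \<in> gwords S" "inv\<^bsub>?A\<^esub> aclass S m u = aclass S m v" "wcong ?R (map fst v @ map fst u) []"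
          using inv[OF u(1)] by blast
        have "wcong ?R (map fst v) (map fst v @ map fst u)"
          using wcong_sym[OF wcong_prepend[OF u(3), of "map fst v"]] by simp
        then have "wcong ?R (map fst v) []" using wcong_trans v(3) by blast
        then show ?thesis using K[OF v(1)] v(2) u(2) by simp
      qed
    qed
    show "x \<otimes>\<^bsub>?A\<^esub> h \<otimes>\<^bsub>?A\<^esub> inv\<^bsub>?A\<^esub> x \<in> K" if x: "x \<in> carrier ?A" and h: "h \<in> K" for x h
    proof -
      obtain p where p: "p \<in> gwords S" "x = aclass S m p" using x by (rule aclassE)
      obtain u where u: "u \<in> gwords S" "h = aclass S m u" "wcong ?R (map fst u) []"
        using h unfolding K_def by blast
      obtain q where q: "q \<in> gwords S" "inv\<^bsub>?A\<^esub> x = aclass S m q" "wcong ?R (map fst p @ map fst q) []"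
        using inv[OF p(1)] p(2) by blast
      have "wcong ?R (map fst p @ map fst u @ map fst q) (map fst p @ map fst q)"
        using wcong_prepend[OF wcong_postpend[OF u(3)], of "map fst p" "map fst q"] by simp
      then have "wcong ?R (map fst ((p @ u) @ q)) []" using wcong_trans q(3) by fastforce
      moreover have pu: "p @ u \<in> gwords S" using append_in_gwords[OF p(1) u(1)] .
      ultimately show ?thesis
        unfolding q(2) unfolding p(2) u(2) aclass_mult[OF p(1) u(1)] aclass_mult[OF pu q(1)]
        using K[OF append_in_gwords[OF pu q(1)]] by blast
    qed
  qed
  moreover have "(\<lambda>s. artin_gen S m s [^]\<^bsub>?A\<^esub> (2::nat)) ` S \<subseteq> K"
  proof
    fix x assume "x \<in> (\<lambda>s. artin_gen S m s [^]\<^bsub>?A\<^esub> (2::nat)) ` S"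
    then obtain s where s: "s \<in> S" "x = artin_gen S m s [^]\<^bsub>?A\<^esub> (2::nat)" by blast
    have w: "[(s, True)] \<in> gwords S" "[(s, True), (s, True)] \<in> gwords S" using s by (simp_all add: gwords_def)
    have "x = artin_gen S m s \<otimes>\<^bsub>?A\<^esub> artin_gen S m s"
      using s artin_gen_closed[OF s(1)] by (simp add: numeral_2_eq_2)
    also have "\<dots> = aclass S m [(s, True), (s, True)]" unfolding aclass_gen aclass_mult[OF w(1) w(1)] by simp
    also have "\<dots> \<in> K" using K[OF w(2)] s(1) by (auto intro: wcong_base simp: coxeter_rel_def)
    finally show "x \<in> K" .
  qed
  ultimately have "acl S m \<subseteq> K" unfolding normal_closure_def by blast
  then show ?thesis using assms K by blast
qed

definition cbij :: "'a set \<Rightarrow> ('a \<Rightarrow> 'a \<Rightarrow> enat) \<Rightarrow> 'a \<Rightarrow> 'a gword set set bijection" where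
  "cbij S m s = cayley (coxeter_group S m) (acl S m #>\<^bsub>artin_group S m\<^esub> artin_gen S m s)"

lemma acl_normal: "acl S m \<lhd> artin_group S m"
proof -
  interpret group "artin_group S m" by (rule group_artin_group)
  show ?thesis by (rule normal_closure_normal) (auto simp: artin_gen_closed)
qed

lemma sum_cbij:
  assumes "u \<in> lists S"
  shows "sum_list (map (cbij S m) u) =
    cayley (coxeter_group S m) (acl S m #>\<^bsub>artin_group S m\<^esub> aclass S m (map (\<lambda>s. (s, True)) u))"
    and "acl S m #>\<^bsub>artin_group S m\<^esub> aclass S m (map (\<lambda>s. (s, True)) u) \<in> carrier (coxeter_group S m)"
proof -
  let ?A = "artin_group S m"
  interpret A: group ?A by (rule group_artin_group)
  interpret W: group "coxeter_group S m" by (rule group_coxeter_group)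
  interpret N: normal "acl S m" ?A by (rule acl_normal)
  have cos: "acl S m #>\<^bsub>?A\<^esub> x \<in> carrier (coxeter_group S m)" if "x \<in> carrier ?A" for x
    unfolding coxeter_group_def FactGroup_def RCOSETS_def using that by auto
  have mult: "(acl S m #>\<^bsub>?A\<^esub> x) \<otimes>\<^bsub>coxeter_group S m\<^esub> (acl S m #>\<^bsub>?A\<^esub> y) = acl S m #>\<^bsub>?A\<^esub> (x \<otimes>\<^bsub>?A\<^esub> y)"
    if "x \<in> carrier ?A" "y \<in> carrier ?A" for x y
    unfolding coxeter_group_def FactGroup_def using N.rcos_sum[OF that] by simp
  have pos: "map (\<lambda>s. (s, True)) v \<in> gwords S" if "v \<in> lists S" for v :: "'a list"
    using that by (auto simp: gwords_def in_lists_conv_set)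
  show "acl S m #>\<^bsub>?A\<^esub> aclass S m (map (\<lambda>s. (s, True)) u) \<in> carrier (coxeter_group S m)"
    using cos aclass_carrier[OF pos[OF assms]] by blast
  show "sum_list (map (cbij S m) u) =
    cayley (coxeter_group S m) (acl S m #>\<^bsub>?A\<^esub> aclass S m (map (\<lambda>s. (s, True)) u))"
    using assms
  proof (induction u rule: list.induct)
    case Nil
    have "acl S m #>\<^bsub>?A\<^esub> \<one>\<^bsub>?A\<^esub> = \<one>\<^bsub>coxeter_group S m\<^esub>"
      using A.coset_mult_one[OF N.subset] by (simp add: coxeter_group_def FactGroup_def)
    then show ?case using W.cayley_one by (simp add: aclass_one)
  next
    case (Cons s u)
    have s: "s \<in> S" and u: "u \<in> lists S" using Cons.prems by auto
    have w: "[(s, True)] \<in> gwords S" using s by (simp add: gwords_def)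
    have "aclass S m (map (\<lambda>s. (s, True)) (s # u)) = aclass S m [(s, True)] \<otimes>\<^bsub>?A\<^esub> aclass S m (map (\<lambda>s. (s, True)) u)"
      using aclass_mult[OF w pos[OF u], of m] by simp
    then show ?case
      using Cons.IH[OF u] mult[OF aclass_carrier[OF w] aclass_carrier[OF pos[OF u]]]
        W.cayley_mult[OF cos[OF aclass_carrier[OF w]] cos[OF aclass_carrier[OF pos[OF u]]]]
      by (simp add: cbij_def aclass_gen)
  qed
qed

lemma coxeter_system_cbij:
  assumes d: "artin_datum S m" and sph: "spherical_type S m"
  shows "coxeter_system S m (cbij S m)"
proof
  let ?A = "artin_group S m"
  interpret A: group ?A by (rule group_artin_group)
  interpret W: group "coxeter_group S m" by (rule group_coxeter_group)
  interpret N: normal "acl S m" ?A by (rule acl_normal)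
  let ?p = "map (\<lambda>s. (s, True))"
  have pos: "?p v \<in> gwords S" if "v \<in> lists S" for v :: "'a list"
    using that by (auto simp: gwords_def in_lists_conv_set)
  show "artin_datum S m" by (rule d)
  have "(\<lambda>u. sum_list (map (cbij S m) u)) ` lists S \<subseteq> cayley (coxeter_group S m) ` carrier (coxeter_group S m)"
  proof
    fix x assume "x \<in> (\<lambda>u. sum_list (map (cbij S m) u)) ` lists S"
    then obtain u where u: "u \<in> lists S" "x = sum_list (map (cbij S m) u)" by blast
    show "x \<in> cayley (coxeter_group S m) ` carrier (coxeter_group S m)"
      unfolding u(2) sum_cbij(1)[OF u(1)] using sum_cbij(2)[OF u(1)] by (rule imageI)
  qed
  then show "finite ((\<lambda>u. sum_list (map (cbij S m) u)) ` lists S)"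
    using sph finite_subset unfolding spherical_type_def by blast
  have gens: "sum_list (map (cbij S m) u) = sum_list (map (cbij S m) v)" if uv: "(u, v) \<in> coxeter_rel S m" for u v
  proof -
    consider n s t where "u = alt n s t" "v = alt n t s" "s \<in> S" "t \<in> S" "s \<noteq> t" "m s t = enat n"
      | s where "u = [s, s]" "v = []" "s \<in> S"
      using uv unfolding coxeter_rel_def braid_rel_def by blast
    then show ?thesis
    proof cases
      case 1
      have l: "u \<in> lists S" "v \<in> lists S" using 1 alt_lists[of s S t n] alt_lists[of t S s n] by simp_all
      have "(?p u, ?p v) \<in> artin_relations S m"
        unfolding artin_relations_def alt_word_eq 1(1,2) using 1(3-6) by blast
      then have "pres_eq S (artin_relations S m) (?p u) (?p v)" using pos l by (intro pres_eq.rel)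
      then have "aclass S m (?p u) = aclass S m (?p v)" using aclass_eq_iff[OF pos[OF l(1)] pos[OF l(2)]] by blast
      then show ?thesis using sum_cbij(1)[OF l(1)] sum_cbij(1)[OF l(2)] by simp
    next
      case 2
      have w: "[(s, True)] \<in> gwords S" using 2 by (simp add: gwords_def)
      have "artin_gen S m s [^]\<^bsub>?A\<^esub> (2::nat) \<in> acl S m"
        unfolding normal_closure_def using 2 by blast
      moreover have "artin_gen S m s [^]\<^bsub>?A\<^esub> (2::nat) = aclass S m (?p u)"
        using artin_gen_closed[OF 2(3), of m] aclass_mult[OF w w, of m] 2(1)
        by (simp add: numeral_2_eq_2 aclass_gen)
      ultimately have "aclass S m (?p u) \<in> acl S m" by simp
      then have "acl S m #>\<^bsub>?A\<^esub> aclass S m (?p u) = acl S m" using A.coset_join2[OF _ N.subgroup_axioms] N.subset by blast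
      moreover have "acl S m #>\<^bsub>?A\<^esub> aclass S m (?p v) = acl S m"
        using A.coset_mult_one[OF N.subset] 2(2) by (simp add: aclass_one)
      ultimately show ?thesis using sum_cbij(1)[of u S m] sum_cbij(1)[of v S m] 2 by simp
    qed
  qed
  fix u v :: "'a list"
  assume u: "u \<in> lists S" and v: "v \<in> lists S"
  show "sum_list (map (cbij S m) u) = sum_list (map (cbij S m) v) \<longleftrightarrow> wcong (coxeter_rel S m) u v"
  proof
    assume "wcong (coxeter_rel S m) u v"
    then show "sum_list (map (cbij S m) u) = sum_list (map (cbij S m) v)"
      by (induction rule: wcong.induct) (auto simp: gens)
  next
    assume "sum_list (map (cbij S m) u) = sum_list (map (cbij S m) v)"
    then have "acl S m #>\<^bsub>?A\<^esub> aclass S m (?p u) = acl S m #>\<^bsub>?A\<^esub> aclass S m (?p v)"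
      unfolding sum_cbij(1)[OF u] sum_cbij(1)[OF v]
      using W.cayley_inj[OF sum_cbij(2)[OF u] sum_cbij(2)[OF v]] by blast
    then have eq: "acl S m #>\<^bsub>?A\<^esub> aclass S m (?p u) = acl S m #>\<^bsub>?A\<^esub> aclass S m (?p v)" .
    have uc: "aclass S m (?p u) \<in> carrier ?A" and vc: "aclass S m (?p v) \<in> carrier ?A"
      using aclass_carrier[OF pos[OF u]] aclass_carrier[OF pos[OF v]] by blast+
    have "aclass S m (?p u) \<in> acl S m #>\<^bsub>?A\<^esub> aclass S m (?p v)"
      using A.rcos_self[OF uc N.subgroup_axioms] unfolding eq .
    then obtain h where h: "h \<in> acl S m" "aclass S m (?p u) = h \<otimes>\<^bsub>?A\<^esub> aclass S m (?p v)"
      unfolding r_coset_def by blast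
    have "h \<in> carrier ?A" using h(1) N.subset by blast
    then obtain q where q: "q \<in> gwords S" "h = aclass S m q" by (rule aclassE)
    have "wcong (coxeter_rel S m) (map fst q) []"
      using normal_closure_coxeter[OF q(1)] h(1) q(2) by blast
    then have "wcong (coxeter_rel S m) (map fst q @ v) v" using wcong_postpend by fastforce
    moreover have "pres_eq S (artin_relations S m) (?p u) (q @ ?p v)"
      using h(2) aclass_mult[OF q(1) pos[OF v]] aclass_eq_iff[OF pos[OF u] append_in_gwords[OF q(1) pos[OF v]]]
      unfolding q(2) by simp
    then have "wcong (coxeter_rel S m) u (map fst q @ v)"
      using pres_eq_coxeter by (fastforce simp: comp_def)
    ultimately show "wcong (coxeter_rel S m) u v" using wcong_trans by blast
  qed
qed

theorem corollary8p3:
  fixes S :: "'a set" and m :: "'a \<Rightarrow> 'a \<Rightarrow> enat"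
    and P :: "'a gword set set" and \<alpha> \<beta> :: "'a gword set" and k :: int
  assumes "artin_datum S m"
    and "spherical_type S m"
    and "parabolic_subgroup S m P"
    and "\<alpha> \<in> P"
    and "\<beta> \<in> carrier (artin_group S m)"
    and "k \<noteq> 0"
    and "\<beta> [^]\<^bsub>artin_group S m\<^esub> k = \<alpha>"
  shows "\<beta> \<in> P"
proof -
  let ?A = "artin_group S m"
  interpret A: group ?A by (rule group_artin_group)
  interpret coxeter_system S m "cbij S m" by (rule coxeter_system_cbij[OF assms(1,2)])
  interpret artin_system S m "cbij S m" "abij S m"
  proof
    fix u v :: "'a gword" assume uv: "u \<in> gwords S" "v \<in> gwords S"
    show "signed_sum (abij S m) u = signed_sum (abij S m) v \<longleftrightarrow> pres_eq S (artin_relations S m) u v"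
      using A.cayley_inj[OF aclass_carrier[OF uv(1)] aclass_carrier[OF uv(2)]] aclass_eq_iff[OF uv]
      by (simp add: signed_sum_abij[OF uv(1)] signed_sum_abij[OF uv(2)])
  qed
  interpret garside_group "abij S m ` S" gD glen by (rule garside_group)
  let ?i = "cayley ?A"
  obtain X \<gamma> where X: "X \<subseteq> S" and \<gamma>: "\<gamma> \<in> carrier ?A"
    and P: "P = (\<lambda>x. \<gamma> \<otimes>\<^bsub>?A\<^esub> x \<otimes>\<^bsub>?A\<^esub> inv\<^bsub>?A\<^esub> \<gamma>) ` standard_parabolic S m X"
    using assms(3) unfolding parabolic_subgroup_def by blast
  have gens: "artin_gen S m ` Y \<subseteq> carrier ?A" if "Y \<subseteq> S" for Y
    using that artin_gen_closed[of _ S m] by auto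
  have i_gens: "?i ` artin_gen S m ` Y = abij S m ` Y" for Y
    by (simp add: image_image abij_def)
  have in_X: "?i x \<in> gspan (abij S m ` X) \<longleftrightarrow> x \<in> standard_parabolic S m X" if "x \<in> carrier ?A" for x
    using A.cayley_generate[OF gens[OF X] that] unfolding standard_parabolic_def i_gens .
  have X_carrier: "x \<in> carrier ?A" if "x \<in> standard_parabolic S m X" for x
    using A.generate_in_carrier[OF gens[OF X]] that unfolding standard_parabolic_def .
  have in_S: "?i x \<in> gspan (abij S m ` S)" if x: "x \<in> carrier ?A" for x
  proof -
    obtain u where u: "u \<in> gwords S" "x = aclass S m u" using x by (rule aclassE)
    have "signed_sum (abij S m) u \<in> gspan (abij S m ` S)"
      using u(1)
    proof (induction u)
      case (Cons a u)
      obtain s b where a: "a = (s, b)" by (cases a)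
      have "s \<in> S" "u \<in> gwords S" using Cons.prems a by (auto simp: gwords_def)
      then show ?case using Cons.IH a by (auto intro: gspan.intros)
    qed (simp add: grp_zero)
    then show ?thesis using signed_sum_abij[OF u(1)] u(2) by simp
  qed
  obtain x where x: "x \<in> standard_parabolic S m X" "\<alpha> = \<gamma> \<otimes>\<^bsub>?A\<^esub> x \<otimes>\<^bsub>?A\<^esub> inv\<^bsub>?A\<^esub> \<gamma>"
    using assms(4) P by blast
  define b c where "b = ?i \<beta>" and "c = ?i \<gamma>"
  have i\<alpha>: "?i \<alpha> = c + ?i x - c"
    unfolding x(2) c_def using \<gamma> X_carrier[OF x(1)]
    by (simp add: A.cayley_mult A.cayley_inv)
  \<comment> \<open>For negative \<open>k\<close> the inverse of \<open>\<alpha>\<close> takes its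
    place, so that a positive multiple of \<open>b\<close> is a conjugate by \<open>c\<close> of an
    element of the span for \<open>X\<close>.\<close>
  obtain n y where n: "n > 0" "nmul n b = c + y - c" "y \<in> gspan (abij S m ` X)"
  proof (cases "k \<ge> 0")
    case True
    then obtain n where n: "k = int n" using nonneg_int_cases by blast
    then have "nmul n b = ?i \<alpha>"
      using A.cayley_pow[OF assms(5), of n] assms(7) by (simp add: b_def int_pow_int)
    then show ?thesis using that[of n "?i x"] n assms(6) i\<alpha> in_X[OF X_carrier[OF x(1)]] x(1) by simp
  next
    case False
    then obtain n where n: "k = - int n" using nonpos_int_cases[of k] by auto
    then have "inv\<^bsub>?A\<^esub> (\<beta> [^]\<^bsub>?A\<^esub> n) = \<alpha>" using assms(7) A.int_pow_neg_int[OF assms(5)] by simp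
    then have "- nmul n b = ?i \<alpha>"
      using A.cayley_pow[OF assms(5), of n] A.cayley_inv[of "\<beta> [^]\<^bsub>?A\<^esub> n"] assms(5) by (simp add: b_def)
    then have "nmul n b = - (c + ?i x - c)" using i\<alpha> by (metis minus_minus)
    also have "\<dots> = c + - ?i x - c" by (simp add: group_simps del: add_uminus_conv_diff)
    finally have "nmul n b = c + - ?i x - c" .
    moreover have "- ?i x \<in> gspan (abij S m ` X)"
      using grp_neg in_X[OF X_carrier[OF x(1)]] x(1) by blast
    moreover have "n > 0" using n assms(6) by simp
    ultimately show ?thesis using that by blast
  qed
  have conj: "nmul j (- c + b + c) = - c + nmul j b + c" for j
    by (induction j) (simp_all add: group_simps del: add_uminus_conv_diff)
  have "nmul n (- c + b + c) = y"
    unfolding conj n(2) by (simp add: group_simps del: add_uminus_conv_diff)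
  then have root: "- c + b + c \<in> gspan (abij S m ` X)"
    using gspan_root_closed[of "abij S m ` X" "- c + b + c" n] X n
      grp_plus[OF grp_plus[OF grp_neg[OF in_S[OF \<gamma>]] in_S[OF assms(5)]] in_S[OF \<gamma>]]
    unfolding b_def c_def by blast
  define \<delta> where "\<delta> = inv\<^bsub>?A\<^esub> \<gamma> \<otimes>\<^bsub>?A\<^esub> \<beta> \<otimes>\<^bsub>?A\<^esub> \<gamma>"
  have "?i \<delta> = - c + b + c" unfolding \<delta>_def b_def c_def using \<gamma> assms(5)
    by (simp add: A.cayley_mult A.cayley_inv)
  then have "?i \<delta> \<in> gspan (abij S m ` X)" using root by simp
  moreover have "\<delta> \<in> carrier ?A" unfolding \<delta>_def using \<gamma> assms(5) by simp
  ultimately have "\<delta> \<in> standard_parabolic S m X" using in_X by blast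
  moreover have "\<beta> = \<gamma> \<otimes>\<^bsub>?A\<^esub> \<delta> \<otimes>\<^bsub>?A\<^esub> inv\<^bsub>?A\<^esub> \<gamma>"
    unfolding \<delta>_def using \<gamma> assms(5) by (simp add: A.m_assoc[symmetric]) (simp add: A.m_assoc)
  ultimately show ?thesis unfolding P by blast
qed

end
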